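(* Let $V$ be a finite set and $A$ the transition matrix of a reversible, irreducible, aperiodic Markov chain on $V$. For every $\varepsilon>0$ there exist $\delta>0$ and a positive integer $j$ (depending only on $\varepsilon$, $V$, $A$) such that the following holds for every $n\ge 1$. Let $g:V^n\to[0,1]$ with $\langle g,Ag\rangle<\delta$. Then there exist $J\subseteq[n]$ with $|J|\le j$ and $T\subseteq V^J$ such that 1. $\langle \mathbb{1}_T,A\mathbb{1}_T\rangle=0$, and 2. $\mathbb{E}_{x\in V^J}\big[\mathbb{1}_{\overline T}(x)\,\mathbb{E}[g(x,\cdot)]\big]\le\varepsilon$. Moreover, one can take $\delta=\delta_1(\delta_2(\varepsilon/2))$ and $j=j_1(\delta_2(\varepsilon/2))$ (rounded down to an integer), where $\delta_1(\eta)=\eta^{c}$ and $j_1(\eta)=\eta^{-c}$ for a constant $c>0$ depending only on $A$, and $\delta_2(\eta)=1/\mathrm{Tower}(O(\log(1/\eta)))$, i.e. $\delta_2(\eta)=1/\mathrm{Tower}(h(\eta))$ for a function $h:(0,\infty)\to\mathbb{N}$ depending only on $V$ and $A$ with $h(\eta)=O(\log(1/\eta))$ as $\eta\to0$.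
   Context: Let $\mu$ be the unique stationary measure of $A$ on $V$. On $V^m$ (or $V^J$ for a finite index set $J$) we use the product measure $\mu^{\otimes m}$ (written $\mu$) and the product chain $A^{\otimes m}$ (written $A$), acting on functions by $(Ah)(x)=\sum_y A(x,y)h(y)$. Expectations $\mathbb{E}$ and the inner product $\langle f_1,f_2\rangle=\mathbb{E}[f_1f_2]$ are with respect to $\mu$. $\mathbb{1}_T$ is the indicator of $T$ and $\overline T$ its complement. For $x\in V^J$, $g(x,\cdot)$ is the function on $V^{[n]\setminus J}$ obtained by fixing the $J$-coordinates to $x$. $\mathrm{Tower}$ is the tower function: $\mathrm{Tower}(0)=1$, $\mathrm{Tower}(t+1)=2^{\mathrm{Tower}(t)}$. *)

theory Defs
  imports "HOL-Analysis.Analysis" "HOL-Library.Landau_Symbols"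
begin

section \<open>Finite Markov chains\<close>

definition transition_matrix :: "real^'v^'v \<Rightarrow> bool" where
  "transition_matrix A \<longleftrightarrow> (\<forall>x y. 0 \<le> A $ x $ y) \<and> (\<forall>x. (\<Sum>y\<in>UNIV. A $ x $ y) = 1)"

text \<open>The type class power on vectors would be componentwise, so matrix powers are iterated
  matrix products.\<close>

definition mpow :: "real^'v^'v \<Rightarrow> nat \<Rightarrow> real^'v^'v" where
  "mpow A k = (((**) A) ^^ k) (mat 1)"

definition irreducible_chain :: "real^'v^'v \<Rightarrow> bool" where
  "irreducible_chain A \<longleftrightarrow> (\<forall>x y. \<exists>k. 0 < mpow A k $ x $ y)"

definition aperiodic_chain :: "real^'v^'v \<Rightarrow> bool" where
  "aperiodic_chain A \<longleftrightarrow> (\<forall>x. Gcd {k. 1 \<le> k \<and> 0 < mpow A k $ x $ x} = 1)"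

definition distribution :: "real^'v \<Rightarrow> bool" where
  "distribution p \<longleftrightarrow> (\<forall>x. 0 \<le> p $ x) \<and> (\<Sum>x\<in>UNIV. p $ x) = 1"

definition reversible_chain :: "real^'v^'v \<Rightarrow> bool" where
  "reversible_chain A \<longleftrightarrow>
     (\<exists>p. distribution p \<and> (\<forall>x y. p $ x * A $ x $ y = p $ y * A $ y $ x))"

definition is_stationary :: "real^'v^'v \<Rightarrow> real^'v \<Rightarrow> bool" where
  "is_stationary A p \<longleftrightarrow> distribution p \<and> p v* A = p"

text \<open>The description is meaningful for the chains considered here, by
  \<open>ex1_stationary\<close> below.\<close>

definition stationary_measure :: "real^'v^'v \<Rightarrow> real^'v" where
  "stationary_measure A = (THE p. is_stationary A p)"

lemma mpow_simps [simp]: "mpow A 0 = mat 1" "mpow A (Suc k) = A ** mpow A k"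
  by (simp_all add: mpow_def)

lemma mpow_nonneg: "transition_matrix A \<Longrightarrow> 0 \<le> mpow A k $ x $ y"
  by (induction k arbitrary: x y)
    (auto simp: mat_def matrix_matrix_mult_def transition_matrix_def intro!: sum_nonneg)

lemma mpow_harmonic: "A *v f = f \<Longrightarrow> mpow A k *v f = f"
  by (induction k) (simp_all add: matrix_vector_mul_assoc [symmetric])

lemma mpow_stationary: "p v* A = p \<Longrightarrow> p v* mpow A k = p"
  by (induction k) (simp_all add: vector_matrix_mul_assoc [symmetric])

lemma stationary_pos:
  assumes A: "transition_matrix A" "irreducible_chain A" and p: "is_stationary A p"
  shows "0 < p $ y"
proof -
  have nn: "0 \<le> p $ x" for x
    using p by (auto simp: is_stationary_def distribution_def)
  obtain x where x: "0 < p $ x"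
    using p nn by (metis is_stationary_def distribution_def less_eq_real_def sum.neutral zero_neq_one)
  obtain k where k: "0 < mpow A k $ x $ y"
    using A by (auto simp: irreducible_chain_def)
  have "0 < p $ x * mpow A k $ x $ y"
    using x k by simp
  also have "\<dots> \<le> (\<Sum>z\<in>UNIV. p $ z * mpow A k $ z $ y)"
    by (rule member_le_sum) (auto intro!: mult_nonneg_nonneg nn mpow_nonneg A)
  also have "\<dots> = (p v* mpow A k) $ y"
    by (simp add: vector_matrix_mult_def)
  also have "\<dots> = p $ y"
    using p mpow_stationary by (metis is_stationary_def)
  finally show ?thesis .
qed

lemma harmonic_const:
  assumes A: "transition_matrix A" "irreducible_chain A" and f: "A *v f = f"
  shows "f $ y = f $ x"
proof -
  define m where "m = Min (range (\<lambda>z. f $ z))"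
  have mle: "m \<le> f $ z" for z
    by (simp add: m_def)
  have "m \<in> range (\<lambda>z. f $ z)"
    unfolding m_def by (rule Min_in) auto
  then obtain w where w: "f $ w = m" by auto
  have row: "A *v 1 = 1"
    using A by (simp add: transition_matrix_def matrix_vector_mult_def vec_eq_iff)
  have "f $ z = m" for z
  proof -
    obtain k where k: "0 < mpow A k $ w $ z"
      using A by (auto simp: irreducible_chain_def)
    have "(\<Sum>u\<in>UNIV. mpow A k $ w $ u * (f $ u - m)) =
            (mpow A k *v f) $ w - m * (mpow A k *v 1) $ w"
      by (simp add: matrix_vector_mult_def algebra_simps sum_subtractf sum_distrib_left)
    also have "\<dots> = 0"
      using w mpow_harmonic [OF f] mpow_harmonic [OF row] by simp
    finally have "mpow A k $ w $ z * (f $ z - m) = 0"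
      using mle by (subst (asm) sum_nonneg_eq_0_iff) (auto intro!: mult_nonneg_nonneg mpow_nonneg A)
    then show ?thesis using k by simp
  qed
  then show ?thesis by simp
qed

lemma ex1_stationary:
  fixes A :: "real^'v^'v"
  assumes A: "transition_matrix A" "irreducible_chain A" and R: "reversible_chain A"
  shows "\<exists>!p. is_stationary A p"
proof -
  obtain p where p: "distribution p"
    and db: "\<And>x y. p $ x * A $ x $ y = p $ y * A $ y $ x"
    using R by (auto simp: reversible_chain_def)
  have "(\<Sum>x\<in>UNIV. p $ x * A $ x $ y) = p $ y" for y
  proof -
    have "(\<Sum>x\<in>UNIV. p $ x * A $ x $ y) = p $ y * (\<Sum>x\<in>UNIV. A $ y $ x)"
      unfolding sum_distrib_left by (rule sum.cong) (auto simp: db)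
    then show ?thesis using A by (simp add: transition_matrix_def)
  qed
  then have ps: "is_stationary A p"
    using p by (simp add: is_stationary_def vec_eq_iff vector_matrix_mult_def mult.commute)
  have pos: "0 < p $ x" for x
    using stationary_pos A ps by blast
  have "q = p" if q: "is_stationary A q" for q
  proof -
    define f :: "real^'v" where "f = (\<chi> x. q $ x / p $ x)"
    have "(\<Sum>y\<in>UNIV. A $ x $ y * f $ y) = f $ x" for x
    proof -
      have "A $ x $ y * f $ y = (q $ y * A $ y $ x) / p $ x" for y
        using db [of x y] pos [of x] pos [of y] by (simp add: f_def field_simps)
      then have "(\<Sum>y\<in>UNIV. A $ x $ y * f $ y) = (q v* A) $ x / p $ x"
        by (simp add: sum_divide_distrib vector_matrix_mult_def mult.commute)
      then show ?thesis using q by (simp add: is_stationary_def f_def)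
    qed
    then have "A *v f = f"
      by (simp add: matrix_vector_mult_def vec_eq_iff)
    then obtain c where c: "\<And>x. f $ x = c"
      using harmonic_const A by metis
    have eq: "q $ x = c * p $ x" for x
      using c [of x] pos [of x] by (simp add: f_def field_simps)
    have "(\<Sum>x\<in>UNIV. q $ x) = c * (\<Sum>x\<in>UNIV. p $ x)"
      by (simp add: eq sum_distrib_left)
    then have "c = 1"
      using p q by (simp add: is_stationary_def distribution_def)
    then show ?thesis using eq by (simp add: vec_eq_iff)
  qed
  then show ?thesis using ps by blast
qed


section \<open>Product spaces\<close>

text \<open>The set \<open>V\<^sup>J\<close> is the set of extensional functions on \<open>J\<close> (the value outside \<open>J\<close> is
  \<open>undefined\<close>), and \<open>V\<^sup>n\<close> is \<open>V\<^sup>[\<^sup>n\<^sup>]\<close> with \<open>[n] = {1..n}\<close>.\<close>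

abbreviation cube :: "nat set \<Rightarrow> (nat \<Rightarrow> 'v) set" where
  "cube J \<equiv> PiE J (\<lambda>_. UNIV)"

definition expect :: "real^'v^'v \<Rightarrow> nat set \<Rightarrow> ((nat \<Rightarrow> 'v) \<Rightarrow> real) \<Rightarrow> real" where
  "expect A J f = (\<Sum>x\<in>cube J. (\<Prod>i\<in>J. stationary_measure A $ x i) * f x)"

definition chain_op ::
    "real^'v^'v \<Rightarrow> nat set \<Rightarrow> ((nat \<Rightarrow> 'v) \<Rightarrow> real) \<Rightarrow> (nat \<Rightarrow> 'v) \<Rightarrow> real" where
  "chain_op A J f x = (\<Sum>y\<in>cube J. (\<Prod>i\<in>J. A $ x i $ y i) * f y)"

definition inner_prod ::
    "real^'v^'v \<Rightarrow> nat set \<Rightarrow> ((nat \<Rightarrow> 'v) \<Rightarrow> real) \<Rightarrow> ((nat \<Rightarrow> 'v) \<Rightarrow> real) \<Rightarrow> real" where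
  "inner_prod A J f1 f2 = expect A J (\<lambda>x. f1 x * f2 x)"

text \<open>The function \<open>g(x,\<cdot>)\<close> on the coordinates in \<open>[n] - J\<close>, with the coordinates in \<open>J\<close>
  fixed to \<open>x\<close>.\<close>

definition restr :: "nat \<Rightarrow> nat set \<Rightarrow> ((nat \<Rightarrow> 'v) \<Rightarrow> real) \<Rightarrow> (nat \<Rightarrow> 'v) \<Rightarrow> (nat \<Rightarrow> 'v) \<Rightarrow> real" where
  "restr n J g x = (\<lambda>z. g (merge J ({1..n} - J) (x, z)))"

definition almost_in_juntas :: "real^'v^'v \<Rightarrow> real \<Rightarrow> real \<Rightarrow> nat \<Rightarrow> bool" where
  "almost_in_juntas A \<epsilon> \<delta> j \<longleftrightarrow>
     (\<forall>n\<ge>1. \<forall>g. (\<forall>x\<in>cube {1..n}. 0 \<le> g x \<and> g x \<le> 1) \<longrightarrow>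
        inner_prod A {1..n} g (chain_op A {1..n} g) < \<delta> \<longrightarrow>
        (\<exists>J T. J \<subseteq> {1..n} \<and> card J \<le> j \<and> T \<subseteq> cube J \<and>
           inner_prod A J (indicator T) (chain_op A J (indicator T)) = 0 \<and>
           expect A J (\<lambda>x. indicator (cube J - T) x * expect A ({1..n} - J) (restr n J g x)) \<le> \<epsilon>))"


section \<open>The quantitative bounds\<close>

fun tower :: "nat \<Rightarrow> nat" where
  "tower 0 = 1"
| "tower (Suc t) = 2 ^ tower t"

definition \<delta>\<^sub>1 :: "real \<Rightarrow> real \<Rightarrow> real" where
  "\<delta>\<^sub>1 c \<eta> = \<eta> powr c"

definition j\<^sub>1 :: "real \<Rightarrow> real \<Rightarrow> real" where
  "j\<^sub>1 c \<eta> = \<eta> powr (- c)"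

definition \<delta>\<^sub>2 :: "(real \<Rightarrow> nat) \<Rightarrow> real \<Rightarrow> real" where
  "\<delta>\<^sub>2 h \<eta> = 1 / real (tower (h \<eta>))"

end

theory Submission
  imports Defs
begin

text \<open>There are two halves. First, a function with small correlation \<open>\<langle>g, Ag\<rangle>\<close> depends, up to a small error,
  on few coordinates. Expanding in eigenfunctions of \<open>A\<close>, the Lindeberg replacement argument
  moves a function without influential coordinates to a different space and a different chain with the same
  correlations but with full support, where reverse hypercontractivity bounds correlations from
  below. Hence two functions of small correlation and substantial mean share an influential coordinate.
  If \<open>J\<close> is chosen so that no coordinate outside it carries much low-degree weight, then the set of
  restrictions having a given influential coordinate is small, and small-set expansion shows that few edges of
  \<open>V\<^sup>J\<close> join two restrictions of substantial mean.

  Second, a set of vertices spanning few edges is made independent as in Fox's proof of the graph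
  removal lemma. Otherwise it carries a fractional matching along its edges. The first half, applied to the
  fibres over every matched edge, yields a refinement which raises the entropy of the
  matched mass by a constant fraction of that mass; since the entropy of a density of mass \<open>\<epsilon>\<close> ranges over an
  interval of length \<open>\<epsilon> ln (1/\<epsilon>)\<close>, there are only \<open>O(ln (1/\<epsilon>))\<close> steps, each of which is a bounded
  number of exponentials.\<close>

section \<open>Sums over product spaces\<close>

text \<open>Reverse hypercontractivity needs a kernel bounded below by a multiple of the product
  law. \<open>A\<close> may have zero entries, and then two sets of positive measure in V^n can have
  correlation 0. What a function without influential coordinates sees of the chain is only its
  eigenvalues, so another chain with these eigenvalues may take over. Room for full support is made
  by first splitting some noise off both functions: the eigenvalues that remain are still bounded
  away from 1 in modulus, and the noise is also what permits truncation to low degree.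

  Every loss in the first half is a power of \<open>(1 / 2) ^ m\<close> with an exponent independent
  of \<open>m\<close>, so that half is polynomial. The tower comes from the iteration alone: once
  \<open>N\<close> coordinates are fixed, up to \<open>CARD('v) ^ (2 * N)\<close> pairs of vertices
  have to be treated before the next step. The polynomial losses then disappear in boundedly many or
  \<open>O(ln (1/\<epsilon>))\<close> further levels of the tower.\<close>

definition pexp :: "(nat \<Rightarrow> 'w \<Rightarrow> real) \<Rightarrow> nat set \<Rightarrow> ((nat \<Rightarrow> 'w) \<Rightarrow> real) \<Rightarrow> real" where
  "pexp r I F = (\<Sum>x\<in>cube I. (\<Prod>i\<in>I. r i (x i)) * F x)"

text \<open>\<open>K\<close> is a joint weight and not a transition kernel, so that both marginals
  and the symmetry of a reversible chain are visible. \<open>pexp\<close> lets the weight vary with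
  the coordinate because the replacement argument passes through hybrid product measures.\<close>

definition dexp :: "('w \<Rightarrow> 'w \<Rightarrow> real) \<Rightarrow> nat set \<Rightarrow> ((nat \<Rightarrow> 'w) \<Rightarrow> (nat \<Rightarrow> 'w) \<Rightarrow> real) \<Rightarrow> real" where
  "dexp K I F = (\<Sum>x\<in>cube I. \<Sum>y\<in>cube I. (\<Prod>i\<in>I. K (x i) (y i)) * F x y)"

lemma finite_cube [simp]: "finite I \<Longrightarrow> finite (cube I :: (nat \<Rightarrow> 'w::finite) set)"
  by (simp add: finite_PiE)

lemma sum_cube_insert:
  assumes "i \<notin> I"
  shows "(\<Sum>x\<in>cube (insert i I). G (x :: nat \<Rightarrow> 'w::finite)) = (\<Sum>w\<in>UNIV. \<Sum>x\<in>cube I. G (x(i := w)))"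
proof -
  have inj: "inj_on (\<lambda>(y::'w, g). g(i := y)) (UNIV \<times> cube I)"
    using inj_combinator [OF assms, of "\<lambda>_. UNIV"] .
  show ?thesis
    unfolding PiE_insert_eq sum.cartesian_product
    by (subst sum.reindex [OF inj]) (simp add: case_prod_unfold comp_def)
qed

lemma bij_betw_merge:
  assumes "I \<inter> J = {}"
  shows "bij_betw (merge I J) (cube I \<times> cube J) (cube (I \<union> J) :: (nat \<Rightarrow> 'w) set)"
  by (rule bij_betw_byWitness [where f' = "\<lambda>x. (restrict x I, restrict x J)"])
    (use assms in \<open>auto simp: merge_def PiE_def extensional_def fun_eq_iff restrict_def\<close>)

lemma sum_cube_union:
  assumes "I \<inter> J = {}"
  shows "(\<Sum>x\<in>cube (I \<union> J). G (x :: nat \<Rightarrow> 'w)) = (\<Sum>x\<in>cube I. \<Sum>y\<in>cube J. G (merge I J (x, y)))"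
  unfolding sum.cartesian_product
  by (subst sum.reindex_bij_betw [OF bij_betw_merge [OF assms], symmetric]) (simp add: case_prod_unfold)

lemma merge_in_cube [simp]: "merge I J (x, y) \<in> cube (I \<union> J)"
  by (simp add: PiE_def)

lemma prod_union_merge:
  assumes "finite I" "finite J" "I \<inter> J = {}"
  shows "(\<Prod>i\<in>I \<union> J. (h i (merge I J (x, y) i) :: real)) = (\<Prod>i\<in>I. h i (x i)) * (\<Prod>i\<in>J. h i (y i))"
  using assms by (subst prod.union_disjoint) (auto simp: assms intro!: arg_cong2 [where f = "(*)"] prod.cong)

lemma prod_union_merge2:
  assumes "finite I" "finite J" "I \<inter> J = {}"
  shows "(\<Prod>i\<in>I \<union> J. (h (merge I J (x, y) i) (merge I J (x', y') i) :: real)) =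
    (\<Prod>i\<in>I. h (x i) (x' i)) * (\<Prod>i\<in>J. h (y i) (y' i))"
  using assms by (subst prod.union_disjoint) (auto simp: assms intro!: arg_cong2 [where f = "(*)"] prod.cong)

lemma pexp_union:
  assumes "finite I" "finite J" "I \<inter> J = {}"
  shows "pexp r (I \<union> J) F = pexp r I (\<lambda>x. pexp r J (\<lambda>y. F (merge I J (x, y))))"
  unfolding pexp_def
  by (subst sum_cube_union [OF assms(3)])
    (simp add: prod_union_merge [OF assms] sum_distrib_left mult.assoc)

lemma dexp_union:
  assumes "finite I" "finite J" "I \<inter> J = {}"
  shows "dexp K (I \<union> J) F =
    dexp K I (\<lambda>x x'. dexp K J (\<lambda>y y'. F (merge I J (x, y)) (merge I J (x', y'))))"
proof -
  have "dexp K (I \<union> J) F = (\<Sum>x\<in>cube I. \<Sum>y\<in>cube J. \<Sum>x'\<in>cube I. \<Sum>y'\<in>cube J.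
      (\<Prod>i\<in>I. K (x i) (x' i)) * ((\<Prod>i\<in>J. K (y i) (y' i)) * F (merge I J (x, y)) (merge I J (x', y'))))"
    unfolding dexp_def sum_cube_union [OF assms(3)] prod_union_merge2 [OF assms] mult.assoc ..
  also have "\<dots> = (\<Sum>x\<in>cube I. \<Sum>x'\<in>cube I. \<Sum>y\<in>cube J. \<Sum>y'\<in>cube J.
      (\<Prod>i\<in>I. K (x i) (x' i)) * ((\<Prod>i\<in>J. K (y i) (y' i)) * F (merge I J (x, y)) (merge I J (x', y'))))"
    by (intro sum.cong refl sum.swap)
  finally show ?thesis
    by (simp add: dexp_def sum_distrib_left)
qed

lemma pexp_cong [cong]:
  assumes "r = r'" "I = I'" "\<And>x. x \<in> cube I' \<Longrightarrow> F x = F' x" shows "pexp r I F = pexp r' I' F'"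
  using assms by (simp add: pexp_def cong: sum.cong)

lemma dexp_cong [cong]:
  assumes "K = K'" "I = I'" "\<And>x y. x \<in> cube I' \<Longrightarrow> y \<in> cube I' \<Longrightarrow> F x y = F' x y"
  shows "dexp K I F = dexp K' I' F'"
  using assms by (simp add: dexp_def cong: sum.cong)

lemma pexp_cong_measure:
  assumes "\<And>i. i \<in> I \<Longrightarrow> r i = r' i" shows "pexp r I F = pexp r' I F"
  using assms by (simp add: pexp_def cong: prod.cong)

lemma pexp_empty [simp]: "pexp r {} F = F (\<lambda>_. undefined)"
  by (simp add: pexp_def)

lemma dexp_empty [simp]: "dexp K {} F = F (\<lambda>_. undefined) (\<lambda>_. undefined)"
  by (simp add: dexp_def)

lemma prod_upd: "i \<notin> I \<Longrightarrow> (\<Prod>j\<in>I. h j ((x(i := w)) j)) = (\<Prod>j\<in>I. h j (x j))"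
  by (intro prod.cong) auto

lemma prod_upd2: "i \<notin> I \<Longrightarrow> (\<Prod>j\<in>I. h ((x(i := w)) j) ((y(i := v)) j)) = (\<Prod>j\<in>I. h (x j) (y j))"
  by (intro prod.cong) auto

lemma pexp_insert:
  fixes r :: "nat \<Rightarrow> 'w::finite \<Rightarrow> real"
  assumes "finite I" "i \<notin> I"
  shows "pexp r (insert i I) F = (\<Sum>w\<in>UNIV. r i w * pexp r I (\<lambda>x. F (x(i := w))))"
  unfolding pexp_def sum_cube_insert [OF assms(2)]
  using assms by (simp add: prod_upd sum_distrib_left mult.assoc del: fun_upd_apply) simp

lemma dexp_insert:
  fixes K :: "'w::finite \<Rightarrow> 'w \<Rightarrow> real"
  assumes "finite I" "i \<notin> I"
  shows "dexp K (insert i I) F =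
    (\<Sum>w\<in>UNIV. \<Sum>v\<in>UNIV. K w v * dexp K I (\<lambda>x y. F (x(i := w)) (y(i := v))))"
proof -
  have "dexp K (insert i I) F = (\<Sum>w\<in>UNIV. \<Sum>x\<in>cube I. \<Sum>v\<in>UNIV. \<Sum>y\<in>cube I.
      K w v * ((\<Prod>i\<in>I. K (x i) (y i)) * F (x(i := w)) (y(i := v))))"
    unfolding dexp_def sum_cube_insert [OF assms(2)]
    by (simp only: prod.insert [OF assms] prod_upd2 [OF assms(2)] fun_upd_same mult.assoc)
  also have "\<dots> = (\<Sum>w\<in>UNIV. \<Sum>v\<in>UNIV. \<Sum>x\<in>cube I. \<Sum>y\<in>cube I.
      K w v * ((\<Prod>i\<in>I. K (x i) (y i)) * F (x(i := w)) (y(i := v))))"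
    by (intro sum.cong refl sum.swap)
  finally show ?thesis
    by (simp add: dexp_def sum_distrib_left)
qed

lemma pexp_prod:
  fixes r :: "nat \<Rightarrow> 'w::finite \<Rightarrow> real"
  assumes "finite I"
  shows "pexp r I (\<lambda>x. \<Prod>i\<in>I. F i (x i)) = (\<Prod>i\<in>I. \<Sum>w\<in>UNIV. r i w * F i w)"
  unfolding pexp_def by (simp add: prod_sum_PiE [OF assms] prod.distrib)

lemma dexp_prod:
  fixes K :: "'w::finite \<Rightarrow> 'w \<Rightarrow> real"
  assumes "finite I"
  shows "dexp K I (\<lambda>x y. \<Prod>i\<in>I. F i (x i) (y i)) = (\<Prod>i\<in>I. \<Sum>w\<in>UNIV. \<Sum>v\<in>UNIV. K w v * F i w v)"
  using assms
proof (induction I)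
  case (insert i I)
  have "(\<Prod>j\<in>insert i I. F j ((x(i := w)) j) ((y(i := v)) j)) = F i w v * (\<Prod>j\<in>I. F j (x j) (y j))" for x y w v
    using insert by (auto intro!: prod.cong)
  moreover have "dexp K I (\<lambda>x y. c * G x y) = c * dexp K I G" for c and G :: "(nat \<Rightarrow> 'w) \<Rightarrow> (nat \<Rightarrow> 'w) \<Rightarrow> real"
    by (simp add: dexp_def sum_distrib_left mult_ac)
  ultimately show ?case
    using insert by (simp add: dexp_insert sum_distrib_right mult.assoc del: prod.insert)
      (simp add: insert sum_distrib_right mult.assoc)
qed simp

lemma pexp_add: "pexp r I (\<lambda>x. F x + G x) = pexp r I F + pexp r I G"
  by (simp add: pexp_def sum.distrib algebra_simps)

lemma pexp_diff: "pexp r I (\<lambda>x. F x - G x) = pexp r I F - pexp r I G"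
  by (simp add: pexp_def sum_subtractf algebra_simps)

lemma pexp_cmult: "pexp r I (\<lambda>x. c * F x) = c * pexp r I F"
  by (simp add: pexp_def sum_distrib_left mult_ac)

lemma pexp_sum: "pexp r I (\<lambda>x. \<Sum>a\<in>S. F a x) = (\<Sum>a\<in>S. pexp r I (F a))"
  unfolding pexp_def by (simp add: sum_distrib_left) (rule sum.swap)

lemma pexp_zero [simp]: "pexp r I (\<lambda>x. 0) = 0"
  by (simp add: pexp_def)

lemma dexp_add: "dexp r I (\<lambda>x y. F x y + G x y) = dexp r I F + dexp r I G"
  by (simp add: dexp_def sum.distrib algebra_simps)

lemma dexp_cmult: "dexp r I (\<lambda>x y. c * F x y) = c * dexp r I F"
  by (simp add: dexp_def sum_distrib_left mult_ac)

lemma dexp_sum: "dexp r I (\<lambda>x y. \<Sum>a\<in>S. F a x y) = (\<Sum>a\<in>S. dexp r I (F a))"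
  by (induction S rule: infinite_finite_induct) (simp_all add: dexp_add, simp_all add: dexp_def)

lemma pexp_mono:
  assumes "\<And>i w. i \<in> I \<Longrightarrow> 0 \<le> r i w" "\<And>x. x \<in> cube I \<Longrightarrow> F x \<le> G x"
  shows "pexp r I F \<le> pexp r I G"
  unfolding pexp_def by (intro sum_mono mult_left_mono prod_nonneg ballI) (use assms in auto)

lemma dexp_mono:
  assumes "\<And>v w. 0 \<le> K v w" "\<And>x y. x \<in> cube I \<Longrightarrow> y \<in> cube I \<Longrightarrow> F x y \<le> G x y"
  shows "dexp K I F \<le> dexp K I G"
  unfolding dexp_def by (intro sum_mono mult_left_mono prod_nonneg ballI) (use assms in auto)

lemma pexp_nonneg:
  assumes "\<And>i w. i \<in> I \<Longrightarrow> 0 \<le> r i w" "\<And>x. x \<in> cube I \<Longrightarrow> 0 \<le> F x"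
  shows "0 \<le> pexp r I F"
  using pexp_mono [of I r "\<lambda>_. 0" F] assms by simp

lemma dexp_nonneg:
  assumes "\<And>v w. 0 \<le> K v w" "\<And>x y. x \<in> cube I \<Longrightarrow> y \<in> cube I \<Longrightarrow> 0 \<le> F x y"
  shows "0 \<le> dexp K I F"
  unfolding dexp_def by (intro sum_nonneg mult_nonneg_nonneg prod_nonneg ballI) (use assms in auto)

lemma pexp_const:
  fixes r :: "nat \<Rightarrow> 'w::finite \<Rightarrow> real"
  assumes "finite I" "\<And>i. i \<in> I \<Longrightarrow> (\<Sum>w\<in>UNIV. r i w) = 1"
  shows "pexp r I (\<lambda>_. c) = c"
  using pexp_prod [OF assms(1), of r "\<lambda>_ _. 1"] assms(2) pexp_cmult [of r I c "\<lambda>_. 1"] by simp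

lemma pexp_CS:
  assumes "\<And>i w. i \<in> I \<Longrightarrow> 0 \<le> r i w"
  shows "(pexp r I (\<lambda>x. F x * G x))\<^sup>2 \<le> pexp r I (\<lambda>x. (F x)\<^sup>2) * pexp r I (\<lambda>x. (G x)\<^sup>2)"
proof -
  define m where "m x = sqrt (\<Prod>i\<in>I. r i (x i))" for x
  have m: "(\<Prod>i\<in>I. r i (x i)) = (m x)\<^sup>2" for x
    by (simp add: m_def prod_nonneg assms)
  have "(\<Sum>x\<in>cube I. (m x * F x) * (m x * G x))\<^sup>2 \<le>
      (\<Sum>x\<in>cube I. (m x * F x)\<^sup>2) * (\<Sum>x\<in>cube I. (m x * G x)\<^sup>2)"
    by (rule Cauchy_Schwarz_ineq_sum)
  then show ?thesis
    by (simp add: pexp_def m power2_eq_square mult_ac)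
qed

lemma dexp_left:
  fixes K :: "'w::finite \<Rightarrow> 'w \<Rightarrow> real"
  assumes "finite I" "\<And>w. (\<Sum>v\<in>UNIV. K w v) = r w"
  shows "dexp K I (\<lambda>x y. F x) = pexp (\<lambda>_. r) I F"
proof -
  have "(\<Sum>y\<in>cube I. (\<Prod>i\<in>I. K (x i) (y i)) * F x) = (\<Prod>i\<in>I. r (x i)) * F x" for x
  proof -
    have "(\<Sum>y\<in>cube I. \<Prod>i\<in>I. K (x i) (y i)) = (\<Prod>i\<in>I. r (x i))"
      using prod_sum_PiE [OF assms(1), of "\<lambda>_. UNIV" "\<lambda>i v. K (x i) v"] by (simp add: assms(2))
    then show ?thesis by (simp add: sum_distrib_right [symmetric])
  qed
  then show ?thesis by (simp add: dexp_def pexp_def)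
qed

lemma dexp_swap: "dexp K I F = dexp (\<lambda>x y. K y x) I (\<lambda>x y. F y x)"
  unfolding dexp_def by (rule sum.swap)

lemma dexp_right:
  fixes K :: "'w::finite \<Rightarrow> 'w \<Rightarrow> real"
  assumes "finite I" "\<And>w. (\<Sum>v\<in>UNIV. K v w) = r w"
  shows "dexp K I (\<lambda>x y. F y) = pexp (\<lambda>_. r) I F"
  by (subst dexp_swap) (rule dexp_left [OF assms])

text \<open>Change of variables: the hypothesis says, through test functions, that
  \<open>r i\<close> is the image of \<open>s i\<close> under \<open>\<phi>\<close>. It serves to
  compute an integral over a sum type on the summand that carries the measure.\<close>

lemma pexp_image:
  fixes r :: "nat \<Rightarrow> 'w::finite \<Rightarrow> real" and s :: "nat \<Rightarrow> 'u::finite \<Rightarrow> real"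
  assumes "finite I" "\<And>i G. i \<in> I \<Longrightarrow> (\<Sum>w\<in>UNIV. r i w * G w) = (\<Sum>u\<in>UNIV. s i u * G (\<phi> u))"
  shows "pexp r I F = pexp s I (\<lambda>x. F (\<lambda>i\<in>I. \<phi> (x i)))"
  using assms
proof (induction I arbitrary: F)
  case empty then show ?case by (simp add: restrict_def)
next
  case (insert i I)
  have *: "(\<lambda>j\<in>insert i I. \<phi> ((x(i := u)) j)) = (\<lambda>j\<in>I. \<phi> (x j))(i := \<phi> u)" for x u
    using insert.hyps by (auto simp: restrict_def fun_eq_iff)
  have IH: "pexp r I G = pexp s I (\<lambda>x. G (\<lambda>j\<in>I. \<phi> (x j)))" for G
    by (rule insert.IH) (rule insert.prems, simp)
  have "pexp r (insert i I) F = (\<Sum>w\<in>UNIV. r i w * pexp s I (\<lambda>x. F ((\<lambda>j\<in>I. \<phi> (x j))(i := w))))"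
    by (simp only: pexp_insert [OF insert.hyps] IH)
  also have "\<dots> = (\<Sum>u\<in>UNIV. s i u * pexp s I (\<lambda>x. F ((\<lambda>j\<in>I. \<phi> (x j))(i := \<phi> u))))"
    by (rule insert.prems) simp
  finally show ?case
    by (simp only: pexp_insert [OF insert.hyps] *)
qed

section \<open>Spectral decomposition of the chain\<close>

text \<open>The orthogonal complement \<open>U\<close> of \<open>S\<close> is invariant, since
  \<open>B\<close> is symmetric and \<open>S\<close> consists of eigenvectors. A maximizer of the
  quadratic form of \<open>B\<close> on the unit sphere of \<open>U\<close> is a new eigenvector, by
  the first-order condition in the direction of the residue \<open>w\<close>.\<close>

lemma symmetric_extend_eigenvectors:
  fixes B :: "real^'n^'n"
  assumes sym: "transpose B = B" and S: "finite S" "card S < CARD('n)"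
    and eig: "\<And>x. x \<in> S \<Longrightarrow> \<exists>l. B *v x = l *\<^sub>R x"
  shows "\<exists>v l. norm v = 1 \<and> (\<forall>x\<in>S. x \<bullet> v = 0) \<and> B *v v = l *\<^sub>R v"
proof -
  have symB: "x \<bullet> (B *v y) = (B *v x) \<bullet> y" for x y
    by (metis dot_lmul_matrix sym transpose_matrix_vector)
  define U where "U = {x. \<forall>s\<in>S. s \<bullet> x = 0}"
  have BU: "B *v x \<in> U" if "x \<in> U" for x
    using that eig by (fastforce simp: U_def symB)
  have "dim S < DIM(real^'n)"
    using dim_le_card' [OF S(1)] S(2) by simp
  then obtain x0 where x0: "x0 \<noteq> 0" "\<And>y. y \<in> span S \<Longrightarrow> orthogonal x0 y"
    using orthogonal_to_subspace_exists by blast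
  have x0U: "(1 / norm x0) *\<^sub>R x0 \<in> sphere 0 1 \<inter> U"
    using x0 span_base [of _ S] by (auto simp: U_def orthogonal_def inner_commute)
  have "U = (\<Inter>s\<in>S. {x. s \<bullet> x = 0})"
    by (auto simp: U_def)
  then have "closed U"
    by (simp add: closed_INT closed_hyperplane)
  then have "compact (sphere 0 1 \<inter> U)"
    by (simp add: compact_Int_closed)
  moreover have "sphere 0 1 \<inter> U \<noteq> {}"
    using x0U by blast
  moreover have "continuous_on (sphere 0 1 \<inter> U) (\<lambda>x. x \<bullet> (B *v x))"
    by (intro continuous_intros linear_continuous_on) (simp add: bounded_linear_def linear_conv_bounded_linear [symmetric])
  ultimately have "\<exists>v\<in>sphere 0 1 \<inter> U. \<forall>x\<in>sphere 0 1 \<inter> U. x \<bullet> (B *v x) \<le> v \<bullet> (B *v v)"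
    by (rule continuous_attains_sup)
  then obtain v where v: "v \<in> sphere 0 1 \<inter> U"
      "\<And>x. x \<in> sphere 0 1 \<inter> U \<Longrightarrow> x \<bullet> (B *v x) \<le> v \<bullet> (B *v v)"
    by (elim bexE) (rule that, auto)
  define l where "l = v \<bullet> (B *v v)"
  have vv: "v \<bullet> v = 1" and vU: "v \<in> U"
    using v(1) by (auto simp: norm_eq_1)
  have le: "x \<bullet> (B *v x) \<le> l * (x \<bullet> x)" if "x \<in> U" for x
  proof (cases "x = 0")
    case False
    define y where "y = (1 / norm x) *\<^sub>R x"
    have "y \<in> sphere 0 1 \<inter> U"
      using that False by (auto simp: y_def U_def)
    then have "y \<bullet> (B *v y) \<le> l"
      using v(2) l_def by blast
    moreover have "x = norm x *\<^sub>R y"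
      using False by (simp add: y_def)
    then have "x \<bullet> (B *v x) = (norm x)\<^sup>2 * (y \<bullet> (B *v y))"
      by (metis inner_scaleR_left inner_scaleR_right matrix_vector_mult_scaleR mult.assoc power2_eq_square)
    ultimately show ?thesis
      by (metis mult.commute mult_left_mono power2_norm_eq_inner zero_le_power2)
  qed simp
  define w where "w = l *\<^sub>R v - B *v v"
  have wU: "w \<in> U"
    using BU [OF vU] vU by (auto simp: w_def U_def inner_diff_right)
  define q where "q = l * (w \<bullet> w) - w \<bullet> (B *v w)"
  have quad: "0 \<le> t\<^sup>2 * q + 2 * t * (w \<bullet> w)" for t
  proof -
    have "v + t *\<^sub>R w \<in> U"
      using vU wU by (auto simp: U_def inner_add_right)
    from le [OF this] have "0 \<le> l * ((v + t *\<^sub>R w) \<bullet> (v + t *\<^sub>R w)) - (v + t *\<^sub>R w) \<bullet> (B *v (v + t *\<^sub>R w))"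
      by simp
    also have "\<dots> = (l * (v \<bullet> v) - v \<bullet> (B *v v)) + t\<^sup>2 * q + 2 * t * (l * (v \<bullet> w) - w \<bullet> (B *v v))"
      using symB [of v w] by (simp add: q_def matrix_vector_right_distrib matrix_vector_mult_scaleR inner_add_left
          inner_add_right inner_commute power2_eq_square algebra_simps)
    also have "l * (v \<bullet> w) - w \<bullet> (B *v v) = w \<bullet> w"
      by (simp add: w_def inner_diff_right inner_commute algebra_simps)
    finally show ?thesis
      using vv by (simp add: l_def)
  qed
  have "w \<bullet> w = 0"
  proof (rule ccontr)
    assume "w \<bullet> w \<noteq> 0"
    then have pos: "0 < w \<bullet> w" by simp
    \<comment> \<open>With this \<open>t\<close> the quadratic term is at most half the size of the
      negative linear term, whatever the sign of \<open>q\<close>.\<close>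
    define t where "t = - (w \<bullet> w) / (\<bar>q\<bar> + 1)"
    have "t\<^sup>2 * q \<le> (w \<bullet> w)\<^sup>2 / (\<bar>q\<bar> + 1)"
    proof -
      have "t\<^sup>2 * q \<le> t\<^sup>2 * (\<bar>q\<bar> + 1)"
        by (intro mult_left_mono) auto
      also have "\<dots> = (w \<bullet> w)\<^sup>2 / (\<bar>q\<bar> + 1)"
        unfolding t_def power_divide by (simp add: power2_eq_square)
      finally show ?thesis .
    qed
    moreover have "2 * t * (w \<bullet> w) = - 2 * ((w \<bullet> w)\<^sup>2 / (\<bar>q\<bar> + 1))"
      by (simp add: t_def power2_eq_square)
    moreover have "0 < (w \<bullet> w)\<^sup>2 / (\<bar>q\<bar> + 1)"
      using pos by (intro divide_pos_pos) auto
    ultimately show False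
      using quad [of t] by linarith
  qed
  then have "B *v v = l *\<^sub>R v"
    by (simp add: w_def)
  then show ?thesis
    using vU vv by (intro exI [of _ v] exI [of _ l]) (auto simp: norm_eq_1 U_def)
qed

text \<open>The basis is grown one vector at a time from the prescribed \<open>u\<close> and then
  indexed by the type \<open>'n\<close> itself. Prescribing the vector at \<open>a0\<close> later
  gives the constant function a name.\<close>

lemma symmetric_eigenbasis:
  fixes B :: "real^'n^'n" and a0 :: 'n
  assumes sym: "transpose B = B" and u: "norm u = 1" "B *v u = l *\<^sub>R u"
  obtains e lam where "e a0 = u" "\<And>a b. e a \<bullet> e b = (if a = b then 1 else 0)"
    "\<And>a. B *v e a = lam a *\<^sub>R e a"
proof -
  have ex: "\<exists>S. finite S \<and> card S = k \<and> u \<in> S \<and> (\<forall>x\<in>S. \<forall>y\<in>S. x \<bullet> y = (if x = y then 1 else 0)) \<and>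
      (\<forall>x\<in>S. \<exists>l. B *v x = l *\<^sub>R x)" if "1 \<le> k" "k \<le> CARD('n)" for k
    using that
  proof (induction k rule: nat_induct_at_least)
    case base
    show ?case
      using u by (intro exI [of _ "{u}"]) (auto simp: norm_eq_1)
  next
    case (Suc k)
    then obtain S where S: "finite S" "card S = k" "u \<in> S"
      "\<forall>x\<in>S. \<forall>y\<in>S. x \<bullet> y = (if x = y then 1 else 0)" "\<forall>x\<in>S. \<exists>l. B *v x = l *\<^sub>R x"
      by auto
    then obtain v m where v: "norm v = 1" "\<forall>x\<in>S. x \<bullet> v = 0" "B *v v = m *\<^sub>R v"
      using symmetric_extend_eigenvectors [OF sym S(1)] Suc.prems by auto
    have "v \<notin> S" using v by force
    then show ?case
      using S v by (intro exI [of _ "insert v S"]) (auto simp: norm_eq_1 inner_commute)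
  qed
  obtain S where S: "finite S" "card S = CARD('n)" "u \<in> S"
      "\<forall>x\<in>S. \<forall>y\<in>S. x \<bullet> y = (if x = y then 1 else 0)" "\<forall>x\<in>S. \<exists>l. B *v x = l *\<^sub>R x"
    using ex [of "CARD('n)"] by (auto simp: Suc_le_eq)
  have "card (UNIV - {a0}) = card (S - {u})"
    using S by (simp add: card_Diff_subset)
  then obtain h where h: "bij_betw h (UNIV - {a0}) (S - {u})"
    using S(1) finite_same_card_bij by (metis finite_Diff finite_code)
  define e where "e a = (if a = a0 then u else h a)" for a
  have hS: "h a \<in> S - {u}" if "a \<noteq> a0" for a
    using h that by (auto dest: bij_betwE)
  have eS: "e a \<in> S" for a
    using hS S(3) by (auto simp: e_def)
  have inj: "e a = e b \<longleftrightarrow> a = b" for a b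
    using bij_betw_imp_inj_on [OF h] hS [of a] hS [of b] by (auto simp: e_def dest: inj_onD)
  have "\<forall>a. \<exists>l. B *v e a = l *\<^sub>R e a"
    using S(5) eS by blast
  then obtain lam where "\<And>a. B *v e a = lam a *\<^sub>R e a"
    by (auto dest!: choice)
  then show ?thesis
    using that [of e lam] S(4) eS inj by (simp add: e_def [of a0])
qed

text \<open>A maximum-modulus argument gives modulus at most 1. Irreducibility excludes 1.
  Aperiodicity excludes -1: at a point where \<open>f\<close> has maximal modulus there is a return
  of odd length with positive probability, and this share of the average has the wrong sign.\<close>

lemma eigenvalue_bound:
  fixes A :: "real^'v^'v"
  assumes A: "transition_matrix A" and irr: "irreducible_chain A" and ap: "aperiodic_chain A"
    and f: "A *v f = l *\<^sub>R f" and nc: "f $ x0 \<noteq> f $ x1"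
  shows "\<bar>l\<bar> < 1"
proof -
  define m where "m = Max (range (\<lambda>z. \<bar>f $ z\<bar>))"
  have mle: "\<bar>f $ z\<bar> \<le> m" for z
    by (simp add: m_def)
  have "m \<in> range (\<lambda>z. \<bar>f $ z\<bar>)"
    unfolding m_def by (rule Max_in) auto
  then obtain x where x: "\<bar>f $ x\<bar> = m" by auto
  have mpos: "0 < m"
    using nc mle [of x0] mle [of x1] by linarith
  have row: "(\<Sum>y\<in>UNIV. mpow A k $ z $ y) = 1" for k z
  proof -
    have "A *v 1 = 1"
      using A by (simp add: transition_matrix_def matrix_vector_mult_def vec_eq_iff)
    then have "(mpow A k *v 1) $ z = 1"
      using mpow_harmonic by (metis one_index)
    then show ?thesis by (simp add: matrix_vector_mult_def)
  qed
  have pw: "mpow A k *v f = (l ^ k) *\<^sub>R f" for k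
    by (induction k) (simp_all add: matrix_vector_mul_assoc [symmetric] f matrix_vector_mult_scaleR mult.commute)
  have sumk: "(\<Sum>y\<in>UNIV. mpow A k $ z $ y * f $ y) = l ^ k * f $ z" for k z
    using arg_cong [OF pw, of "\<lambda>v. v $ z" k] by (simp add: matrix_vector_mult_def)
  have "\<bar>l\<bar> * m \<le> m"
  proof -
    have "\<bar>l\<bar> * m = \<bar>\<Sum>y\<in>UNIV. mpow A 1 $ x $ y * f $ y\<bar>"
      using sumk [of 1 x] by (simp add: abs_mult x)
    also have "\<dots> \<le> (\<Sum>y\<in>UNIV. mpow A 1 $ x $ y * m)"
      by (rule order_trans [OF sum_abs sum_mono])
        (auto simp: abs_mult abs_of_nonneg mpow_nonneg [OF A] intro!: mult_left_mono mle mpow_nonneg [OF A] simp del: mpow_simps One_nat_def)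
    also have "\<dots> = m"
      by (simp add: sum_distrib_right [symmetric] row del: mpow_simps One_nat_def)
    finally show ?thesis .
  qed
  then have l1: "\<bar>l\<bar> \<le> 1"
    using mpos by simp
  have "l \<noteq> 1"
    using harmonic_const [OF A irr, of f] f nc by auto
  moreover have "l \<noteq> -1"
  proof
    assume l: "l = -1"
    \<comment> \<open>If every return time were even, 2 would divide their gcd.\<close>
    have "\<exists>k. odd k \<and> 0 < mpow A k $ x $ x"
    proof (rule ccontr)
      assume "\<not> ?thesis"
      then have "2 dvd Gcd {k. 1 \<le> k \<and> 0 < mpow A k $ x $ x}"
        by (intro Gcd_greatest) auto
      then show False
        using ap by (simp add: aperiodic_chain_def)
    qed
    then obtain k where k: "odd k" "0 < mpow A k $ x $ x" by blast
    define p where "p = mpow A k $ x"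
    have p0: "0 \<le> p $ y" for y by (simp add: p_def mpow_nonneg [OF A])
    have "(\<Sum>y\<in>UNIV. p $ y * f $ y) = - f $ x"
      using sumk [of k x] k(1) l by (simp add: p_def)
    then have "- f $ x - p $ x * f $ x = (\<Sum>y\<in>UNIV - {x}. p $ y * f $ y)"
      by (simp add: sum.remove [of UNIV x])
    also have "\<bar>\<dots>\<bar> \<le> (\<Sum>y\<in>UNIV - {x}. p $ y * m)"
      by (rule order_trans [OF sum_abs sum_mono]) (auto simp: abs_mult p0 intro!: mult_left_mono mle)
    also have "\<dots> = (1 - p $ x) * m"
      using row [where k = k and z = x] by (simp add: p_def sum_distrib_right [symmetric] sum.remove [of UNIV x])
    finally have "\<bar>(1 + p $ x) * f $ x\<bar> \<le> (1 - p $ x) * m"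
      by (simp add: algebra_simps abs_minus_commute)
    then have "(1 + p $ x) * m \<le> (1 - p $ x) * m"
      using p0 [of x] by (simp add: abs_mult x)
    then show False
      using k(2) mpos by (simp add: p_def)
  qed
  ultimately show ?thesis using l1 by linarith
qed

text \<open>The analytic data of the chain: a symmetric joint law \<open>\<nu>\<close> with marginal
  \<open>\<mu>\<close>, and an orthonormal eigenbasis indexed by the state space itself, whose
  member \<open>v0\<close> is the constant function. \<open>chi_complete\<close> is the dual
  orthogonality that makes expansions exact. \<open>\<kappa>\<close> is positive because eigenvalues
  will be divided by its square root.\<close>

locale spectral_chain =
  fixes \<mu> :: "'v::finite \<Rightarrow> real" and \<nu> :: "'v \<Rightarrow> 'v \<Rightarrow> real" and \<phi> :: "'v \<Rightarrow> 'v \<Rightarrow> real"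
    and lam :: "'v \<Rightarrow> real" and v0 :: 'v and \<kappa> :: real
  assumes mu_pos: "0 < \<mu> x" and mu_sum: "(\<Sum>x\<in>UNIV. \<mu> x) = 1"
    and nu_nonneg: "0 \<le> \<nu> x y" and nu_row: "(\<Sum>y\<in>UNIV. \<nu> x y) = \<mu> x" and nu_sym: "\<nu> x y = \<nu> y x"
    and chi_v0: "\<phi> v0 x = 1"
    and chi_orth: "(\<Sum>x\<in>UNIV. \<mu> x * (\<phi> a x * \<phi> b x)) = (if a = b then 1 else 0)"
    and chi_complete: "(\<Sum>a\<in>UNIV. \<phi> a x * \<phi> a y) * \<mu> y = (if x = y then 1 else 0)"
    and nu_chi: "(\<Sum>x\<in>UNIV. \<Sum>y\<in>UNIV. \<nu> x y * (\<phi> a x * \<phi> b y)) = (if a = b then lam a else 0)"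
    and lam_le: "a \<noteq> v0 \<Longrightarrow> \<bar>lam a\<bar> \<le> \<kappa>" and lam_range: "0 < \<kappa>" "\<kappa> < 1"

lemma stationary_measure_props:
  fixes A :: "real^'v^'v"
  assumes A: "transition_matrix A" "irreducible_chain A" and R: "reversible_chain A"
  shows "0 < stationary_measure A $ x" "(\<Sum>x\<in>UNIV. stationary_measure A $ x) = 1"
    "stationary_measure A $ x * A $ x $ y = stationary_measure A $ y * A $ y $ x"
proof -
  obtain p where p: "distribution p"
    and db: "\<And>x y. p $ x * A $ x $ y = p $ y * A $ y $ x"
    using R by (auto simp: reversible_chain_def)
  have "(\<Sum>x\<in>UNIV. p $ x * A $ x $ y) = p $ y" for y
  proof -
    have "(\<Sum>x\<in>UNIV. p $ x * A $ x $ y) = p $ y * (\<Sum>x\<in>UNIV. A $ y $ x)"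
      unfolding sum_distrib_left by (rule sum.cong) (auto simp: db)
    then show ?thesis using A by (simp add: transition_matrix_def)
  qed
  then have ps: "is_stationary A p"
    using p by (simp add: is_stationary_def vec_eq_iff vector_matrix_mult_def mult.commute)
  then have "stationary_measure A = p"
    unfolding stationary_measure_def using ex1_stationary [OF A R] by (simp add: the1_equality)
  then show "0 < stationary_measure A $ x" "(\<Sum>x\<in>UNIV. stationary_measure A $ x) = 1"
    "stationary_measure A $ x * A $ x $ y = stationary_measure A $ y * A $ y $ x"
    using stationary_pos [OF A ps] p db by (auto simp: distribution_def)
qed

text \<open>Detailed balance makes the conjugate of \<open>A\<close> by the square roots of
  \<open>\<mu>\<close> symmetric, and dividing its eigenvectors by these roots gives eigenfunctions
  of \<open>A\<close>. Completeness holds since a one-sided inverse of a square matrix is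
  two-sided.\<close>

lemma ex_spectral_chain:
  fixes A :: "real^'v^'v" and v0 :: 'v
  assumes A: "transition_matrix A" "irreducible_chain A" and R: "reversible_chain A" and ap: "aperiodic_chain A"
  shows "\<exists>\<phi> lam \<kappa>. spectral_chain (($) (stationary_measure A))
    (\<lambda>x y. stationary_measure A $ x * A $ x $ y) \<phi> lam v0 \<kappa>"
proof -
  define \<mu> where "\<mu> = ($) (stationary_measure A)"
  have pos: "0 < \<mu> x" and sum1: "(\<Sum>x\<in>UNIV. \<mu> x) = 1" and db: "\<mu> x * A $ x $ y = \<mu> y * A $ y $ x" for x y
    using stationary_measure_props [OF A R] by (auto simp: \<mu>_def)
  define s where "s x = sqrt (\<mu> x)" for x
  have spos: "0 < s x" and ss: "\<mu> x = s x * s x" for x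
    using pos [of x] by (auto simp: s_def)
  have sne: "s x \<noteq> 0" for x using spos [of x] by simp
  have row: "(\<Sum>y\<in>UNIV. A $ x $ y) = 1" for x
    using A by (simp add: transition_matrix_def)
  define B :: "real^'v^'v" where "B = (\<chi> x y. s x * A $ x $ y / s y)"
  have B: "B $ x $ y = s x * A $ x $ y / s y" for x y by (simp add: B_def)
  have "transpose B = B"
    using db by (simp add: B_def transpose_def vec_eq_iff ss field_simps sne)
  moreover define u where "u = (\<chi> x. s x)"
  have "norm u = 1"
    using sum1 by (simp add: norm_eq_1 inner_vec_def u_def ss)
  moreover have "B *v u = 1 *\<^sub>R u"
    by (simp add: vec_eq_iff matrix_vector_mult_def u_def B sne sum_distrib_left [symmetric] row)
  ultimately obtain e lam where e: "e v0 = u" "\<And>a b. e a \<bullet> e b = (if a = b then 1 else 0)"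
    "\<And>a. B *v e a = lam a *\<^sub>R e a"
    using symmetric_eigenbasis by metis
  define c where "c a x = e a $ x / s x" for a x
  have ec: "e a $ x = s x * c a x" for a x
    by (simp add: c_def sne)
  have orth: "(\<Sum>x\<in>UNIV. \<mu> x * (c a x * c b x)) = (if a = b then 1 else 0)" for a b
    using e(2) [of a b] by (simp add: inner_vec_def ec ss mult_ac)
  have c0: "c v0 x = 1" for x
    by (simp add: c_def e(1) u_def sne)
  have "(\<chi> a. e a) ** transpose (\<chi> a. e a) = mat 1"
    using e(2) by (simp add: matrix_matrix_mult_def transpose_def mat_def vec_eq_iff inner_vec_def)
  then have "transpose (\<chi> a. e a) ** (\<chi> a. e a) = mat 1"
    by (simp add: matrix_left_right_inverse)
  then have ee: "(\<Sum>a\<in>UNIV. e a $ x * e a $ y) = (if x = y then 1 else 0)" for x y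
    by (simp add: matrix_matrix_mult_def transpose_def mat_def vec_eq_iff)
  have compl: "(\<Sum>a\<in>UNIV. c a x * c a y) * \<mu> y = (if x = y then 1 else 0)" for x y
  proof -
    have "(\<Sum>a\<in>UNIV. c a x * c a y) * \<mu> y = (\<Sum>a\<in>UNIV. e a $ x * e a $ y) * (s y / s x)"
      unfolding sum_distrib_right by (intro sum.cong refl) (simp add: ec ss sne field_simps)
    then show ?thesis by (simp add: ee sne)
  qed
  have eig: "(\<Sum>y\<in>UNIV. A $ x $ y * c a y) = lam a * c a x" for a x
  proof -
    have "s x * (\<Sum>y\<in>UNIV. A $ x $ y * c a y) = (B *v e a) $ x"
      by (simp add: matrix_vector_mult_def B ec sne sum_distrib_left mult_ac)
    also have "\<dots> = s x * (lam a * c a x)"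
      by (simp add: e(3) ec)
    finally show ?thesis using sne by simp
  qed
  have cross: "(\<Sum>x\<in>UNIV. \<Sum>y\<in>UNIV. \<mu> x * A $ x $ y * (c a x * c b y)) = (if a = b then lam a else 0)" for a b
  proof -
    have "(\<Sum>y\<in>UNIV. \<mu> x * A $ x $ y * (c a x * c b y)) = lam b * (\<mu> x * (c a x * c b x))" for x
    proof -
      have "(\<Sum>y\<in>UNIV. \<mu> x * A $ x $ y * (c a x * c b y)) = \<mu> x * c a x * (\<Sum>y\<in>UNIV. A $ x $ y * c b y)"
        by (simp add: sum_distrib_left mult_ac)
      then show ?thesis by (simp add: eig)
    qed
    then have "(\<Sum>x\<in>UNIV. \<Sum>y\<in>UNIV. \<mu> x * A $ x $ y * (c a x * c b y)) =
        lam b * (\<Sum>x\<in>UNIV. \<mu> x * (c a x * c b x))"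
      by (simp add: sum_distrib_left)
    then show ?thesis by (simp add: orth)
  qed
  have lam1: "\<bar>lam a\<bar> < 1" if "a \<noteq> v0" for a
  proof -
    have "\<exists>x0 x1. c a x0 \<noteq> c a x1"
    proof (rule ccontr)
      assume "\<not> ?thesis"
      then obtain k where const: "\<And>x. c a x = k" by blast
      have "k = (\<Sum>x\<in>UNIV. \<mu> x * (c a x * c v0 x))"
        by (simp add: const c0 sum_distrib_right [symmetric] sum1)
      then have "k = 0"
        using orth [of a v0] that by simp
      then show False
        using orth [of a a] const by simp
    qed
    then obtain x0 x1 where "(\<chi> x. c a x) $ x0 \<noteq> (\<chi> x. c a x) $ x1" by auto
    moreover have "A *v (\<chi> x. c a x) = lam a *\<^sub>R (\<chi> x. c a x)"
      by (simp add: vec_eq_iff matrix_vector_mult_def eig)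
    ultimately show ?thesis
      using eigenvalue_bound [OF A ap] by blast
  qed
  \<comment> \<open>The inserted 1/2 keeps \<open>\<kappa>\<close> positive when all other
    eigenvalues vanish, or when there are none.\<close>
  define \<kappa> where "\<kappa> = Max (insert (1/2) ((\<lambda>a. \<bar>lam a\<bar>) ` (UNIV - {v0})))"
  have "1/2 \<le> \<kappa>"
    unfolding \<kappa>_def by (rule Max_ge) auto
  moreover have "\<kappa> < 1" "\<And>a. a \<noteq> v0 \<Longrightarrow> \<bar>lam a\<bar> \<le> \<kappa>"
    using lam1 by (auto simp: \<kappa>_def)
  ultimately have "spectral_chain \<mu> (\<lambda>x y. \<mu> x * A $ x $ y) c lam v0 \<kappa>"
    using A pos sum1 db c0 orth compl cross
    by unfold_locales (auto simp: transition_matrix_def sum_distrib_left [symmetric] less_imp_le)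
  then show ?thesis unfolding \<mu>_def by blast
qed

section \<open>Orthogonal expansions and hypercontractivity\<close>

definition chi :: "('a \<Rightarrow> 'w \<Rightarrow> real) \<Rightarrow> nat set \<Rightarrow> (nat \<Rightarrow> 'a) \<Rightarrow> (nat \<Rightarrow> 'w) \<Rightarrow> real" where
  "chi \<phi> I s x = (\<Prod>i\<in>I. \<phi> (s i) (x i))"

text \<open>The coefficients are kept apart from the basis functions and from the space on which
  these live: one and the same \<open>c\<close> is evaluated over several spaces.\<close>

definition ser :: "('a \<Rightarrow> 'w \<Rightarrow> real) \<Rightarrow> nat set \<Rightarrow> ((nat \<Rightarrow> 'a) \<Rightarrow> real) \<Rightarrow> (nat \<Rightarrow> 'w) \<Rightarrow> real" where
  "ser \<phi> I c x = (\<Sum>s\<in>cube I. c s * chi \<phi> I s x)"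

definition deg :: "'a \<Rightarrow> nat set \<Rightarrow> (nat \<Rightarrow> 'a) \<Rightarrow> nat" where
  "deg a0 I s = card {i\<in>I. s i \<noteq> a0}"

definition orthd :: "('a \<Rightarrow> 'w::finite \<Rightarrow> real) \<Rightarrow> ('w \<Rightarrow> real) \<Rightarrow> bool" where
  "orthd \<phi> r \<longleftrightarrow> (\<forall>w. 0 \<le> r w) \<and>
    (\<forall>a b. (\<Sum>w\<in>UNIV. r w * (\<phi> a w * \<phi> b w)) = (if a = b then 1 else 0))"

lemma orthdD:
  assumes "orthd \<phi> r"
  shows "0 \<le> r w" "(\<Sum>w\<in>UNIV. r w * (\<phi> a w * \<phi> b w)) = (if a = b then 1 else 0)"
  using assms by (auto simp: orthd_def)

lemma chi_insert:
  assumes "finite I" "i \<notin> I"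
  shows "chi \<phi> (insert i I) (s(i := a)) (x(i := w)) = \<phi> a w * chi \<phi> I s x"
  unfolding chi_def prod.insert [OF assms] fun_upd_same prod_upd2 [OF assms(2)] ..

lemma ser_insert:
  fixes \<phi> :: "'a::finite \<Rightarrow> 'w::finite \<Rightarrow> real"
  assumes "finite I" "i \<notin> I"
  shows "ser \<phi> (insert i I) c (x(i := w)) = (\<Sum>a\<in>UNIV. \<phi> a w * ser \<phi> I (\<lambda>s. c (s(i := a))) x)"
  unfolding ser_def sum_cube_insert [OF assms(2)] chi_insert [OF assms]
  by (simp add: sum_distrib_left mult_ac)

lemma prod_if_eq:
  fixes s t :: "nat \<Rightarrow> 'a"
  assumes "finite I" "s \<in> cube I" "t \<in> cube I"
  shows "(\<Prod>i\<in>I. if s i = t i then (h i :: real) else 0) = (if s = t then \<Prod>i\<in>I. h i else 0)"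
proof (cases "s = t")
  case False
  then obtain i where "i \<in> I" "s i \<noteq> t i"
    using assms by (metis PiE_ext)
  then show ?thesis
    using False assms(1) by (auto simp: prod_zero_iff)
qed simp

lemma pexp_chi:
  fixes \<phi> :: "'a \<Rightarrow> 'w::finite \<Rightarrow> real"
  assumes "finite I" "\<And>i. i \<in> I \<Longrightarrow> orthd \<phi> (r i)" "s \<in> cube I" "t \<in> cube I"
  shows "pexp r I (\<lambda>x. chi \<phi> I s x * chi \<phi> I t x) = (if s = t then 1 else 0)"
proof -
  have "pexp r I (\<lambda>x. chi \<phi> I s x * chi \<phi> I t x) =
      (\<Prod>i\<in>I. \<Sum>w\<in>UNIV. r i w * (\<phi> (s i) w * \<phi> (t i) w))"
    unfolding chi_def prod.distrib [symmetric] by (rule pexp_prod [OF assms(1)])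
  also have "\<dots> = (\<Prod>i\<in>I. if s i = t i then 1 else 0)"
    by (intro prod.cong refl orthdD(2) assms(2))
  finally show ?thesis
    using prod_if_eq [OF assms(1,3,4), of "\<lambda>_. 1"] by simp
qed

lemma pexp_ser_mult:
  fixes \<phi> :: "'a::finite \<Rightarrow> 'w::finite \<Rightarrow> real"
  assumes "finite I" "\<And>i. i \<in> I \<Longrightarrow> orthd \<phi> (r i)"
  shows "pexp r I (\<lambda>x. ser \<phi> I c x * ser \<phi> I d x) = (\<Sum>s\<in>cube I. c s * d s)"
proof -
  have "pexp r I (\<lambda>x. ser \<phi> I c x * ser \<phi> I d x) =
     pexp r I (\<lambda>x. \<Sum>s\<in>cube I. \<Sum>t\<in>cube I. (c s * d t) * (chi \<phi> I s x * chi \<phi> I t x))"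
    by (rule pexp_cong) (auto simp: ser_def sum_product mult_ac)
  also have "\<dots> = (\<Sum>s\<in>cube I. \<Sum>t\<in>cube I. (c s * d t) * pexp r I (\<lambda>x. chi \<phi> I s x * chi \<phi> I t x))"
    by (simp only: pexp_sum pexp_cmult)
  also have "\<dots> = (\<Sum>s\<in>cube I. \<Sum>t\<in>cube I. if t = s then c s * d t else 0)"
    by (intro sum.cong refl) (simp add: pexp_chi assms)
  finally show ?thesis
    using assms(1) by (simp add: sum.delta)
qed

lemma dexp_ser_mult:
  fixes \<phi> :: "'a::finite \<Rightarrow> 'w::finite \<Rightarrow> real"
  assumes "finite I"
    and K: "\<And>a b. (\<Sum>w\<in>UNIV. \<Sum>v\<in>UNIV. K w v * (\<phi> a w * \<phi> b v)) = (if a = b then l a else 0)"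
  shows "dexp K I (\<lambda>x y. ser \<phi> I c x * ser \<phi> I d y) = (\<Sum>s\<in>cube I. (\<Prod>i\<in>I. l (s i)) * (c s * d s))"
proof -
  have chi: "dexp K I (\<lambda>x y. chi \<phi> I s x * chi \<phi> I t y) = (if s = t then \<Prod>i\<in>I. l (s i) else 0)"
    if "s \<in> cube I" "t \<in> cube I" for s t
  proof -
    have "dexp K I (\<lambda>x y. chi \<phi> I s x * chi \<phi> I t y) =
        (\<Prod>i\<in>I. \<Sum>w\<in>UNIV. \<Sum>v\<in>UNIV. K w v * (\<phi> (s i) w * \<phi> (t i) v))"
      unfolding chi_def prod.distrib [symmetric] by (rule dexp_prod [OF assms(1)])
    then show ?thesis
      using prod_if_eq [OF assms(1) that, of "\<lambda>i. l (s i)"] by (simp add: K)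
  qed
  have "dexp K I (\<lambda>x y. ser \<phi> I c x * ser \<phi> I d y) =
     dexp K I (\<lambda>x y. \<Sum>s\<in>cube I. \<Sum>t\<in>cube I. (c s * d t) * (chi \<phi> I s x * chi \<phi> I t y))"
    by (rule dexp_cong) (auto simp: ser_def sum_product mult_ac)
  also have "\<dots> = (\<Sum>s\<in>cube I. \<Sum>t\<in>cube I. (c s * d t) * dexp K I (\<lambda>x y. chi \<phi> I s x * chi \<phi> I t y))"
    by (simp only: dexp_sum dexp_cmult)
  also have "\<dots> = (\<Sum>s\<in>cube I. \<Sum>t\<in>cube I. if t = s then (\<Prod>i\<in>I. l (s i)) * (c s * d t) else 0)"
    by (intro sum.cong refl) (simp add: chi)
  finally show ?thesis
    using assms(1) by (simp add: sum.delta)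
qed

lemma prod_if_power:
  assumes "finite I"
  shows "(\<Prod>i\<in>I. if s i = a0 then 1 else (K::real)) = K ^ deg a0 I s"
proof -
  have "I \<inter> - {i. s i = a0} = {i\<in>I. s i \<noteq> a0}" by auto
  then show ?thesis
    using assms by (simp add: prod.If_cases deg_def)
qed

lemma deg_insert:
  assumes "finite I" "i \<notin> I"
  shows "deg a0 (insert i I) (s(i := a)) = (if a = a0 then deg a0 I s else Suc (deg a0 I s))"
proof -
  have "{j \<in> insert i I. (s(i := a)) j \<noteq> a0} = (if a = a0 then {} else {i}) \<union> {j\<in>I. s j \<noteq> a0}"
    using assms(2) by auto
  then show ?thesis
    using assms by (simp add: deg_def)
qed

context
  fixes \<phi> :: "'a::finite \<Rightarrow> 'w::finite \<Rightarrow> real" and a0 :: 'a and B :: real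
  assumes \<phi>0: "\<And>w. \<phi> a0 w = 1"
    and \<phi>B: "\<And>w. (\<Sum>a\<in>UNIV - {a0}. (\<phi> a w)\<^sup>2) \<le> B"
begin

lemma orthd_sum: "orthd \<phi> r \<Longrightarrow> (\<Sum>w\<in>UNIV. r w) = 1"
  using orthdD(2) [of \<phi> r a0 a0] by (simp add: \<phi>0)

text \<open>The first two moments are the same for every measure that makes \<open>\<phi>\<close>
  orthonormal; this is the matching of moments behind the replacement argument. The pointwise bound
  is Cauchy-Schwarz.\<close>

lemma coord_moments:
  assumes r: "orthd \<phi> r" and D: "\<And>w. D w = (\<Sum>a\<in>UNIV - {a0}. \<phi> a w * Q a)"
  shows "(\<Sum>w\<in>UNIV. r w * D w) = 0" "(\<Sum>w\<in>UNIV. r w * (D w)\<^sup>2) = (\<Sum>a\<in>UNIV - {a0}. (Q a)\<^sup>2)"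
    "(D w)\<^sup>2 \<le> B * (\<Sum>a\<in>UNIV - {a0}. (Q a)\<^sup>2)"
proof -
  let ?A = "UNIV - {a0}"
  have "(\<Sum>w\<in>UNIV. r w * D w) = (\<Sum>a\<in>?A. Q a * (\<Sum>w\<in>UNIV. r w * (\<phi> a w * \<phi> a0 w)))"
    unfolding D sum_distrib_left by (subst sum.swap) (simp add: \<phi>0 mult_ac)
  also have "\<dots> = 0"
    by (rule sum.neutral) (simp add: orthdD(2) [OF r])
  finally show "(\<Sum>w\<in>UNIV. r w * D w) = 0" .
  have "(\<Sum>w\<in>UNIV. r w * (D w)\<^sup>2) = (\<Sum>w\<in>UNIV. \<Sum>a\<in>?A. \<Sum>b\<in>?A. Q a * Q b * (r w * (\<phi> a w * \<phi> b w)))"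
    by (simp add: D power2_eq_square sum_product sum_distrib_left mult_ac)
  also have "\<dots> = (\<Sum>a\<in>?A. \<Sum>w\<in>UNIV. \<Sum>b\<in>?A. Q a * Q b * (r w * (\<phi> a w * \<phi> b w)))"
    by (rule sum.swap)
  also have "\<dots> = (\<Sum>a\<in>?A. \<Sum>b\<in>?A. Q a * Q b * (\<Sum>w\<in>UNIV. r w * (\<phi> a w * \<phi> b w)))"
    unfolding sum_distrib_left by (intro sum.cong refl sum.swap)
  also have "\<dots> = (\<Sum>a\<in>?A. \<Sum>b\<in>?A. if b = a then Q a * Q b else 0)"
    by (intro sum.cong refl) (simp add: orthdD(2) [OF r])
  also have "\<dots> = (\<Sum>a\<in>?A. (Q a)\<^sup>2)"
    by (intro sum.cong refl) (simp add: sum.delta power2_eq_square)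
  finally show "(\<Sum>w\<in>UNIV. r w * (D w)\<^sup>2) = (\<Sum>a\<in>?A. (Q a)\<^sup>2)" .
  have "(D w)\<^sup>2 \<le> (\<Sum>a\<in>?A. (\<phi> a w)\<^sup>2) * (\<Sum>a\<in>?A. (Q a)\<^sup>2)"
    unfolding D by (rule Cauchy_Schwarz_ineq_sum)
  also have "\<dots> \<le> B * (\<Sum>a\<in>?A. (Q a)\<^sup>2)"
    by (intro mult_right_mono \<phi>B sum_nonneg) auto
  finally show "(D w)\<^sup>2 \<le> B * (\<Sum>a\<in>?A. (Q a)\<^sup>2)" .
qed

lemma coord_fourth_moment:
  fixes Q :: "'a \<Rightarrow> real"
  assumes r: "orthd \<phi> r"
  defines "S \<equiv> (\<Sum>a\<in>UNIV - {a0}. (Q a)\<^sup>2)"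
  shows "(\<Sum>w\<in>UNIV. r w * (\<Sum>a\<in>UNIV. \<phi> a w * Q a) ^ 4) \<le> (Q a0) ^ 4 + 8 * (Q a0)\<^sup>2 * S + 3 * B * S\<^sup>2"
proof -
  define D where "D w = (\<Sum>a\<in>UNIV - {a0}. \<phi> a w * Q a)" for w
  note m = coord_moments [OF r D_def, folded S_def]
  let ?q = "Q a0"
  have q4: "(?q + D w) ^ 4 \<le> ?q ^ 4 + 4 * ?q ^ 3 * D w + 8 * ?q\<^sup>2 * (D w)\<^sup>2 + 3 * B * S * (D w)\<^sup>2" for w
  proof -
    \<comment> \<open>The third moment of \<open>D\<close> need not vanish, so the cubic term is
      absorbed into the quadratic and the quartic one, which raises their coefficients from 6 to 8
      and from 1 to 3.\<close>
    have "4 * ?q * D w ^ 3 \<le> 2 * ?q\<^sup>2 * (D w)\<^sup>2 + 2 * (D w)^4"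
    proof -
      have "0 \<le> 2 * (?q * D w - (D w)\<^sup>2)\<^sup>2" by simp
      then show ?thesis by (simp add: power2_eq_square power3_eq_cube power4_eq_xxxx algebra_simps)
    qed
    moreover have "(D w) ^ 4 \<le> B * S * (D w)\<^sup>2"
      using mult_right_mono [OF m(3) [of w], of "(D w)\<^sup>2"] by (simp add: power2_eq_square power4_eq_xxxx mult_ac)
    moreover have "(?q + D w) ^ 4 = ?q ^ 4 + 4 * ?q ^ 3 * D w + 6 * ?q\<^sup>2 * (D w)\<^sup>2 + 4 * ?q * D w ^ 3 + (D w) ^ 4"
      by (simp add: power2_eq_square power3_eq_cube power4_eq_xxxx algebra_simps)
    ultimately show ?thesis by linarith
  qed
  have "(\<Sum>w\<in>UNIV. r w * (\<Sum>a\<in>UNIV. \<phi> a w * Q a) ^ 4) = (\<Sum>w\<in>UNIV. r w * (?q + D w) ^ 4)"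
    by (simp add: D_def sum.remove [of UNIV a0] \<phi>0)
  also have "\<dots> \<le> (\<Sum>w\<in>UNIV. r w * (?q ^ 4 + 4 * ?q ^ 3 * D w + 8 * ?q\<^sup>2 * (D w)\<^sup>2 + 3 * B * S * (D w)\<^sup>2))"
    by (intro sum_mono mult_left_mono q4 orthdD(1) [OF r])
  also have "\<dots> = (\<Sum>w\<in>UNIV. r w) * ?q ^ 4 + 4 * ?q ^ 3 * (\<Sum>w\<in>UNIV. r w * D w) +
      (8 * ?q\<^sup>2 + 3 * B * S) * (\<Sum>w\<in>UNIV. r w * (D w)\<^sup>2)"
    by (simp add: sum_distrib_left sum_distrib_right sum.distrib algebra_simps)
  also have "\<dots> = ?q ^ 4 + 8 * ?q\<^sup>2 * S + 3 * B * S\<^sup>2"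
    unfolding m(1,2) orthd_sum [OF r] by (simp add: algebra_simps power2_eq_square)
  finally show ?thesis .
qed

text \<open>Induction on the coordinates, with the one-coordinate inequality inside and
  Cauchy-Schwarz for the mixed terms. The conditions on \<open>K\<close> complete the square:
  \<open>8 \<le> 2 * K\<close> for the mixed term, \<open>3 * B \<le> K\<^sup>2\<close> for the pure
  one. In the usual language, noise with parameter \<open>1 / sqrt K\<close> contracts L2 into
  L4.\<close>

theorem hypercontractive_4_2:
  assumes "finite I" "\<And>i. i \<in> I \<Longrightarrow> orthd \<phi> (r i)" and K: "4 \<le> K" "3 * B \<le> K\<^sup>2"
  shows "pexp r I (\<lambda>x. ser \<phi> I c x ^ 4) \<le> (\<Sum>s\<in>cube I. (c s)\<^sup>2 * K ^ deg a0 I s)\<^sup>2"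
  using assms(1,2)
proof (induction I arbitrary: c)
  case empty
  show ?case by (simp add: ser_def chi_def deg_def power2_eq_square power4_eq_xxxx)
next
  case (insert i I)
  have rI: "\<And>i. i \<in> I \<Longrightarrow> orthd \<phi> (r i)" and ri: "orthd \<phi> (r i)"
    using insert.prems by auto
  have r0: "0 \<le> r j w" if "j \<in> I" for j w
    using orthdD(1) [OF rI [OF that]] .
  define Q where "Q a = ser \<phi> I (\<lambda>s. c (s(i := a)))" for a
  define N where "N a = (\<Sum>s\<in>cube I. (c (s(i := a)))\<^sup>2 * K ^ deg a0 I s)" for a
  have N0: "0 \<le> N a" for a
    unfolding N_def by (intro sum_nonneg mult_nonneg_nonneg) (use K in auto)
  have IH: "pexp r I (\<lambda>x. Q a x ^ 4) \<le> (N a)\<^sup>2" for a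
    unfolding Q_def N_def by (rule insert.IH [OF rI])
  have QQ: "pexp r I (\<lambda>x. (Q a x)\<^sup>2 * (Q b x)\<^sup>2) \<le> N a * N b" for a b
  proof (rule power2_le_imp_le)
    have "(pexp r I (\<lambda>x. (Q a x)\<^sup>2 * (Q b x)\<^sup>2))\<^sup>2 \<le>
       pexp r I (\<lambda>x. ((Q a x)\<^sup>2)\<^sup>2) * pexp r I (\<lambda>x. ((Q b x)\<^sup>2)\<^sup>2)"
      by (rule pexp_CS [OF r0])
    also have "\<dots> = pexp r I (\<lambda>x. Q a x ^ 4) * pexp r I (\<lambda>x. Q b x ^ 4)"
      by (simp add: power_mult [symmetric])
    also have "\<dots> \<le> (N a)\<^sup>2 * (N b)\<^sup>2"
      by (intro mult_mono IH pexp_nonneg r0) auto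
    finally show "(pexp r I (\<lambda>x. (Q a x)\<^sup>2 * (Q b x)\<^sup>2))\<^sup>2 \<le> (N a * N b)\<^sup>2"
      by (simp add: power_mult_distrib)
  qed (simp add: N0)
  let ?A = "UNIV - {a0}"
  define M where "M = (\<Sum>a\<in>?A. N a)"
  have M0: "0 \<le> M" by (simp add: M_def sum_nonneg N0)
  define S where "S x = (\<Sum>a\<in>?A. (Q a x)\<^sup>2)" for x
  have B0: "0 \<le> B"
    using order_trans [OF sum_nonneg \<phi>B] by simp
  have eS: "pexp r I (\<lambda>x. (Q a0 x)\<^sup>2 * S x) \<le> N a0 * M"
    unfolding S_def M_def sum_distrib_left pexp_sum by (intro sum_mono QQ)
  have eSS: "pexp r I (\<lambda>x. (S x)\<^sup>2) \<le> M\<^sup>2"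
  proof -
    have "pexp r I (\<lambda>x. (S x)\<^sup>2) = (\<Sum>a\<in>?A. \<Sum>b\<in>?A. pexp r I (\<lambda>x. (Q a x)\<^sup>2 * (Q b x)\<^sup>2))"
      unfolding S_def power2_eq_square [of "sum _ _"] sum_product pexp_sum ..
    also have "\<dots> \<le> (\<Sum>a\<in>?A. \<Sum>b\<in>?A. N a * N b)"
      by (intro sum_mono QQ)
    finally show ?thesis
      by (simp add: M_def power2_eq_square sum_product)
  qed
  have "pexp r (insert i I) (\<lambda>x. ser \<phi> (insert i I) c x ^ 4) =
      pexp r I (\<lambda>x. \<Sum>w\<in>UNIV. r i w * (\<Sum>a\<in>UNIV. \<phi> a w * Q a x) ^ 4)"
    unfolding pexp_insert [OF insert.hyps] ser_insert [OF insert.hyps] pexp_sum pexp_cmult Q_def ..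
  also have "\<dots> \<le> pexp r I (\<lambda>x. Q a0 x ^ 4 + 8 * ((Q a0 x)\<^sup>2 * S x) + 3 * B * (S x)\<^sup>2)"
    by (rule pexp_mono [OF r0]) (use coord_fourth_moment [OF ri] in \<open>simp_all add: S_def mult.assoc\<close>)
  also have "\<dots> = pexp r I (\<lambda>x. Q a0 x ^ 4) + 8 * pexp r I (\<lambda>x. (Q a0 x)\<^sup>2 * S x) + 3 * B * pexp r I (\<lambda>x. (S x)\<^sup>2)"
    by (simp only: pexp_add pexp_cmult)
  also have "\<dots> \<le> (N a0)\<^sup>2 + 8 * (N a0 * M) + 3 * B * M\<^sup>2"
    using IH [of a0] eS mult_left_mono [OF eSS, of "3 * B"] B0 by simp
  also have "\<dots> \<le> (N a0)\<^sup>2 + (2 * K) * (N a0 * M) + K\<^sup>2 * M\<^sup>2"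
    by (intro add_mono mult_right_mono) (use K N0 M0 in auto)
  also have "\<dots> = (N a0 + K * M)\<^sup>2"
    by (simp add: power2_eq_square algebra_simps)
  also have "N a0 + K * M = (\<Sum>s\<in>cube (insert i I). (c s)\<^sup>2 * K ^ deg a0 (insert i I) s)"
    unfolding sum_cube_insert [OF insert.hyps(2)] deg_insert [OF insert.hyps]
    by (simp add: sum.remove [of UNIV a0] N_def M_def sum_distrib_left mult_ac)
  finally show ?case .
qed

end

section \<open>The Lindeberg replacement argument\<close>

lemma DERIV_pos_part_power:
  "((\<lambda>t. (max 0 t) ^ Suc (Suc k)) has_real_derivative real (Suc (Suc k)) * (max 0 t) ^ Suc k) (at t)"
proof -
  consider "t > 0" | "t < 0" | "t = 0" by linarith
  then show ?thesis
  proof cases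
    case 1
    have ev: "\<forall>\<^sub>F x in nhds t. x ^ Suc (Suc k) = max 0 x ^ Suc (Suc k)"
      using eventually_nhds_in_open [of "{0<..}" t] 1 by (auto elim!: eventually_mono)
    have "((\<lambda>x. x ^ Suc (Suc k)) has_real_derivative real (Suc (Suc k)) * (max 0 t) ^ Suc k) (at t)"
      using DERIV_pow [of "Suc (Suc k)" t] 1 by simp
    then show ?thesis
      using DERIV_cong_ev [OF refl ev refl] by blast
  next
    case 2
    have ev: "\<forall>\<^sub>F x in nhds t. 0 = max 0 x ^ Suc (Suc k)"
      using eventually_nhds_in_open [of "{..<0}" t] 2 by (auto elim!: eventually_mono)
    have "((\<lambda>x. 0) has_real_derivative real (Suc (Suc k)) * (max 0 t) ^ Suc k) (at t)"
      using 2 by simp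
    then show ?thesis
      using DERIV_cong_ev [OF refl ev refl] by blast
  next
    case 3
    have "((\<lambda>h. (max 0 h) ^ Suc (Suc k) / h) \<longlongrightarrow> 0) (at (0::real))"
    proof (rule Lim_null_comparison)
      show "\<forall>\<^sub>F h in at (0::real). norm ((max 0 h) ^ Suc (Suc k) / h) \<le> \<bar>h\<bar> ^ Suc k"
        by (rule always_eventually) (auto simp: max_def abs_mult power_abs intro!: mult_nonpos_nonneg)
      show "((\<lambda>h. \<bar>h\<bar> ^ Suc k) \<longlongrightarrow> 0) (at (0::real))"
        by (rule tendsto_eq_intros | simp)+
    qed
    then show ?thesis
      using 3 by (simp add: DERIV_def)
  qed
qed

text \<open>A twice continuously differentiable substitute for the squared negative part, with
  Lipschitz second derivative and quadratic growth.\<close>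

definition psi :: "real \<Rightarrow> real" where "psi t = (max 0 (-t)) ^ 3 - (max 0 (-(t + 1))) ^ 3"
definition psi1 :: "real \<Rightarrow> real" where "psi1 t = 3 * (max 0 (-(t + 1)))\<^sup>2 - 3 * (max 0 (-t))\<^sup>2"
definition psi2 :: "real \<Rightarrow> real" where "psi2 t = 6 * max 0 (-t) - 6 * max 0 (-(t + 1))"

lemma DERIV_neg_part_power:
  "((\<lambda>t. (max 0 (-(t + c))) ^ Suc (Suc k)) has_real_derivative - (real (Suc (Suc k)) * (max 0 (-(t + c))) ^ Suc k)) (at t)"
proof -
  have "((\<lambda>t. -(t + c)) has_real_derivative -1) (at t)"
    by (auto intro!: derivative_eq_intros)
  from DERIV_chain2 [OF DERIV_pos_part_power this] show ?thesis by simp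
qed

lemma DERIV_psi: "(psi has_real_derivative psi1 t) (at t)"
proof -
  have "((\<lambda>t. (max 0 (-(t + 0))) ^ Suc (Suc 1) - (max 0 (-(t + 1))) ^ Suc (Suc 1)) has_real_derivative psi1 t) (at t)"
    by (rule DERIV_cong [OF DERIV_diff [OF DERIV_neg_part_power DERIV_neg_part_power]])
      (simp add: psi1_def power2_eq_square)
  then show ?thesis
    by (simp add: psi_def [abs_def] numeral_3_eq_3)
qed

lemma DERIV_psi1: "(psi1 has_real_derivative psi2 t) (at t)"
proof -
  have "((\<lambda>t. 3 * (max 0 (-(t + 1))) ^ Suc (Suc 0) - 3 * (max 0 (-(t + 0))) ^ Suc (Suc 0)) has_real_derivative psi2 t) (at t)"
    by (rule DERIV_cong [OF DERIV_diff [OF DERIV_cmult [OF DERIV_neg_part_power] DERIV_cmult [OF DERIV_neg_part_power]]])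
      (simp add: psi2_def)
  then show ?thesis
    by (simp add: psi1_def [abs_def] numeral_2_eq_2)
qed

lemma psi2_lipschitz: "\<bar>psi2 s - psi2 t\<bar> \<le> 6 * \<bar>s - t\<bar>"
  by (auto simp: psi2_def max_def abs_if split: if_splits)

text \<open>The Lagrange remainder contains \<open>psi2\<close> at a point no further than
  \<open>\<bar>h\<bar>\<close> from \<open>q\<close>; the Lipschitz constant 6 and the factor 1/2
  give 3.\<close>

lemma psi_taylor: "\<bar>psi (q + h) - psi q - psi1 q * h - psi2 q * h\<^sup>2 / 2\<bar> \<le> 3 * \<bar>h\<bar> ^ 3"
proof (cases "h = 0")
  case False
  define df where "df m = (if m = 0 then psi else if m = 1 then psi1 else psi2)" for m :: nat
  have "\<forall>m t. m < 2 \<and> min q (q + h) \<le> t \<and> t \<le> max q (q + h) \<longrightarrow> DERIV (df m) t :> df (Suc m) t"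
    using DERIV_psi DERIV_psi1 by (auto simp: df_def less_2_cases_iff)
  then obtain t where t: "if q + h < q then q + h < t \<and> t < q else q < t \<and> t < q + h"
      "psi (q + h) = (\<Sum>m<2. df m q / fact m * (q + h - q) ^ m) + df 2 t / fact 2 * (q + h - q)\<^sup>2"
    using Taylor [of 2 df psi "min q (q + h)" "max q (q + h)" q "q + h"] False by (auto simp: df_def)
  have "psi (q + h) = psi q + psi1 q * h + psi2 t * h\<^sup>2 / 2"
    using t(2) by (simp add: df_def numeral_2_eq_2)
  then have "\<bar>psi (q + h) - psi q - psi1 q * h - psi2 q * h\<^sup>2 / 2\<bar> = \<bar>psi2 t - psi2 q\<bar> * \<bar>h\<bar>\<^sup>2 / 2"
    by (simp add: abs_mult [symmetric] algebra_simps flip: diff_divide_distrib)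
      (simp add: abs_mult left_diff_distrib [symmetric] mult.commute)
  also have "\<dots> \<le> (6 * \<bar>h\<bar>) * \<bar>h\<bar>\<^sup>2 / 2"
    using psi2_lipschitz [of t q] t(1) by (intro divide_right_mono mult_right_mono) (auto split: if_splits)
  finally show ?thesis by (simp add: power2_eq_square power3_eq_cube)
qed simp

lemma psi_nonneg: "0 \<le> psi t"
  by (auto simp: psi_def intro!: power_mono)

lemma psi_le: "psi t \<le> 3 * (max 0 (-t))\<^sup>2"
proof -
  define n where "n = max 0 (-t)"
  show ?thesis
  proof (cases "n \<le> 1")
    case True
    then have "n ^ 3 \<le> 3 * n\<^sup>2"
      using power_decreasing [of 2 3 n] zero_le_power2 [of n] unfolding n_def by linarith
    moreover have "psi t = n ^ 3"
      using True by (auto simp: psi_def n_def max_def)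
    ultimately show ?thesis by (simp add: n_def)
  next
    case False
    then have "psi t = n ^ 3 - (n - 1) ^ 3"
      by (auto simp: psi_def n_def max_def split: if_splits)
    also have "\<dots> \<le> 3 * n\<^sup>2"
      using False by (simp add: power2_eq_square power3_eq_cube algebra_simps)
    finally show ?thesis by (simp add: n_def)
  qed
qed

text \<open>Partial converse of \<open>psi_le\<close>: \<open>psi\<close> is only cubic near 0, so
  negative parts below \<open>a\<close> are paid for by \<open>a\<^sup>2\<close>. It brings a bound
  on the smooth test function back to the squared negative part.\<close>

lemma neg_part_le_psi:
  assumes "0 < a" "a \<le> 1"
  shows "(max 0 (-t))\<^sup>2 \<le> a\<^sup>2 + psi t / a"
proof -
  define n where "n = max 0 (-t)"
  have n0: "0 \<le> n" by (simp add: n_def)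
  have "n\<^sup>2 \<le> a\<^sup>2 + psi t / a"
  proof (cases "n \<le> 1")
    case True
    then have p: "psi t = n ^ 3"
      by (auto simp: psi_def n_def max_def)
    show ?thesis
    proof (cases "n \<le> a")
      case True
      then have "n\<^sup>2 \<le> a\<^sup>2" using n0 by (simp add: power_mono)
      then show ?thesis using assms psi_nonneg [of t] by (smt (verit) divide_nonneg_pos)
    next
      case False
      then have "a * n\<^sup>2 \<le> n ^ 3"
        using mult_right_mono [of a n "n\<^sup>2"] by (simp add: power2_eq_square power3_eq_cube)
      then have "n\<^sup>2 \<le> psi t / a"
        using assms p by (simp add: field_simps)
      then show ?thesis by (smt (verit) zero_le_power2)
    qed
  next
    case False
    then have "psi t = n ^ 3 - (n - 1) ^ 3"
      by (auto simp: psi_def n_def max_def split: if_splits)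
    also have "\<dots> = n\<^sup>2 + (2 * n - 1) * (n - 1)"
      by (simp add: power2_eq_square power3_eq_cube algebra_simps)
    finally have "n\<^sup>2 \<le> psi t"
      using False by (smt (verit) mult_nonneg_nonneg)
    also have "\<dots> \<le> psi t / a"
      using assms psi_nonneg [of t] by (simp add: field_simps mult_left_le_one_le)
    finally show ?thesis by (smt (verit) zero_le_power2)
  qed
  then show ?thesis by (simp add: n_def)
qed

section \<open>Influences, and the replacement of one coordinate at a time\<close>

definition infl :: "'a \<Rightarrow> nat set \<Rightarrow> ((nat \<Rightarrow> 'a) \<Rightarrow> real) \<Rightarrow> nat \<Rightarrow> real" where
  "infl a0 I c i = (\<Sum>s\<in>cube I. if s i = a0 then 0 else (c s)\<^sup>2)"

text \<open>Exchange of summation: each multi-index is counted once for every coordinate that it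
  involves.\<close>

lemma sum_infl_le:
  fixes c :: "(nat \<Rightarrow> 'a::finite) \<Rightarrow> real"
  assumes I: "finite I" and d: "\<And>s. s \<in> cube I \<Longrightarrow> c s \<noteq> 0 \<Longrightarrow> deg a0 I s \<le> d"
  shows "(\<Sum>i\<in>I. infl a0 I c i) \<le> real d * (\<Sum>s\<in>cube I. (c s)\<^sup>2)"
proof -
  have "(\<Sum>i\<in>I. infl a0 I c i) = (\<Sum>s\<in>cube I. \<Sum>i\<in>I. if s i = a0 then 0 else (c s)\<^sup>2)"
    unfolding infl_def by (rule sum.swap)
  also have "\<dots> = (\<Sum>s\<in>cube I. real (deg a0 I s) * (c s)\<^sup>2)"
  proof (rule sum.cong)
    fix s :: "nat \<Rightarrow> 'a"
    have "(\<Sum>i\<in>I. if s i = a0 then 0 else (c s)\<^sup>2) = (\<Sum>i\<in>{i\<in>I. s i \<noteq> a0}. (c s)\<^sup>2)"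
      using I by (intro sum.mono_neutral_cong_right) auto
    then show "(\<Sum>i\<in>I. if s i = a0 then 0 else (c s)\<^sup>2) = real (deg a0 I s) * (c s)\<^sup>2"
      by (simp add: deg_def)
  qed simp
  also have "\<dots> \<le> (\<Sum>s\<in>cube I. real d * (c s)\<^sup>2)"
  proof (rule sum_mono)
    fix s :: "nat \<Rightarrow> 'a" assume "s \<in> cube I"
    then show "real (deg a0 I s) * (c s)\<^sup>2 \<le> real d * (c s)\<^sup>2"
      using d [of s] by (cases "c s = 0") (auto intro!: mult_right_mono)
  qed
  finally show ?thesis by (simp add: sum_distrib_left)
qed

context
  fixes \<phi> :: "'a::finite \<Rightarrow> 'w::finite \<Rightarrow> real" and a0 :: 'a and B :: real
  assumes \<phi>0: "\<And>w. \<phi> a0 w = 1"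
    and \<phi>B: "\<And>w. (\<Sum>a\<in>UNIV - {a0}. (\<phi> a w)\<^sup>2) \<le> B"
begin

text \<open>Cauchy-Schwarz between the second and the fourth moment, the latter being controlled by
  hypercontractivity at degree \<open>d\<close>.\<close>

lemma third_moment:
  assumes I: "finite I" "\<And>i. i \<in> I \<Longrightarrow> orthd \<phi> (r i)" and K: "4 \<le> K" "3 * B \<le> K\<^sup>2"
    and d: "\<And>s. s \<in> cube I \<Longrightarrow> c s \<noteq> 0 \<Longrightarrow> deg a0 I s \<le> d"
    and W: "(\<Sum>s\<in>cube I. (c s)\<^sup>2) = W"
  shows "pexp r I (\<lambda>x. \<bar>ser \<phi> I c x\<bar> ^ 3) \<le> K ^ d * W * sqrt W"
proof (rule power2_le_imp_le)
  have r0: "0 \<le> r j w" if "j \<in> I" for j w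
    using orthdD(1) [OF I(2) [OF that]] .
  have W0: "0 \<le> W" unfolding W [symmetric] by (simp add: sum_nonneg)
  let ?Q = "ser \<phi> I c"
  have Q2: "pexp r I (\<lambda>x. (?Q x)\<^sup>2) = W"
    unfolding power2_eq_square using pexp_ser_mult [OF I] W by (simp add: power2_eq_square)
  have "(\<Sum>s\<in>cube I. (c s)\<^sup>2 * K ^ deg a0 I s) \<le> (\<Sum>s\<in>cube I. (c s)\<^sup>2 * K ^ d)"
  proof (rule sum_mono)
    fix s :: "nat \<Rightarrow> 'a" assume s: "s \<in> cube I"
    show "(c s)\<^sup>2 * K ^ deg a0 I s \<le> (c s)\<^sup>2 * K ^ d"
    proof (cases "c s = 0")
      case False
      then show ?thesis
        using d [OF s] K(1) by (intro mult_left_mono power_increasing) auto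
    qed simp
  qed
  also have "\<dots> = K ^ d * W"
    by (simp add: W [symmetric] sum_distrib_left mult.commute)
  finally have le: "(\<Sum>s\<in>cube I. (c s)\<^sup>2 * K ^ deg a0 I s) \<le> K ^ d * W" .
  have "pexp r I (\<lambda>x. ?Q x ^ 4) \<le> (\<Sum>s\<in>cube I. (c s)\<^sup>2 * K ^ deg a0 I s)\<^sup>2"
    by (rule hypercontractive_4_2 [OF \<phi>0 \<phi>B I K])
  also have "\<dots> \<le> (K ^ d * W)\<^sup>2"
    by (intro power_mono le sum_nonneg mult_nonneg_nonneg) (use K in auto)
  finally have Q4: "pexp r I (\<lambda>x. ?Q x ^ 4) \<le> (K ^ d * W)\<^sup>2" .
  have "pexp r I (\<lambda>x. \<bar>?Q x\<bar> ^ 3) = pexp r I (\<lambda>x. \<bar>?Q x\<bar> * (?Q x)\<^sup>2)"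
    by (simp add: power2_eq_square power3_eq_cube mult_ac)
  then have "(pexp r I (\<lambda>x. \<bar>?Q x\<bar> ^ 3))\<^sup>2 \<le> pexp r I (\<lambda>x. \<bar>?Q x\<bar>\<^sup>2) * pexp r I (\<lambda>x. ((?Q x)\<^sup>2)\<^sup>2)"
    using pexp_CS [of I r "\<lambda>x. \<bar>?Q x\<bar>" "\<lambda>x. (?Q x)\<^sup>2", OF r0] by simp
  also have "\<dots> = W * pexp r I (\<lambda>x. ?Q x ^ 4)"
    by (simp add: Q2 power_mult [symmetric])
  also have "\<dots> \<le> W * (K ^ d * W)\<^sup>2"
    by (intro mult_left_mono Q4 W0)
  also have "\<dots> = (K ^ d * W * sqrt W)\<^sup>2"
    using W0 by (simp add: power_mult_distrib mult_ac)
  finally show "(pexp r I (\<lambda>x. \<bar>?Q x\<bar> ^ 3))\<^sup>2 \<le> (K ^ d * W * sqrt W)\<^sup>2" .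
  show "0 \<le> K ^ d * W * sqrt W"
    using K W0 by simp
qed

text \<open>The first-order Taylor term averages to 0 and the second-order one to a sum free of
  \<open>p\<close>. So the expression subtracted is the same for every admissible measure, and only
  the third-order remainder depends on it.\<close>

lemma coord_replace:
  fixes Q :: "'a \<Rightarrow> real"
  assumes p: "orthd \<phi> p"
  defines "D \<equiv> \<lambda>w. \<Sum>a\<in>UNIV - {a0}. \<phi> a w * Q a"
  shows "\<bar>(\<Sum>w\<in>UNIV. p w * psi (\<Sum>a\<in>UNIV. \<phi> a w * Q a)) - (psi (Q a0) + psi2 (Q a0) / 2 * (\<Sum>a\<in>UNIV - {a0}. (Q a)\<^sup>2))\<bar>
     \<le> 3 * (\<Sum>w\<in>UNIV. p w * \<bar>D w\<bar> ^ 3)"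
proof -
  note m = coord_moments(1,2) [of \<phi> a0 B p D Q, OF \<phi>0 \<phi>B p]
  have D: "\<And>w. D w = (\<Sum>a\<in>UNIV - {a0}. \<phi> a w * Q a)" by (simp add: D_def)
  let ?q = "Q a0"
  let ?R = "\<lambda>w. psi (?q + D w) - psi ?q - psi1 ?q * D w - psi2 ?q * (D w)\<^sup>2 / 2"
  have "(\<Sum>w\<in>UNIV. p w * psi (\<Sum>a\<in>UNIV. \<phi> a w * Q a)) = (\<Sum>w\<in>UNIV. p w * psi (?q + D w))"
    by (simp add: D sum.remove [of UNIV a0] \<phi>0)
  also have "\<dots> = (\<Sum>w\<in>UNIV. p w * ?R w) + (\<Sum>w\<in>UNIV. p w) * psi ?q + psi1 ?q * (\<Sum>w\<in>UNIV. p w * D w) +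
      psi2 ?q / 2 * (\<Sum>w\<in>UNIV. p w * (D w)\<^sup>2)"
    by (simp add: sum_distrib_left sum_distrib_right sum.distrib [symmetric] algebra_simps)
  also have "\<dots> = (\<Sum>w\<in>UNIV. p w * ?R w) + (psi ?q + psi2 ?q / 2 * (\<Sum>a\<in>UNIV - {a0}. (Q a)\<^sup>2))"
    using m [OF D] orthd_sum [OF \<phi>0 \<phi>B p] by simp
  finally have "\<bar>(\<Sum>w\<in>UNIV. p w * psi (\<Sum>a\<in>UNIV. \<phi> a w * Q a)) - (psi ?q + psi2 ?q / 2 * (\<Sum>a\<in>UNIV - {a0}. (Q a)\<^sup>2))\<bar>
     = \<bar>\<Sum>w\<in>UNIV. p w * ?R w\<bar>" by simp
  also have "\<dots> \<le> (\<Sum>w\<in>UNIV. p w * (3 * \<bar>D w\<bar> ^ 3))"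
    by (rule order_trans [OF sum_abs sum_mono])
      (auto simp: abs_mult orthdD(1) [OF p] intro!: mult_left_mono psi_taylor)
  finally show ?thesis by (simp add: sum_distrib_left mult_ac)
qed

text \<open>Both measures are compared with the common value \<open>m\<close>; hence 6, twice the 3
  of \<open>coord_replace\<close>.\<close>

lemma replace_one:
  assumes I: "finite I" "i \<in> I" and r: "\<And>i. i \<in> I \<Longrightarrow> orthd \<phi> (r i)" and p: "orthd \<phi> p"
    and K: "4 \<le> K" "3 * B \<le> K\<^sup>2"
    and d: "\<And>s. s \<in> cube I \<Longrightarrow> c s \<noteq> 0 \<Longrightarrow> deg a0 I s \<le> d"
  shows "\<bar>pexp (r(i := p)) I (\<lambda>x. psi (ser \<phi> I c x)) - pexp r I (\<lambda>x. psi (ser \<phi> I c x))\<bar>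
     \<le> 6 * K ^ d * infl a0 I c i * sqrt (infl a0 I c i)"
proof -
  define I' where "I' = I - {i}"
  have I': "finite I'" "i \<notin> I'" "I = insert i I'"
    using I by (auto simp: I'_def)
  define Q where "Q a = ser \<phi> I' (\<lambda>s. c (s(i := a)))" for a
  define m where "m x = psi (Q a0 x) + psi2 (Q a0 x) / 2 * (\<Sum>a\<in>UNIV - {a0}. (Q a x)\<^sup>2)" for x
  \<comment> \<open>The coefficients of the part that involves coordinate \<open>i\<close>. Their
    squares add up to the influence of \<open>i\<close>, to which the third moment is
    charged.\<close>
  define cD where "cD s = (if s i = a0 then 0 else c s)" for s
  have D: "(\<Sum>a\<in>UNIV - {a0}. \<phi> a w * Q a x) = ser \<phi> I cD (x(i := w))" for x w
    unfolding I'(3) ser_insert [OF I'(1,2)]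
    by (simp add: sum.remove [of UNIV a0] cD_def Q_def) (simp add: ser_def)
  have *: "\<bar>pexp (r(i := p)) I (\<lambda>x. psi (ser \<phi> I c x)) - pexp r I' m\<bar> \<le> 3 * (K ^ d * infl a0 I c i * sqrt (infl a0 I c i))"
    if p: "orthd \<phi> p" for p
  proof -
    have rp: "orthd \<phi> ((r(i := p)) j)" if "j \<in> I" for j
      using r that p by simp
    have r': "pexp (r(i := p)) I' F = pexp r I' F" for F
      by (rule pexp_cong_measure) (use I' in auto)
    have r0: "0 \<le> r j w" if "j \<in> I'" for j w
      using orthdD(1) [OF r] that I' by blast
    have e1: "pexp (r(i := p)) I (\<lambda>x. psi (ser \<phi> I c x)) =
       pexp r I' (\<lambda>x. \<Sum>w\<in>UNIV. p w * psi (\<Sum>a\<in>UNIV. \<phi> a w * Q a x))"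
      unfolding I'(3) pexp_insert [OF I'(1,2)] ser_insert [OF I'(1,2)] pexp_sum pexp_cmult Q_def r' by simp
    have e2: "pexp (r(i := p)) I (\<lambda>x. \<bar>ser \<phi> I cD x\<bar> ^ 3) =
       pexp r I' (\<lambda>x. \<Sum>w\<in>UNIV. p w * \<bar>\<Sum>a\<in>UNIV - {a0}. \<phi> a w * Q a x\<bar> ^ 3)"
      unfolding D unfolding I'(3) pexp_insert [OF I'(1,2)] pexp_sum pexp_cmult r' by simp
    have cr: "\<bar>(\<Sum>w\<in>UNIV. p w * psi (\<Sum>a\<in>UNIV. \<phi> a w * Q a x)) - m x\<bar> \<le>
        3 * (\<Sum>w\<in>UNIV. p w * \<bar>\<Sum>a\<in>UNIV - {a0}. \<phi> a w * Q a x\<bar> ^ 3)" for x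
      unfolding m_def by (rule coord_replace [OF p])
    have "\<bar>pexp (r(i := p)) I (\<lambda>x. psi (ser \<phi> I c x)) - pexp r I' m\<bar> =
      \<bar>pexp r I' (\<lambda>x. (\<Sum>w\<in>UNIV. p w * psi (\<Sum>a\<in>UNIV. \<phi> a w * Q a x)) - m x)\<bar>"
      unfolding e1 pexp_diff ..
    also have "\<dots> \<le> pexp r I' (\<lambda>x. 3 * (\<Sum>w\<in>UNIV. p w * \<bar>\<Sum>a\<in>UNIV - {a0}. \<phi> a w * Q a x\<bar> ^ 3))"
      unfolding abs_le_iff
    proof
      show "pexp r I' (\<lambda>x. (\<Sum>w\<in>UNIV. p w * psi (\<Sum>a\<in>UNIV. \<phi> a w * Q a x)) - m x) \<le>
          pexp r I' (\<lambda>x. 3 * (\<Sum>w\<in>UNIV. p w * \<bar>\<Sum>a\<in>UNIV - {a0}. \<phi> a w * Q a x\<bar> ^ 3))"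
        by (rule pexp_mono [OF r0]) (use cr in \<open>auto simp: abs_le_iff\<close>)
      have "pexp r I' (\<lambda>x. (-1) * ((\<Sum>w\<in>UNIV. p w * psi (\<Sum>a\<in>UNIV. \<phi> a w * Q a x)) - m x)) \<le>
          pexp r I' (\<lambda>x. 3 * (\<Sum>w\<in>UNIV. p w * \<bar>\<Sum>a\<in>UNIV - {a0}. \<phi> a w * Q a x\<bar> ^ 3))"
        by (rule pexp_mono [OF r0]) (use cr in \<open>auto simp: abs_le_iff\<close>)
      then show "- pexp r I' (\<lambda>x. (\<Sum>w\<in>UNIV. p w * psi (\<Sum>a\<in>UNIV. \<phi> a w * Q a x)) - m x) \<le>
          pexp r I' (\<lambda>x. 3 * (\<Sum>w\<in>UNIV. p w * \<bar>\<Sum>a\<in>UNIV - {a0}. \<phi> a w * Q a x\<bar> ^ 3))"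
        unfolding pexp_cmult by simp
    qed
    also have "\<dots> = 3 * pexp (r(i := p)) I (\<lambda>x. \<bar>ser \<phi> I cD x\<bar> ^ 3)"
      unfolding e2 pexp_cmult ..
    also have "\<dots> \<le> 3 * (K ^ d * infl a0 I c i * sqrt (infl a0 I c i))"
    proof (intro mult_left_mono third_moment [OF I(1) rp K])
      show "deg a0 I s \<le> d" if "s \<in> cube I" "cD s \<noteq> 0" for s
        using d [of s] that by (auto simp: cD_def split: if_splits)
      show "(\<Sum>s\<in>cube I. (cD s)\<^sup>2) = infl a0 I c i"
        unfolding infl_def by (rule sum.cong) (auto simp: cD_def)
    qed auto
    finally show ?thesis .
  qed
  have "r(i := r i) = r" by simp
  then show ?thesis
    using * [OF p] * [OF r [OF I(2)]] by (simp add: abs_le_iff)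
qed

text \<open>The coordinates are switched from \<open>p\<close> to \<open>q\<close> one by one. A
  switch costs the influence to the power 3/2: one square root is bounded by
  \<open>sqrt \<tau>\<close>, the rest is summed, and the total influence is at most the degree
  times the weight.\<close>

theorem lindeberg:
  assumes I: "finite I" and p: "orthd \<phi> p" and q: "orthd \<phi> q"
    and K: "4 \<le> K" "3 * B \<le> K\<^sup>2"
    and d: "\<And>s. s \<in> cube I \<Longrightarrow> c s \<noteq> 0 \<Longrightarrow> deg a0 I s \<le> d"
    and tau: "\<And>i. i \<in> I \<Longrightarrow> infl a0 I c i \<le> \<tau>" and tau0: "0 \<le> \<tau>"
  shows "pexp (\<lambda>_. q) I (\<lambda>x. psi (ser \<phi> I c x)) \<le> pexp (\<lambda>_. p) I (\<lambda>x. psi (ser \<phi> I c x)) +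
     6 * K ^ d * sqrt \<tau> * (real d * (\<Sum>s\<in>cube I. (c s)\<^sup>2))"
proof -
  let ?F = "\<lambda>x. psi (ser \<phi> I c x)"
  have inf0: "0 \<le> infl a0 I c i" for i
    unfolding infl_def by (intro sum_nonneg) auto
  have "pexp (\<lambda>j. if j \<in> L then q else p) I ?F \<le> pexp (\<lambda>_. p) I ?F + 6 * K ^ d * sqrt \<tau> * (\<Sum>i\<in>L. infl a0 I c i)"
    if "L \<subseteq> I" for L
    using finite_subset [OF that I] that
  proof (induction L rule: finite_induct)
    case empty
    then show ?case by simp
  next
    case (insert i L)
    let ?r = "\<lambda>j. if j \<in> L then q else p"
    have "(\<lambda>j. if j \<in> insert i L then q else p) = ?r(i := q)"
      by auto
    moreover have "\<bar>pexp (?r(i := q)) I ?F - pexp ?r I ?F\<bar> \<le> 6 * K ^ d * infl a0 I c i * sqrt (infl a0 I c i)"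
      by (rule replace_one) (use I p q K d insert.prems in auto)
    ultimately have "pexp (\<lambda>j. if j \<in> insert i L then q else p) I ?F \<le> pexp ?r I ?F + 6 * K ^ d * infl a0 I c i * sqrt (infl a0 I c i)"
      by (simp add: abs_le_iff)
    also have "6 * K ^ d * infl a0 I c i * sqrt (infl a0 I c i) \<le> 6 * K ^ d * infl a0 I c i * sqrt \<tau>"
      using tau insert.prems inf0 K by (intro mult_left_mono) auto
    finally show ?case
      using insert by (simp add: algebra_simps)
  qed
  from this [OF order_refl] have "pexp (\<lambda>j. if j \<in> I then q else p) I ?F \<le> pexp (\<lambda>_. p) I ?F + 6 * K ^ d * sqrt \<tau> * (\<Sum>i\<in>I. infl a0 I c i)" .
  moreover have "pexp (\<lambda>j. if j \<in> I then q else p) I ?F = pexp (\<lambda>_. q) I ?F"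
    by (rule pexp_cong_measure) simp
  moreover have "6 * K ^ d * sqrt \<tau> * (\<Sum>i\<in>I. infl a0 I c i) \<le> 6 * K ^ d * sqrt \<tau> * (real d * (\<Sum>s\<in>cube I. (c s)\<^sup>2))"
    using K tau0 by (intro mult_left_mono sum_infl_le I d) auto
  ultimately show ?thesis by simp
qed

end

section \<open>Reverse hypercontractivity\<close>

text \<open>Bernoulli's inequality alone gives a linear term. Using it for the power
  \<open>L\<close>, squaring, and using it again for the power \<open>M\<close> leaves a positive
  quadratic term, which can outweigh a negative first-order one.\<close>

lemma one_plus_power_ge:
  fixes z :: real
  assumes "-1 \<le> z" "-1 \<le> real L * z"
  shows "1 + real M * (2 * real L * z + (real L * z)\<^sup>2) \<le> (1 + z) ^ (2 * L * M)"
proof -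
  have "1 + real L * z \<le> (1 + z) ^ L"
    using assms by (intro Bernoulli_inequality)
  then have "(1 + real L * z)\<^sup>2 \<le> ((1 + z) ^ L)\<^sup>2"
    using assms by (intro power_mono) auto
  moreover have "((1 + z) ^ L)\<^sup>2 = (1 + z) ^ (2 * L)"
    by (simp add: power_mult [symmetric] mult.commute)
  moreover have "1 + (2 * real L * z + (real L * z)\<^sup>2) = (1 + real L * z)\<^sup>2"
    by (simp add: power2_eq_square algebra_simps)
  ultimately have le: "1 + (2 * real L * z + (real L * z)\<^sup>2) \<le> (1 + z) ^ (2 * L)"
    by simp
  have "-1 \<le> 2 * real L * z + (real L * z)\<^sup>2"
    using zero_le_power2 [of "1 + real L * z"] by (simp add: power2_eq_square algebra_simps)
  then have "1 + real M * (2 * real L * z + (real L * z)\<^sup>2) \<le> (1 + (2 * real L * z + (real L * z)\<^sup>2)) ^ M"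
    by (rule Bernoulli_inequality)
  also have "\<dots> \<le> ((1 + z) ^ (2 * L)) ^ M"
    using le \<open>-1 \<le> 2 * real L * z + (real L * z)\<^sup>2\<close> by (intro power_mono) auto
  finally show ?thesis by (simp add: power_mult)
qed

context
  fixes q :: "'w::finite \<Rightarrow> real" and \<nu> :: "'w \<Rightarrow> 'w \<Rightarrow> real" and \<alpha> \<beta> :: real
  assumes q: "\<And>w. \<alpha> \<le> q w" "0 < \<alpha>" and q1: "(\<Sum>w\<in>UNIV. q w) = 1"
    and \<nu>: "\<And>w v. \<beta> * (q w * q v) \<le> \<nu> w v" "0 < \<beta>"
    and rows: "\<And>w. (\<Sum>v\<in>UNIV. \<nu> w v) = q w" and cols: "\<And>v. (\<Sum>w\<in>UNIV. \<nu> w v) = q v"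
begin

private lemma qpos: "0 < q w"
  using q(1) [of w] q(2) by linarith

private lemma \<nu>0: "0 \<le> \<nu> w v"
  using \<nu>(1) [of w v] \<nu>(2) qpos [of w] qpos [of v] by (smt (verit) mult_pos_pos)

private lemma sum_rows: "(\<Sum>w\<in>UNIV. \<Sum>v\<in>UNIV. \<nu> w v * f w) = (\<Sum>w\<in>UNIV. q w * f w)"
  by (simp add: sum_distrib_right [symmetric] rows)

private lemma sum_cols: "(\<Sum>w\<in>UNIV. \<Sum>v\<in>UNIV. \<nu> w v * f v) = (\<Sum>v\<in>UNIV. q v * f v)"
  by (subst sum.swap) (simp add: sum_distrib_right [symmetric] cols)

private lemma ex_ge_mean:
  assumes "(\<Sum>w\<in>UNIV. q w * s w) = 1"
  shows "\<exists>w. 1 \<le> s w"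
proof (rule ccontr)
  assume "\<not> ?thesis"
  then have "(\<Sum>w\<in>UNIV. q w * s w) < (\<Sum>w\<in>UNIV. q w * 1)"
    by (intro sum_strict_mono mult_strict_left_mono) (auto simp: qpos not_le)
  then show False using assms q1 by simp
qed

text \<open>Every atom has mass at least \<open>\<alpha>\<close>, so with mean 1 a deficit
  \<open>x\<close> at one point forces an excess of at least \<open>\<alpha> * x\<close> at
  another.\<close>

private lemma ex_large:
  assumes s: "(\<Sum>w\<in>UNIV. q w * s w) = 1" and a: "s a < 1 - x"
  shows "\<exists>w. 1 + \<alpha> * x \<le> s w"
proof (cases "x \<le> 0")
  case True
  then have "\<alpha> * x \<le> 0" using q(2) by (simp add: mult_nonneg_nonpos)
  then show ?thesis using ex_ge_mean [OF s] by (meson add_le_same_cancel1 order_trans)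
next
  case False
  show ?thesis
  proof (rule ccontr)
    assume "\<not> ?thesis"
    then have le: "s w \<le> 1 + \<alpha> * x" for w by (meson linorder_not_le order.strict_implies_order)
    have "1 = q a * s a + (\<Sum>w\<in>UNIV - {a}. q w * s w)"
      using s by (simp add: sum.remove [of UNIV a])
    also have "\<dots> < q a * (1 - x) + (\<Sum>w\<in>UNIV - {a}. q w * (1 + \<alpha> * x))"
      using a qpos less_imp_le [OF qpos] by (intro add_less_le_mono sum_mono mult_left_mono le) auto
    also have "(\<Sum>w\<in>UNIV - {a}. q w * (1 + \<alpha> * x)) = (1 - q a) * (1 + \<alpha> * x)"
      using q1 by (simp add: sum_distrib_right [symmetric] sum.remove [of UNIV a])
    also have "q a * (1 - x) + (1 - q a) * (1 + \<alpha> * x) = 1 - (q a - \<alpha>) * x - q a * (\<alpha> * x)"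
      by (simp add: algebra_simps)
    also have "\<dots> \<le> 1"
      using q(1) [of a] q(2) qpos [of a] False by (smt (verit) mult_nonneg_nonneg)
    finally show False by simp
  qed
qed

text \<open>If no product \<open>s w * t v\<close> falls below \<open>1 - 1 / L\<close>, the
  second-order expansion decides: the mean of the product drops by at most half the sum of the
  variances, and the quadratic term makes up for it. Otherwise some product exceeds 1 by a fixed
  amount, and its high power alone suffices.\<close>

lemma coord_reverse_normalized:
  assumes L: "1 \<le> \<beta> * real L" and M: "1 \<le> \<beta> * \<alpha> ^ 3 * real M"
    and s0: "\<And>w. 0 \<le> s w" and t0: "\<And>w. 0 \<le> t w"
    and s1: "(\<Sum>w\<in>UNIV. q w * s w) = 1" and t1: "(\<Sum>w\<in>UNIV. q w * t w) = 1"
  shows "1 \<le> (\<Sum>w\<in>UNIV. \<Sum>v\<in>UNIV. \<nu> w v * (s w * t v) ^ (2 * L * M))"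
proof -
  let ?K = "2 * L * M"
  have Lpos: "0 < real L" using L \<nu>(2) by (cases "L = 0") auto
  show ?thesis
  proof (cases "\<forall>w v. 1 - 1 / real L \<le> s w * t v")
    case True
    define z where "z w v = s w * t v - 1" for w v
    define a where "a = (\<Sum>w\<in>UNIV. q w * (s w - 1)\<^sup>2)"
    define b where "b = (\<Sum>w\<in>UNIV. q w * (t w - 1)\<^sup>2)"
    have ab: "0 \<le> a" "0 \<le> b"
      unfolding a_def b_def by (intro sum_nonneg mult_nonneg_nonneg less_imp_le [OF qpos] zero_le_power2)+
    have a': "(\<Sum>w\<in>UNIV. q w * (s w)\<^sup>2) = 1 + a"
    proof -
      have "a = (\<Sum>w\<in>UNIV. q w * (s w)\<^sup>2) - 2 * (\<Sum>w\<in>UNIV. q w * s w) + (\<Sum>w\<in>UNIV. q w)"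
        by (simp add: a_def power2_eq_square algebra_simps sum.distrib sum_subtractf sum_distrib_left)
      then show ?thesis using s1 q1 by simp
    qed
    have b': "(\<Sum>w\<in>UNIV. q w * (t w)\<^sup>2) = 1 + b"
    proof -
      have "b = (\<Sum>w\<in>UNIV. q w * (t w)\<^sup>2) - 2 * (\<Sum>w\<in>UNIV. q w * t w) + (\<Sum>w\<in>UNIV. q w)"
        by (simp add: b_def power2_eq_square algebra_simps sum.distrib sum_subtractf sum_distrib_left)
      then show ?thesis using t1 q1 by simp
    qed
    define Ez where "Ez = (\<Sum>w\<in>UNIV. \<Sum>v\<in>UNIV. \<nu> w v * z w v)"
    define Ezz where "Ezz = (\<Sum>w\<in>UNIV. \<Sum>v\<in>UNIV. \<nu> w v * (z w v)\<^sup>2)"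
    \<comment> \<open>This square yields \<open>- (a + b) \<le> 2 * Ez\<close> from the marginals of
      \<open>\<nu>\<close> alone.\<close>
    have "0 \<le> (\<Sum>w\<in>UNIV. \<Sum>v\<in>UNIV. \<nu> w v * (s w + t v - 2)\<^sup>2)"
      by (intro sum_nonneg mult_nonneg_nonneg \<nu>0) auto
    also have "\<dots> = (\<Sum>w\<in>UNIV. \<Sum>v\<in>UNIV. \<nu> w v * (s w - 1)\<^sup>2) + (\<Sum>w\<in>UNIV. \<Sum>v\<in>UNIV. \<nu> w v * (t v - 1)\<^sup>2)
        + 2 * Ez - 2 * (\<Sum>w\<in>UNIV. \<Sum>v\<in>UNIV. \<nu> w v * (s w - 1)) - 2 * (\<Sum>w\<in>UNIV. \<Sum>v\<in>UNIV. \<nu> w v * (t v - 1))"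
      by (simp add: Ez_def z_def sum_distrib_left sum.distrib [symmetric] sum_subtractf [symmetric])
        (intro sum.cong refl, simp add: power2_eq_square algebra_simps)
    also have "\<dots> = a + b + 2 * Ez"
      unfolding sum_rows sum_cols by (simp add: a_def b_def algebra_simps sum_subtractf s1 t1 q1)
    finally have Ez: "- (a + b) \<le> 2 * Ez" by simp
    \<comment> \<open>Here the lower bound of \<open>\<nu>\<close> by the product law enters: under
      that law the second moment of \<open>z\<close> is exactly
      \<open>(1 + a) * (1 + b) - 1\<close>.\<close>
    have "\<beta> * (a + b) \<le> \<beta> * ((1 + a) * (1 + b) - 1)"
      using ab \<nu>(2) by (intro mult_left_mono) (auto simp: algebra_simps)
    also have "\<dots> = (\<Sum>w\<in>UNIV. \<Sum>v\<in>UNIV. \<beta> * (q w * q v) * (z w v)\<^sup>2)"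
    proof -
      have "\<beta> * (q w * q v) * (z w v)\<^sup>2 =
          \<beta> * ((q w * (s w)\<^sup>2) * (q v * (t v)\<^sup>2) - 2 * ((q w * s w) * (q v * t v)) + q w * q v)" for w v
        by (simp add: z_def power2_eq_square algebra_simps)
      then have "(\<Sum>w\<in>UNIV. \<Sum>v\<in>UNIV. \<beta> * (q w * q v) * (z w v)\<^sup>2) =
        \<beta> * ((\<Sum>w\<in>UNIV. q w * (s w)\<^sup>2) * (\<Sum>v\<in>UNIV. q v * (t v)\<^sup>2) -
          2 * ((\<Sum>w\<in>UNIV. q w * s w) * (\<Sum>v\<in>UNIV. q v * t v)) + (\<Sum>w\<in>UNIV. q w) * (\<Sum>v\<in>UNIV. q v))"
        by (simp only: sum.distrib sum_subtractf sum_distrib_left [symmetric] sum_distrib_right [symmetric])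
      then show ?thesis by (simp only: a' b' s1 t1 q1) simp
    qed
    also have "\<dots> \<le> Ezz"
      unfolding Ezz_def by (intro sum_mono mult_right_mono \<nu>) auto
    finally have Ezz: "\<beta> * (a + b) \<le> Ezz" .
    have "0 \<le> (\<beta> * real L - 1) * (a + b)"
      using L ab by simp
    then have "a + b \<le> real L * (\<beta> * (a + b))"
      by (simp add: algebra_simps)
    also have "\<dots> \<le> real L * Ezz"
      using Ezz Lpos by simp
    finally have "0 \<le> real L * (2 * Ez + real L * Ezz)"
      using Ez Lpos by simp
    then have "1 \<le> 1 + real M * (real L * (2 * Ez + real L * Ezz))"
      by simp
    also have "\<dots> = (\<Sum>w\<in>UNIV. \<Sum>v\<in>UNIV. \<nu> w v) + real M * (real L * (2 * Ez + real L * Ezz))"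
      by (simp add: rows q1)
    also have "\<dots> = (\<Sum>w\<in>UNIV. \<Sum>v\<in>UNIV. \<nu> w v * (1 + real M * (2 * real L * z w v + (real L * z w v)\<^sup>2)))"
      by (simp add: Ez_def Ezz_def sum_distrib_left sum.distrib [symmetric])
        (intro sum.cong refl, simp add: power2_eq_square algebra_simps)
    also have "\<dots> \<le> (\<Sum>w\<in>UNIV. \<Sum>v\<in>UNIV. \<nu> w v * (1 + z w v) ^ ?K)"
    proof (intro sum_mono mult_left_mono \<nu>0 one_plus_power_ge)
      fix w v
      show "-1 \<le> z w v" using s0 [of w] t0 [of v] by (simp add: z_def)
      have "- (1 / real L) \<le> z w v" using True by (auto simp: z_def algebra_simps)
      then show "-1 \<le> real L * z w v" using Lpos by (simp add: field_simps)
    qed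
    finally show ?thesis by (simp add: z_def)
  next
    case False
    then obtain a b where ab: "s a * t b < 1 - 1 / real L" by (auto simp: not_le)
    \<comment> \<open>Half of \<open>1 / L\<close>, because
      \<open>(1 - x)\<^sup>2 \<ge> 1 - 1 / L\<close>: one of the two factors must lie below
      \<open>1 - x\<close>.\<close>
    define x where "x = 1 / (2 * real L)"
    have xpos: "0 < x" using Lpos by (simp add: x_def)
    have "s a < 1 - x \<or> t b < 1 - x"
    proof (rule ccontr)
      assume "\<not> ?thesis"
      then have st: "1 - x \<le> s a" "1 - x \<le> t b" by auto
      have "x \<le> 1"
        using Lpos by (cases L) (auto simp: x_def field_simps)
      then have "(1 - x) * (1 - x) \<le> s a * t b"
        using st by (intro mult_mono) auto
      moreover have "1 - 1 / real L \<le> (1 - x) * (1 - x)"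
        using Lpos by (simp add: x_def field_simps)
      ultimately show False using ab by linarith
    qed
    then obtain w v where wv: "1 + \<alpha> * x \<le> s w * t v"
    proof
      assume "s a < 1 - x"
      then obtain w where w: "1 + \<alpha> * x \<le> s w" using ex_large [OF s1] by blast
      obtain v where "1 \<le> t v" using ex_ge_mean [OF t1] by blast
      then have "(1 + \<alpha> * x) * 1 \<le> s w * t v" using w q(2) xpos s0 by (intro mult_mono) auto
      then show ?thesis using that by auto
    next
      assume "t b < 1 - x"
      then obtain v where v: "1 + \<alpha> * x \<le> t v" using ex_large [OF t1] by blast
      obtain w where "1 \<le> s w" using ex_ge_mean [OF s1] by blast
      then have "1 * (1 + \<alpha> * x) \<le> s w * t v" using v q(2) xpos s0 by (intro mult_mono) auto
      then show ?thesis using that by auto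
    qed
    \<comment> \<open>The factor \<open>2 * L\<close> of the exponent cancels \<open>x\<close>, and
      \<open>M\<close> is chosen to outweigh the least mass of a pair.\<close>
    have "real M * \<alpha> = real ?K * (\<alpha> * x)"
      using Lpos by (simp add: x_def)
    also have "\<dots> \<le> 1 + real ?K * (\<alpha> * x)" by simp
    also have "\<dots> \<le> (1 + \<alpha> * x) ^ ?K"
      using q(2) xpos by (intro Bernoulli_inequality) (smt (verit) mult_pos_pos)
    also have "\<dots> \<le> (s w * t v) ^ ?K"
      using wv q(2) xpos by (intro power_mono) (smt (verit) mult_pos_pos)+
    finally have pw: "real M * \<alpha> \<le> (s w * t v) ^ ?K" .
    have "\<beta> * (\<alpha> * \<alpha>) \<le> \<beta> * (q w * q v)"
      using q qpos \<nu>(2) less_imp_le [OF qpos] by (intro mult_left_mono mult_mono) auto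
    then have nu: "\<beta> * (\<alpha> * \<alpha>) \<le> \<nu> w v"
      using \<nu>(1) [of w v] by linarith
    have "1 \<le> \<beta> * (\<alpha> * \<alpha>) * (real M * \<alpha>)"
      using M by (simp add: power3_eq_cube mult_ac)
    also have "\<dots> \<le> \<nu> w v * (s w * t v) ^ ?K"
      using q(2) \<nu>(2) \<nu>0 by (intro mult_mono nu pw) auto
    also have "\<dots> \<le> (\<Sum>v\<in>UNIV. \<nu> w v * (s w * t v) ^ ?K)"
      by (rule member_le_sum [of v UNIV "\<lambda>v. \<nu> w v * (s w * t v) ^ ?K"]) (auto intro!: mult_nonneg_nonneg \<nu>0 zero_le_power s0 t0)
    also have "\<dots> \<le> (\<Sum>w\<in>UNIV. \<Sum>v\<in>UNIV. \<nu> w v * (s w * t v) ^ ?K)"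
      by (rule member_le_sum [of w UNIV "\<lambda>w. \<Sum>v\<in>UNIV. \<nu> w v * (s w * t v) ^ ?K"]) (auto intro!: sum_nonneg mult_nonneg_nonneg \<nu>0 zero_le_power s0 t0)
    finally show ?thesis .
  qed
qed

text \<open>The estimate tensorizes because the same power \<open>K\<close> stands on both sides of
  the one-coordinate inequality: the induction hypothesis turns conditional means into
  \<open>(s w * t v) ^ K\<close>, to which that inequality applies. The upper bound 1 serves the
  empty product, where \<open>F * G\<close> must dominate its own power.\<close>

theorem reverse_hypercontractive:
  "\<exists>K\<ge>1. \<forall>I F G. finite I \<longrightarrow> (\<forall>x\<in>cube I. 0 \<le> F x \<and> F x \<le> 1 \<and> 0 \<le> G x \<and> G x \<le> 1) \<longrightarrow>
     (pexp (\<lambda>_. q) I F * pexp (\<lambda>_. q) I G) ^ K \<le> dexp \<nu> I (\<lambda>x y. F x * G y)"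
proof -
  obtain L :: nat where L: "1 / \<beta> \<le> real L" using real_arch_simple by blast
  then have L1: "1 \<le> \<beta> * real L" using \<nu>(2) by (simp add: field_simps)
  obtain M :: nat where M: "1 / (\<beta> * \<alpha> ^ 3) \<le> real M" using real_arch_simple by blast
  then have M1: "1 \<le> \<beta> * \<alpha> ^ 3 * real M" using \<nu>(2) q(2) by (simp add: field_simps)
  define K where "K = 2 * L * M"
  have K1: "1 \<le> K"
    using L1 M1 by (cases "L = 0"; cases "M = 0") (auto simp: K_def)
  have coord: "((\<Sum>w\<in>UNIV. q w * s w) * (\<Sum>w\<in>UNIV. q w * t w)) ^ K \<le> (\<Sum>w\<in>UNIV. \<Sum>v\<in>UNIV. \<nu> w v * (s w * t v) ^ K)"
    if s0: "\<And>w. 0 \<le> s w" and t0: "\<And>w. 0 \<le> t w" for s t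
  proof -
    define a where "a = (\<Sum>w\<in>UNIV. q w * s w)"
    define b where "b = (\<Sum>w\<in>UNIV. q w * t w)"
    have ab: "0 \<le> a" "0 \<le> b"
      unfolding a_def b_def by (intro sum_nonneg mult_nonneg_nonneg less_imp_le [OF qpos] s0 t0)+
    show ?thesis
    proof (cases "a * b = 0")
      case True
      then have "(a * b) ^ K = 0" using K1 by simp
      moreover have "0 \<le> (\<Sum>w\<in>UNIV. \<Sum>v\<in>UNIV. \<nu> w v * (s w * t v) ^ K)"
        by (intro sum_nonneg mult_nonneg_nonneg \<nu>0 zero_le_power s0 t0)
      ultimately show ?thesis unfolding a_def b_def by linarith
    next
      case False
      then have pos: "0 < a" "0 < b" using ab by auto
      have "1 \<le> (\<Sum>w\<in>UNIV. \<Sum>v\<in>UNIV. \<nu> w v * ((s w / a) * (t v / b)) ^ K)"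
        unfolding K_def
        by (rule coord_reverse_normalized [OF L1 M1])
          (use s0 t0 pos in \<open>simp_all add: sum_divide_distrib [symmetric]\<close>, simp_all add: a_def b_def)
      also have "\<dots> = (\<Sum>w\<in>UNIV. \<Sum>v\<in>UNIV. \<nu> w v * (s w * t v) ^ K) / (a * b) ^ K"
        by (simp add: power_divide power_mult_distrib sum_divide_distrib)
      finally show ?thesis
        using pos by (simp add: a_def [symmetric] b_def [symmetric] field_simps)
    qed
  qed
  have "(pexp (\<lambda>_. q) I F * pexp (\<lambda>_. q) I G) ^ K \<le> dexp \<nu> I (\<lambda>x y. F x * G y)"
    if "finite I" "\<forall>x\<in>cube I. 0 \<le> F x \<and> F x \<le> 1 \<and> 0 \<le> G x \<and> G x \<le> 1" for I F G
    using that
  proof (induction I arbitrary: F G)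
    case empty
    then have "0 \<le> F (\<lambda>_. undefined) * G (\<lambda>_. undefined)" "F (\<lambda>_. undefined) * G (\<lambda>_. undefined) \<le> 1"
      by (auto intro: mult_le_one)
    then show ?case
      using power_decreasing [OF K1, of "F (\<lambda>_. undefined) * G (\<lambda>_. undefined)"] by simp
  next
    case (insert i I)
    have upd: "x(i := w) \<in> cube (insert i I)" if "x \<in> cube I" for x w
      using that by (auto simp: PiE_def extensional_def)
    define s where "s w = pexp (\<lambda>_. q) I (\<lambda>x. F (x(i := w)))" for w
    define t where "t w = pexp (\<lambda>_. q) I (\<lambda>x. G (x(i := w)))" for w
    have st0: "0 \<le> s w" "0 \<le> t w" for w
      unfolding s_def t_def by (intro pexp_nonneg less_imp_le [OF qpos]; simp add: insert.prems upd del: fun_upd_apply)+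
    have "(pexp (\<lambda>_. q) (insert i I) F * pexp (\<lambda>_. q) (insert i I) G) ^ K =
      ((\<Sum>w\<in>UNIV. q w * s w) * (\<Sum>w\<in>UNIV. q w * t w)) ^ K"
      unfolding pexp_insert [OF insert.hyps] s_def t_def ..
    also have "\<dots> \<le> (\<Sum>w\<in>UNIV. \<Sum>v\<in>UNIV. \<nu> w v * (s w * t v) ^ K)"
      by (rule coord [OF st0])
    also have "\<dots> \<le> (\<Sum>w\<in>UNIV. \<Sum>v\<in>UNIV. \<nu> w v * dexp \<nu> I (\<lambda>x y. F (x(i := w)) * G (y(i := v))))"
      unfolding s_def t_def
      by (intro sum_mono mult_left_mono \<nu>0 insert.IH ballI) (simp add: insert.prems upd del: fun_upd_apply)
    also have "\<dots> = dexp \<nu> (insert i I) (\<lambda>x y. F x * G y)"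
      unfolding dexp_insert [OF insert.hyps] ..
    finally show ?case .
  qed
  then show ?thesis using K1 by blast
qed

end

section \<open>A full-support chain with prescribed correlations\<close>

definition sg :: "bool \<Rightarrow> real" where "sg b = (if b then 1 else -1)"

text \<open>For \<open>a \<noteq> v0\<close> the function lives on the fibre over \<open>a\<close>
  and is a scaled sign there. Disjoint supports give orthogonality, the signs give mean 0, the
  square root normalizes. Over \<open>v0\<close> all functions but the constant vanish.\<close>

definition aphi :: "'v \<Rightarrow> 'v \<Rightarrow> 'v::finite \<times> bool \<Rightarrow> real" where
  "aphi v0 a w = (if a = v0 then 1 else if fst w = a then sqrt (real CARD('v)) * sg (snd w) else 0)"

definition aunif :: "'v::finite \<times> bool \<Rightarrow> real" where
  "aunif w = 1 / (2 * real CARD('v))"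

text \<open>With probability \<open>1 - r\<close> the two points are independent; otherwise they share the first
  component \<open>a\<close> and their signs have correlation \<open>l a / r\<close>. The eigenvalue of \<open>aphi v0 a\<close> is then \<open>l a\<close>.\<close>

definition anu :: "'v \<Rightarrow> ('v \<Rightarrow> real) \<Rightarrow> real \<Rightarrow> 'v::finite \<times> bool \<Rightarrow> 'v \<times> bool \<Rightarrow> real" where
  "anu v0 l r w v = (1 - r) * (aunif w * aunif v) +
     (if fst w = fst v then r / (4 * real CARD('v)) *
        (1 + (if fst w = v0 then 0 else l (fst w) / r) * (sg (snd w) * sg (snd v))) else 0)"

lemma sum_prod_bool: "(\<Sum>w\<in>UNIV. F (w :: 'v::finite \<times> bool)) = (\<Sum>t\<in>UNIV. F (t, True) + F (t, False) :: real)"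
  by (simp add: UNIV_Times_UNIV [symmetric] sum.cartesian_product' UNIV_bool add.commute del: UNIV_Times_UNIV)

lemma sg_simps [simp]: "sg True = 1" "sg False = -1"
  by (simp_all add: sg_def)

lemma aphi_bound: "(\<Sum>a\<in>UNIV - {v0}. (aphi v0 a (w :: 'v::finite \<times> bool))\<^sup>2) \<le> real CARD('v)"
proof -
  have "(\<Sum>a\<in>UNIV - {v0}. (aphi v0 a w)\<^sup>2) = (\<Sum>a\<in>UNIV - {v0}. if a = fst w then real CARD('v) else 0)"
    by (intro sum.cong refl) (auto simp: aphi_def power_mult_distrib sg_def)
  also have "\<dots> \<le> real CARD('v)"
    by (auto simp: sum.delta)
  finally show ?thesis .
qed

lemma orthd_aunif: "orthd (aphi v0) (aunif :: 'v::finite \<times> bool \<Rightarrow> real)"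
  unfolding orthd_def
proof (intro conjI allI)
  fix a b :: 'v
  have *: "(\<Sum>w\<in>UNIV. aunif w * (aphi v0 a w * aphi v0 b w)) =
      (\<Sum>t\<in>UNIV. if a = v0 \<and> b = v0 then 1 / real CARD('v) else if a = b then (if t = a then 1 else 0) else 0)"
    unfolding sum_prod_bool by (intro sum.cong refl) (auto simp: aphi_def aunif_def field_simps)
  show "(\<Sum>w\<in>UNIV. aunif w * (aphi v0 a w * aphi v0 b w)) = (if a = b then 1 else 0)"
    unfolding * by (cases "a = v0"; cases "b = v0"; cases "a = b") (simp_all add: sum.delta)
qed (simp add: aunif_def)

lemma anu_row: "(\<Sum>v\<in>UNIV. anu v0 l r (w :: 'v::finite \<times> bool) v) = aunif w"
proof -
  have "(\<Sum>v\<in>UNIV. anu v0 l r w v) = (\<Sum>t\<in>UNIV. (1 - r) * aunif w / real CARD('v) + (if t = fst w then r / (2 * real CARD('v)) else 0))"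
    unfolding sum_prod_bool by (intro sum.cong refl) (auto simp: anu_def aunif_def field_simps)
  also have "\<dots> = aunif w"
    by (simp add: sum.distrib sum.delta) (simp add: aunif_def field_simps)
  finally show ?thesis .
qed

lemma anu_sym: "anu v0 l r w v = anu v0 l r v w"
  by (auto simp: anu_def mult_ac)

text \<open>The sign correlations have modulus at most 1, so the dependent part is non-negative; the
  independent part is the lower bound that reverse hypercontractivity asks for.\<close>

lemma anu_ge:
  fixes w v :: "'v::finite \<times> bool"
  assumes "0 < r" "\<And>a. a \<noteq> v0 \<Longrightarrow> \<bar>l a\<bar> \<le> r"
  shows "(1 - r) * (aunif w * aunif v) \<le> anu v0 l r w v"
proof -
  have nn: "0 \<le> 1 + (if fst w = v0 then 0 else l (fst w) / r) * (sg (snd w) * sg (snd v))"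
  proof (cases "fst w = v0")
    case False
    then have "\<bar>l (fst w) / r\<bar> \<le> 1" using assms by simp
    then have "-1 \<le> l (fst w) / r" "l (fst w) / r \<le> 1" by linarith+
    then show ?thesis using False by (auto simp: sg_def)
  qed simp
  have if_nn: "0 \<le> y \<Longrightarrow> 0 \<le> (if P then y else 0)" for P and y :: real by simp
  from nn have "0 \<le> r / (4 * real CARD('v)) *
      (1 + (if fst w = v0 then 0 else l (fst w) / r) * (sg (snd w) * sg (snd v)))"
    using assms(1) by (intro mult_nonneg_nonneg) auto
  then have "0 \<le> (if fst w = fst v then r / (4 * real CARD('v)) *
      (1 + (if fst w = v0 then 0 else l (fst w) / r) * (sg (snd w) * sg (snd v))) else 0)"
    by (rule if_nn)
  then show ?thesis
    unfolding anu_def by linarith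
qed

lemma anu_aphi:
  assumes "0 < r" "l v0 = 1"
  shows "(\<Sum>w\<in>UNIV. \<Sum>v\<in>UNIV. anu v0 l r w v * (aphi v0 a w * aphi v0 b (v :: 'v::finite \<times> bool))) = (if a = b then l a else 0)"
proof -
  have in1: "(\<Sum>v\<in>UNIV. anu v0 l r w v * aphi v0 b v) =
     (if b = v0 then aunif w else if fst w = b then l b / (2 * real CARD('v)) * aphi v0 b w else 0)" for w
  proof (cases "b = v0")
    case True
    then show ?thesis using anu_row [of v0 l r w] by (simp add: aphi_def)
  next
    case False
    have "(\<Sum>v\<in>UNIV. anu v0 l r w v * aphi v0 b v) =
       (\<Sum>t\<in>UNIV. if t = b then (if fst w = b then l b / (2 * real CARD('v)) * aphi v0 b w else 0) else 0)"
      unfolding sum_prod_bool using False assms(1)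
      by (intro sum.cong refl) (auto simp: anu_def aphi_def aunif_def field_simps)
    also have "\<dots> = (if fst w = b then l b / (2 * real CARD('v)) * aphi v0 b w else 0)"
      by (simp add: sum.delta)
    finally show ?thesis using False by simp
  qed
  have "(\<Sum>w\<in>UNIV. \<Sum>v\<in>UNIV. anu v0 l r w v * (aphi v0 a w * aphi v0 b v)) =
    (\<Sum>w\<in>UNIV. aphi v0 a w * (\<Sum>v\<in>UNIV. anu v0 l r w v * aphi v0 b v))"
    by (simp add: sum_distrib_left mult_ac)
  also have "\<dots> = (\<Sum>w\<in>UNIV. l b * (aunif w * (aphi v0 a w * aphi v0 b w)))"
    unfolding in1 by (intro sum.cong refl) (use assms in \<open>auto simp: aphi_def aunif_def\<close>)
  also have "\<dots> = l b * (if a = b then 1 else 0)"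
    unfolding sum_distrib_left [symmetric] orthdD(2) [OF orthd_aunif] ..
  finally show ?thesis by simp
qed

lemma sum_UNIV_sum: "(\<Sum>w\<in>UNIV. F (w :: 'a::finite + 'b::finite)) = (\<Sum>x\<in>UNIV. F (Inl x)) + (\<Sum>y\<in>UNIV. F (Inr y) :: real)"
  unfolding UNIV_sum by (subst sum.union_disjoint) (auto simp: sum.reindex)

text \<open>Weighted arithmetic-geometric mean: with weights \<open>1 / (2 * e)\<close> and
  \<open>e / 2\<close> the two squares contribute at most \<open>e / 2\<close> each, and their
  integrals see only the marginals of \<open>K\<close>.\<close>

lemma dexp_ge_minus:
  fixes K :: "'w::finite \<Rightarrow> 'w \<Rightarrow> real"
  assumes I: "finite I" and K: "\<And>w v. 0 \<le> K w v" "\<And>w. (\<Sum>v\<in>UNIV. K w v) = r w" "\<And>v. (\<Sum>w\<in>UNIV. K w v) = r v"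
    and e: "0 < e" and F: "pexp (\<lambda>_. r) I (\<lambda>x. (F x)\<^sup>2) \<le> e\<^sup>2" and G: "pexp (\<lambda>_. r) I (\<lambda>x. (G x)\<^sup>2) \<le> 1"
  shows "- e \<le> dexp K I (\<lambda>x y. F x * G y)"
proof -
  have pt: "(-1 / (2 * e)) * (F x)\<^sup>2 + (- e / 2) * (G y)\<^sup>2 \<le> F x * G y" for x y
  proof -
    have "0 \<le> (F x + e * G y)\<^sup>2 / (2 * e)" using e by simp
    also have "\<dots> = F x * G y + (1 / (2 * e)) * (F x)\<^sup>2 + (e / 2) * (G y)\<^sup>2"
      using e by (simp add: power2_eq_square field_simps)
    finally show ?thesis by simp
  qed
  have "- e = (-1 / (2 * e)) * e\<^sup>2 + (- e / 2) * 1"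
    using e by (simp add: power2_eq_square)
  also have "\<dots> \<le> (-1 / (2 * e)) * pexp (\<lambda>_. r) I (\<lambda>x. (F x)\<^sup>2) + (- e / 2) * pexp (\<lambda>_. r) I (\<lambda>x. (G x)\<^sup>2)"
    using F G e by (intro add_mono mult_left_mono_neg) auto
  also have "\<dots> = dexp K I (\<lambda>x y. (-1 / (2 * e)) * (F x)\<^sup>2 + (- e / 2) * (G y)\<^sup>2)"
    unfolding dexp_add dexp_cmult dexp_left [OF I K(2)] dexp_right [OF I K(3)] ..
  also have "\<dots> \<le> dexp K I (\<lambda>x y. F x * G y)"
    by (rule dexp_mono [OF K(1) pt])
  finally show ?thesis .
qed

section \<open>Correlation of functions without influential coordinates\<close>

context spectral_chain
begin

definition fc :: "nat set \<Rightarrow> ((nat \<Rightarrow> 'v) \<Rightarrow> real) \<Rightarrow> (nat \<Rightarrow> 'v) \<Rightarrow> real" where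
  "fc I f s = pexp (\<lambda>_. \<mu>) I (\<lambda>x. f x * chi \<phi> I s x)"

lemma orthd_mu: "orthd \<phi> \<mu>"
  using chi_orth mu_pos by (auto simp: orthd_def less_imp_le)

lemma mu_nonneg: "0 \<le> \<mu> x"
  using mu_pos by (simp add: less_imp_le)

lemma lam_v0: "lam v0 = 1"
  using nu_chi [of v0 v0] by (simp add: chi_v0 nu_row mu_sum)

lemma nu_col: "(\<Sum>x\<in>UNIV. \<nu> x y) = \<mu> y"
  using nu_row [of y] by (simp add: nu_sym)

text \<open>By completeness, multiplying the nontrivial terms at \<open>i\<close> by
  \<open>\<rho> i\<close> means keeping coordinate \<open>i\<close> with probability
  \<open>\<rho> i\<close> and resampling it from \<open>\<mu>\<close> otherwise. Hence positivity is
  preserved for parameters in [0,1]; parameter 1 gives the inversion formula, and parameter 0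
  averages the coordinate out.\<close>

lemma noise_ser:
  assumes I: "finite I"
  shows "ser \<phi> I (\<lambda>s. fc I f s * (\<Prod>i\<in>I. if s i = v0 then 1 else \<rho> i)) x =
    (\<Sum>y\<in>cube I. (\<Prod>i\<in>I. \<rho> i * (if x i = y i then 1 else 0) + (1 - \<rho> i) * \<mu> (y i)) * f y)"
proof -
  have one: "(\<Sum>a\<in>UNIV. \<mu> v * \<phi> a v * (if a = v0 then 1 else r) * \<phi> a u) = r * (if u = v then 1 else 0) + (1 - r) * \<mu> v" for r u v
  proof -
    have "(\<Sum>a\<in>UNIV. \<mu> v * \<phi> a v * (if a = v0 then 1 else r) * \<phi> a u) =
       (\<Sum>a\<in>UNIV. r * (\<phi> a u * \<phi> a v * \<mu> v) + (if a = v0 then (1 - r) * \<mu> v else 0))"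
      by (intro sum.cong refl) (auto simp: chi_v0 algebra_simps)
    also have "\<dots> = r * ((\<Sum>a\<in>UNIV. \<phi> a u * \<phi> a v) * \<mu> v) + (1 - r) * \<mu> v"
      by (simp add: sum.distrib sum_distrib_left sum_distrib_right sum.delta)
    finally show ?thesis by (simp add: chi_complete)
  qed
  have "ser \<phi> I (\<lambda>s. fc I f s * (\<Prod>i\<in>I. if s i = v0 then 1 else \<rho> i)) x =
    (\<Sum>s\<in>cube I. \<Sum>y\<in>cube I. (\<Prod>i\<in>I. \<mu> (y i) * \<phi> (s i) (y i) * (if s i = v0 then 1 else \<rho> i) * \<phi> (s i) (x i)) * f y)"
    unfolding ser_def fc_def pexp_def chi_def sum_distrib_right prod.distrib
    by (intro sum.cong refl) (simp add: mult_ac)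
  also have "\<dots> = (\<Sum>y\<in>cube I. (\<Sum>s\<in>cube I. \<Prod>i\<in>I. \<mu> (y i) * \<phi> (s i) (y i) * (if s i = v0 then 1 else \<rho> i) * \<phi> (s i) (x i)) * f y)"
    unfolding sum_distrib_right by (rule sum.swap)
  also have "\<dots> = (\<Sum>y\<in>cube I. (\<Prod>i\<in>I. \<Sum>a\<in>UNIV. \<mu> (y i) * \<phi> a (y i) * (if a = v0 then 1 else \<rho> i) * \<phi> a (x i)) * f y)"
    by (simp add: prod_sum_PiE [OF I])
  finally show ?thesis by (simp only: one)
qed

lemma ser_fc:
  assumes I: "finite I" and x: "x \<in> cube I"
  shows "ser \<phi> I (fc I f) x = f x"
proof -
  have "ser \<phi> I (fc I f) x = (\<Sum>y\<in>cube I. (\<Prod>i\<in>I. if x i = y i then 1 else 0) * f y)"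
    using noise_ser [OF I, of f "\<lambda>_. 1" x] by (simp cong: if_cong)
  also have "\<dots> = (\<Sum>y\<in>cube I. if y = x then f y else 0)"
    by (intro sum.cong refl) (auto simp: prod_if_eq [OF I x, of _ "\<lambda>_. 1", simplified])
  finally show ?thesis using I x by (simp add: sum.delta)
qed

lemma noise_nonneg:
  assumes I: "finite I" and f: "\<And>x. x \<in> cube I \<Longrightarrow> 0 \<le> f x" and \<rho>: "\<And>i. i \<in> I \<Longrightarrow> 0 \<le> \<rho> i \<and> \<rho> i \<le> 1"
  shows "0 \<le> ser \<phi> I (\<lambda>s. fc I f s * (\<Prod>i\<in>I. if s i = v0 then 1 else \<rho> i)) x"
  unfolding noise_ser [OF I]
  by (intro sum_nonneg mult_nonneg_nonneg prod_nonneg add_nonneg_nonneg ballI f) (use \<rho> mu_nonneg in auto)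

lemma parseval:
  assumes "finite I"
  shows "pexp (\<lambda>_. \<mu>) I (\<lambda>x. f x * g x) = (\<Sum>s\<in>cube I. fc I f s * fc I g s)"
proof -
  have "pexp (\<lambda>_. \<mu>) I (\<lambda>x. f x * g x) = pexp (\<lambda>_. \<mu>) I (\<lambda>x. ser \<phi> I (fc I f) x * ser \<phi> I (fc I g) x)"
    by (rule pexp_cong) (auto simp: ser_fc assms)
  then show ?thesis using pexp_ser_mult [of I \<phi> "\<lambda>_. \<mu>"] assms orthd_mu by simp
qed

lemma parseval_nu:
  assumes "finite I"
  shows "dexp \<nu> I (\<lambda>x y. f x * g y) = (\<Sum>s\<in>cube I. (\<Prod>i\<in>I. lam (s i)) * (fc I f s * fc I g s))"
proof -
  have "dexp \<nu> I (\<lambda>x y. f x * g y) = dexp \<nu> I (\<lambda>x y. ser \<phi> I (fc I f) x * ser \<phi> I (fc I g) y)"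
    by (rule dexp_cong) (auto simp: ser_fc assms)
  then show ?thesis using dexp_ser_mult [OF assms nu_chi] by simp
qed

lemma pexp_mu_const: "finite I \<Longrightarrow> pexp (\<lambda>_. \<mu>) I (\<lambda>_. c) = c"
  by (rule pexp_const) (simp_all add: mu_sum)

lemma sum_fc_le_1:
  assumes I: "finite I" and f: "\<And>x. x \<in> cube I \<Longrightarrow> 0 \<le> f x \<and> f x \<le> 1"
  shows "(\<Sum>s\<in>cube I. (fc I f s)\<^sup>2) \<le> 1"
proof -
  have "(\<Sum>s\<in>cube I. (fc I f s)\<^sup>2) = pexp (\<lambda>_. \<mu>) I (\<lambda>x. f x * f x)"
    by (simp add: parseval [OF I] power2_eq_square)
  also have "\<dots> \<le> pexp (\<lambda>_. \<mu>) I (\<lambda>x. 1)"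
    by (rule pexp_mono [OF mu_nonneg]) (use f in \<open>simp add: mult_le_one\<close>)
  finally show ?thesis by (simp add: pexp_mu_const [OF I])
qed

text \<open>Completeness on the diagonal: the squares of all basis functions at \<open>x\<close> add
  up to \<open>1 / \<mu> x\<close>.\<close>

lemma phi_bound:
  obtains B where "0 < B" "\<And>x. (\<Sum>a\<in>UNIV - {v0}. (\<phi> a x)\<^sup>2) \<le> B"
proof
  define B where "B = (\<Sum>x\<in>UNIV. 1 / \<mu> x)"
  show "0 < B" unfolding B_def by (intro sum_pos) (auto simp: mu_pos)
  fix x
  have "(\<Sum>a\<in>UNIV - {v0}. (\<phi> a x)\<^sup>2) \<le> (\<Sum>a\<in>UNIV. (\<phi> a x)\<^sup>2)"
    by (intro sum_mono2) auto
  also have "\<dots> = 1 / \<mu> x"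
    using chi_complete [of x x] mu_pos [of x] by (simp add: power2_eq_square field_simps)
  also have "\<dots> \<le> B"
    unfolding B_def by (rule member_le_sum) (auto simp: mu_nonneg)
  finally show "(\<Sum>a\<in>UNIV - {v0}. (\<phi> a x)\<^sup>2) \<le> B" .
qed

text \<open>One \<open>K\<close> admissible in \<open>hypercontractive_4_2\<close> both for
  \<open>\<phi>\<close> and for \<open>aphi v0\<close>, whose squares add up to at most
  \<open>CARD('v)\<close>. It is later taken to be a power of 2 so that \<open>K ^ d\<close> cancels
  against a power of \<open>(1 / 2) ^ m\<close>.\<close>

definition Hyp :: "real \<Rightarrow> bool" where
  "Hyp K \<longleftrightarrow> 4 \<le> K \<and> (\<forall>x. 3 * (\<Sum>a\<in>UNIV - {v0}. (\<phi> a x)\<^sup>2) \<le> K\<^sup>2) \<and> 3 * real CARD('v) \<le> K\<^sup>2"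

lemma ex_Hyp: "\<exists>k::nat. Hyp (2 ^ k)"
proof -
  obtain B where B: "0 < B" "\<And>x. (\<Sum>a\<in>UNIV - {v0}. (\<phi> a x)\<^sup>2) \<le> B" using phi_bound by blast
  obtain k :: nat where k: "3 * B + 3 * real CARD('v) \<le> real k" using real_arch_simple by blast
  have "real k \<le> 2 ^ (k + 2)"
    by (rule order_trans [OF less_imp_le [OF of_nat_less_two_power] power_increasing]) auto
  also have "\<dots> \<le> (2 ^ (k + 2))\<^sup>2"
    by (intro self_le_power one_le_power) auto
  finally have "3 * B + 3 * real CARD('v) \<le> (2 ^ (k + 2))\<^sup>2" using k by linarith
  moreover have "(4::real) \<le> 2 ^ (k + 2)" by (simp add: power_add)
  ultimately have "Hyp (2 ^ (k + 2))"
    unfolding Hyp_def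
  proof (intro conjI allI)
    fix x
    have "3 * (\<Sum>a\<in>UNIV - {v0}. (\<phi> a x)\<^sup>2) \<le> 3 * B + 3 * real CARD('v)"
      using B(2) [of x] by simp
    then show "3 * (\<Sum>a\<in>UNIV - {v0}. (\<phi> a x)\<^sup>2) \<le> (2 ^ (k + 2))\<^sup>2"
      using \<open>3 * B + 3 * real CARD('v) \<le> (2 ^ (k + 2))\<^sup>2\<close> by linarith
  qed (use B(1) in linarith)+
  then show ?thesis by blast
qed

text \<open>The replacement argument wants two measures on one space. So both are put on the
  disjoint sum of the two spaces: the basis functions are glued, and each measure is carried by its
  own summand.\<close>

lemma lindeberg_chain:
  assumes I: "finite I" and K: "Hyp K"
    and d: "\<And>s. s \<in> cube I \<Longrightarrow> c s \<noteq> 0 \<Longrightarrow> deg v0 I s \<le> d"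
    and tau: "\<And>i. i \<in> I \<Longrightarrow> infl v0 I c i \<le> \<tau>" and tau0: "0 \<le> \<tau>" and c1: "(\<Sum>s\<in>cube I. (c s)\<^sup>2) \<le> 1"
  shows "pexp (\<lambda>_. aunif) I (\<lambda>x. psi (ser (aphi v0) I c x)) \<le>
    pexp (\<lambda>_. \<mu>) I (\<lambda>x. psi (ser \<phi> I c x)) + 6 * K ^ d * sqrt \<tau> * real d"
proof -
  define \<Phi> :: "'v \<Rightarrow> 'v + 'v \<times> bool \<Rightarrow> real" where "\<Phi> a w = (case w of Inl x \<Rightarrow> \<phi> a x | Inr y \<Rightarrow> aphi v0 a y)" for a w
  define p :: "'v + 'v \<times> bool \<Rightarrow> real" where "p w = (case w of Inl x \<Rightarrow> \<mu> x | Inr y \<Rightarrow> 0)" for w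
  define q :: "'v + 'v \<times> bool \<Rightarrow> real" where "q w = (case w of Inl x \<Rightarrow> 0 | Inr y \<Rightarrow> aunif y)" for w
  define B where "B = K\<^sup>2 / 3"
  have \<Phi>0: "\<Phi> v0 w = 1" for w
    by (cases w) (simp_all add: \<Phi>_def chi_v0 aphi_def)
  have \<Phi>B: "(\<Sum>a\<in>UNIV - {v0}. (\<Phi> a w)\<^sup>2) \<le> B" for w
  proof (cases w)
    case (Inl x)
    then show ?thesis using K by (simp add: \<Phi>_def Hyp_def B_def mult.commute)
  next
    case (Inr y)
    have "(\<Sum>a\<in>UNIV - {v0}. (aphi v0 a y)\<^sup>2) \<le> real CARD('v)" by (rule aphi_bound)
    moreover have "3 * real CARD('v) \<le> K\<^sup>2" using K by (simp add: Hyp_def)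
    ultimately show ?thesis using Inr by (simp add: \<Phi>_def B_def)
  qed
  have op: "orthd \<Phi> p" and oq: "orthd \<Phi> q"
    using orthd_mu orthd_aunif [of v0]
    by (auto simp: orthd_def sum_UNIV_sum p_def q_def \<Phi>_def split: sum.splits)
  have K': "4 \<le> K" "3 * B \<le> K\<^sup>2" using K by (auto simp: Hyp_def B_def)
  have sL: "ser \<Phi> I c (\<lambda>i\<in>I. Inl (x i)) = ser \<phi> I c x" for x
    by (simp add: ser_def chi_def \<Phi>_def cong: prod.cong)
  have sR: "ser \<Phi> I c (\<lambda>i\<in>I. Inr (x i)) = ser (aphi v0) I c x" for x
    by (simp add: ser_def chi_def \<Phi>_def cong: prod.cong)
  have eL: "pexp (\<lambda>_. p) I (\<lambda>x. psi (ser \<Phi> I c x)) = pexp (\<lambda>_. \<mu>) I (\<lambda>x. psi (ser \<phi> I c x))"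
    by (subst pexp_image [OF I, of "\<lambda>_. p" "\<lambda>_. \<mu>" Inl]) (simp_all add: sum_UNIV_sum p_def sL del: restrict_apply)
  have eR: "pexp (\<lambda>_. q) I (\<lambda>x. psi (ser \<Phi> I c x)) = pexp (\<lambda>_. aunif) I (\<lambda>x. psi (ser (aphi v0) I c x))"
    by (subst pexp_image [OF I, of "\<lambda>_. q" "\<lambda>_. aunif" Inr]) (simp_all add: sum_UNIV_sum q_def sR del: restrict_apply)
  have "pexp (\<lambda>_. q) I (\<lambda>x. psi (ser \<Phi> I c x)) \<le> pexp (\<lambda>_. p) I (\<lambda>x. psi (ser \<Phi> I c x)) +
     6 * K ^ d * sqrt \<tau> * (real d * (\<Sum>s\<in>cube I. (c s)\<^sup>2))"
    by (rule lindeberg [where \<phi> = \<Phi> and ?a0.0 = v0 and B = B, OF \<Phi>0 \<Phi>B I op oq K' d tau tau0])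
  also have "6 * K ^ d * sqrt \<tau> * (real d * (\<Sum>s\<in>cube I. (c s)\<^sup>2)) \<le> 6 * K ^ d * sqrt \<tau> * (real d * 1)"
    using K' tau0 c1 by (intro mult_left_mono) auto
  finally show ?thesis unfolding eL eR by simp
qed

end

section \<open>Damping, truncation and the transfer to the full-support space\<close>

context spectral_chain
begin

text \<open>The fourth root: noise on both functions costs
  \<open>rho\<^sup>2 = sqrt \<kappa>\<close>, and the nontrivial eigenvalues divided by this are
  still at most \<open>sqrt \<kappa>\<close> in modulus.\<close>

definition rho :: real where "rho = sqrt (sqrt \<kappa>)"

lemma rho: "0 < rho" "rho < 1" "rho\<^sup>2 = sqrt \<kappa>" "0 < sqrt \<kappa>" "sqrt \<kappa> < 1"
  using lam_range by (auto simp: rho_def)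

text \<open>The parameter depends on the coordinate so that the value 0 can average out the masked
  ones.\<close>

definition damp :: "nat set \<Rightarrow> (nat \<Rightarrow> real) \<Rightarrow> ((nat \<Rightarrow> 'v) \<Rightarrow> real) \<Rightarrow> (nat \<Rightarrow> 'v) \<Rightarrow> real" where
  "damp I \<rho> f s = fc I f s * (\<Prod>i\<in>I. if s i = v0 then 1 else \<rho> i)"

definition low :: "nat set \<Rightarrow> nat \<Rightarrow> ((nat \<Rightarrow> 'v) \<Rightarrow> real) \<Rightarrow> (nat \<Rightarrow> 'v) \<Rightarrow> real" where
  "low I d c s = (if deg v0 I s \<le> d then c s else 0)"

lemma damp_sq_le:
  assumes I: "finite I" and \<rho>: "\<And>i. i \<in> I \<Longrightarrow> 0 \<le> \<rho> i \<and> \<rho> i \<le> rho"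
  shows "(damp I \<rho> f s)\<^sup>2 \<le> (fc I f s)\<^sup>2 * rho ^ (2 * deg v0 I s)"
proof -
  have "0 \<le> (\<Prod>i\<in>I. if s i = v0 then 1 else \<rho> i)"
    using \<rho> by (intro prod_nonneg) auto
  moreover have "(\<Prod>i\<in>I. if s i = v0 then 1 else \<rho> i) \<le> (\<Prod>i\<in>I. if s i = v0 then 1 else rho)"
    using \<rho> by (intro prod_mono) auto
  ultimately have "(\<Prod>i\<in>I. if s i = v0 then 1 else \<rho> i)\<^sup>2 \<le> (rho ^ deg v0 I s)\<^sup>2"
    unfolding prod_if_power [OF I] by (rule power_mono [rotated])
  then show ?thesis
    unfolding damp_def power_mult_distrib
    by (intro mult_left_mono) (auto simp: power_mult [symmetric] mult.commute)
qed

lemma damp_sums: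
  assumes I: "finite I" and \<rho>: "\<And>i. i \<in> I \<Longrightarrow> 0 \<le> \<rho> i \<and> \<rho> i \<le> rho"
    and f: "\<And>x. x \<in> cube I \<Longrightarrow> 0 \<le> f x \<and> f x \<le> 1"
  shows "(\<Sum>s\<in>cube I. (damp I \<rho> f s)\<^sup>2) \<le> 1" "(\<Sum>s\<in>cube I. (low I d (damp I \<rho> f) s)\<^sup>2) \<le> 1"
    "(\<Sum>s\<in>cube I. (damp I \<rho> f s - low I d (damp I \<rho> f) s)\<^sup>2) \<le> rho ^ (2 * d)"
proof -
  have "(damp I \<rho> f s)\<^sup>2 \<le> (fc I f s)\<^sup>2" for s
  proof -
    have "(fc I f s)\<^sup>2 * rho ^ (2 * deg v0 I s) \<le> (fc I f s)\<^sup>2 * 1"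
      using rho by (intro mult_left_mono power_le_one) auto
    then show ?thesis
      using damp_sq_le [where \<rho> = \<rho> and f = f and s = s, OF I \<rho>] by linarith
  qed
  then show 1: "(\<Sum>s\<in>cube I. (damp I \<rho> f s)\<^sup>2) \<le> 1"
    by (intro order_trans [OF sum_mono sum_fc_le_1 [where f = f, OF I f]])
  have "(\<Sum>s\<in>cube I. (low I d (damp I \<rho> f) s)\<^sup>2) \<le> (\<Sum>s\<in>cube I. (damp I \<rho> f s)\<^sup>2)"
    by (intro sum_mono) (auto simp: low_def)
  then show "(\<Sum>s\<in>cube I. (low I d (damp I \<rho> f) s)\<^sup>2) \<le> 1" using 1 by linarith
  have "(\<Sum>s\<in>cube I. (damp I \<rho> f s - low I d (damp I \<rho> f) s)\<^sup>2) \<le> (\<Sum>s\<in>cube I. (fc I f s)\<^sup>2 * rho ^ (2 * d))"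
  proof (rule sum_mono)
    fix s :: "nat \<Rightarrow> 'v"
    show "(damp I \<rho> f s - low I d (damp I \<rho> f) s)\<^sup>2 \<le> (fc I f s)\<^sup>2 * rho ^ (2 * d)"
    proof (cases "deg v0 I s \<le> d")
      case False
      then have "(damp I \<rho> f s)\<^sup>2 \<le> (fc I f s)\<^sup>2 * rho ^ (2 * deg v0 I s)"
        by (intro damp_sq_le I \<rho>)
      also have "\<dots> \<le> (fc I f s)\<^sup>2 * rho ^ (2 * d)"
        using False rho by (intro mult_left_mono power_decreasing) auto
      finally show ?thesis using False by (simp add: low_def)
    qed (use rho in \<open>simp add: low_def\<close>)
  qed
  also have "\<dots> \<le> 1 * rho ^ (2 * d)"
    unfolding sum_distrib_right [symmetric]
    using rho sum_fc_le_1 [where f = f, OF I f] by (intro mult_right_mono) auto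
  finally show "(\<Sum>s\<in>cube I. (damp I \<rho> f s - low I d (damp I \<rho> f) s)\<^sup>2) \<le> rho ^ (2 * d)" by simp
qed

lemma ser_diff: "ser \<theta> I (\<lambda>s. c s - c' s) x = ser \<theta> I c x - ser \<theta> I c' x"
  by (simp add: ser_def sum_subtractf algebra_simps)

lemma pexp_ser_sq:
  assumes "finite I"
  shows "pexp (\<lambda>_. \<mu>) I (\<lambda>x. (ser \<phi> I c x)\<^sup>2) = (\<Sum>s\<in>cube I. (c s)\<^sup>2)"
    "pexp (\<lambda>_. aunif) I (\<lambda>x. (ser (aphi v0) I c x)\<^sup>2) = (\<Sum>s\<in>cube I. (c s)\<^sup>2)"
  using pexp_ser_mult [of I \<phi> "\<lambda>_. \<mu>" c c] pexp_ser_mult [of I "aphi v0" "\<lambda>_. aunif" c c] assms orthd_mu orthd_aunif [of v0]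
  by (simp_all add: power2_eq_square)

text \<open>On the new space a series with these coefficients has no reason to be non-negative. Over
  \<open>\<mu>\<close> the damped series is, being noise applied to \<open>f\<close>, so there the
  negative part of its truncation is at most the truncated tail; \<open>psi\<close> carries this
  bound across.\<close>

lemma neg_part_small:
  assumes I: "finite I" and K: "Hyp K" and \<rho>: "\<And>i. i \<in> I \<Longrightarrow> 0 \<le> \<rho> i \<and> \<rho> i \<le> rho"
    and f: "\<And>x. x \<in> cube I \<Longrightarrow> 0 \<le> f x \<and> f x \<le> 1"
    and tau: "\<And>i. i \<in> I \<Longrightarrow> infl v0 I (low I d (damp I \<rho> f)) i \<le> \<tau>" "0 \<le> \<tau>" and a: "0 < a" "a \<le> 1"
  shows "pexp (\<lambda>_. aunif) I (\<lambda>x. (max 0 (- ser (aphi v0) I (low I d (damp I \<rho> f)) x))\<^sup>2) \<le>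
     a\<^sup>2 + (3 * rho ^ (2 * d) + 6 * K ^ d * sqrt \<tau> * real d) / a"
proof -
  define c where "c = damp I \<rho> f"
  define cd where "cd = low I d c"
  note sums = damp_sums(1) [where \<rho> = \<rho> and f = f, OF I \<rho> f, folded c_def] damp_sums(2,3) [where \<rho> = \<rho> and f = f and d = d, OF I \<rho> f, folded c_def, folded cd_def]
  have a0: "0 \<le> aunif w" for w :: "'v \<times> bool" by (simp add: aunif_def)
  have "pexp (\<lambda>_. aunif) I (\<lambda>x. psi (ser (aphi v0) I cd x)) \<le>
      pexp (\<lambda>_. \<mu>) I (\<lambda>x. psi (ser \<phi> I cd x)) + 6 * K ^ d * sqrt \<tau> * real d"
    by (rule lindeberg_chain [OF I K]) (use tau sums(2) in \<open>auto simp: c_def cd_def low_def split: if_splits\<close>)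
  also have "pexp (\<lambda>_. \<mu>) I (\<lambda>x. psi (ser \<phi> I cd x)) \<le> pexp (\<lambda>_. \<mu>) I (\<lambda>x. 3 * (ser \<phi> I (\<lambda>s. c s - cd s) x)\<^sup>2)"
  proof (rule pexp_mono [OF mu_nonneg])
    fix x :: "nat \<Rightarrow> 'v"
    have "0 \<le> ser \<phi> I c x"
      unfolding c_def damp_def by (rule noise_nonneg [OF I]) (use f \<rho> rho in force)+
    then have "max 0 (- ser \<phi> I cd x) \<le> \<bar>ser \<phi> I (\<lambda>s. c s - cd s) x\<bar>"
      unfolding ser_diff by linarith
    then have "(max 0 (- ser \<phi> I cd x))\<^sup>2 \<le> (ser \<phi> I (\<lambda>s. c s - cd s) x)\<^sup>2"
      by (metis max.cobounded1 power2_abs power_mono)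
    then show "psi (ser \<phi> I cd x) \<le> 3 * (ser \<phi> I (\<lambda>s. c s - cd s) x)\<^sup>2"
      using psi_le [of "ser \<phi> I cd x"] by linarith
  qed
  also have "\<dots> = 3 * (\<Sum>s\<in>cube I. (c s - cd s)\<^sup>2)"
    unfolding pexp_cmult pexp_ser_sq(1) [OF I] ..
  also have "\<dots> \<le> 3 * rho ^ (2 * d)"
    using sums(3) by simp
  finally have th: "pexp (\<lambda>_. aunif) I (\<lambda>x. psi (ser (aphi v0) I cd x)) \<le> 3 * rho ^ (2 * d) + 6 * K ^ d * sqrt \<tau> * real d"
    by simp
  have "pexp (\<lambda>_. aunif) I (\<lambda>x. (max 0 (- ser (aphi v0) I cd x))\<^sup>2) \<le>
     pexp (\<lambda>_. aunif) I (\<lambda>x. a\<^sup>2 + (1 / a) * psi (ser (aphi v0) I cd x))"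
    by (rule pexp_mono [OF a0]) (use neg_part_le_psi [OF a] in simp)
  also have "\<dots> = a\<^sup>2 + (1 / a) * pexp (\<lambda>_. aunif) I (\<lambda>x. psi (ser (aphi v0) I cd x))"
    unfolding pexp_add pexp_cmult using I
    by (subst pexp_const) (simp_all add: aunif_def)
  also have "\<dots> \<le> a\<^sup>2 + (1 / a) * (3 * rho ^ (2 * d) + 6 * K ^ d * sqrt \<tau> * real d)"
    using a th by (intro add_left_mono mult_left_mono) auto
  finally show ?thesis by (simp add: cd_def c_def)
qed

lemma pexp_aunif_ser:
  assumes I: "finite I"
  shows "pexp (\<lambda>_. aunif) I (ser (aphi v0) I c) = c (\<lambda>i\<in>I. v0)"
proof -
  define z where "z = (\<lambda>i\<in>I. v0)"
  have z: "z \<in> cube I" by (simp add: z_def)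
  have "ser (aphi v0) I (\<lambda>s. if s = z then 1 else 0) x = chi (aphi v0) I z x" for x
    using z I by (simp add: ser_def sum.delta if_distrib [of "\<lambda>u. u * _"] cong: if_cong)
  also have "\<And>x. chi (aphi v0) I z x = 1"
    by (simp add: chi_def z_def aphi_def)
  finally have "pexp (\<lambda>_. aunif) I (ser (aphi v0) I c) =
     pexp (\<lambda>_. aunif) I (\<lambda>x. ser (aphi v0) I c x * ser (aphi v0) I (\<lambda>s. if s = z then 1 else 0) x)"
    by simp
  also have "\<dots> = c z"
    using z I by (simp add: pexp_ser_mult orthd_aunif sum.delta if_distrib [of "\<lambda>u. _ * u"] cong: if_cong)
  finally show ?thesis by (simp add: z_def)
qed

lemma fc_const: "fc I f (\<lambda>i\<in>I. v0) = pexp (\<lambda>_. \<mu>) I f"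
  by (simp add: fc_def chi_def chi_v0)

text \<open>\<open>R\<close> is an exponent of reverse hypercontractivity for the substitute chain,
  which carries the eigenvalues left after the noise has been split off.\<close>

definition Rhc :: "nat \<Rightarrow> bool" where
  "Rhc R \<longleftrightarrow> (\<forall>I F G. finite I \<longrightarrow> (\<forall>x\<in>cube I. 0 \<le> F x \<and> F x \<le> 1 \<and> 0 \<le> G x \<and> G x \<le> 1) \<longrightarrow>
     (pexp (\<lambda>_. aunif) I F * pexp (\<lambda>_. aunif) I G) ^ R \<le>
       dexp (anu v0 (\<lambda>a. if a = v0 then 1 else lam a / sqrt \<kappa>) (sqrt \<kappa>)) I (\<lambda>x y. F x * G y))"

lemma damped_lam_le: "a \<noteq> v0 \<Longrightarrow> \<bar>if a = v0 then 1 else lam a / sqrt \<kappa>\<bar> \<le> sqrt \<kappa>"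
proof -
  assume "a \<noteq> v0"
  then have "\<bar>lam a\<bar> \<le> sqrt \<kappa> * sqrt \<kappa>"
    using lam_le lam_range by simp
  then show ?thesis
    using \<open>a \<noteq> v0\<close> rho(4) by (simp add: abs_divide divide_le_eq)
qed

lemma damped_nu_nonneg:
  "0 \<le> anu v0 (\<lambda>a. if a = v0 then 1 else lam a / sqrt \<kappa>) (sqrt \<kappa>) w v"
proof -
  have "(1 - sqrt \<kappa>) * (aunif w * aunif v) \<le> anu v0 (\<lambda>a. if a = v0 then 1 else lam a / sqrt \<kappa>) (sqrt \<kappa>) w v"
    by (rule anu_ge [OF rho(4) damped_lam_le])
  moreover have "0 \<le> (1 - sqrt \<kappa>) * (aunif w * aunif v)"
    using rho by (simp add: aunif_def)
  ultimately show ?thesis by linarith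
qed

lemma ex_Rhc: "\<exists>R\<ge>1. Rhc R"
  unfolding Rhc_def
proof (rule reverse_hypercontractive)
  let ?l = "\<lambda>a. if a = v0 then 1 else lam a / sqrt \<kappa>"
  show "1 / (2 * real CARD('v)) \<le> aunif w" for w :: "'v \<times> bool" by (simp add: aunif_def)
  show "0 < 1 / (2 * real CARD('v))" by simp
  show "(\<Sum>w\<in>UNIV. aunif (w :: 'v \<times> bool)) = 1" by (simp add: aunif_def)
  show "(1 - sqrt \<kappa>) * (aunif w * aunif v) \<le> anu v0 ?l (sqrt \<kappa>) w v" for w v
    by (rule anu_ge [OF rho(4) damped_lam_le])
  show "0 < 1 - sqrt \<kappa>" using rho by simp
  show "(\<Sum>v\<in>UNIV. anu v0 ?l (sqrt \<kappa>) w v) = aunif w" for w by (rule anu_row)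
  then show "(\<Sum>w\<in>UNIV. anu v0 ?l (sqrt \<kappa>) w v) = aunif v" for v
    by (subst anu_sym)
qed

text \<open>The functions are bounded in L2 only, whereas reverse hypercontractivity is about values
  in [0,1]. They are cut at height \<open>T\<close> and rescaled, and the second moment controls the
  loss of mean.\<close>

lemma truncated_correlation:
  assumes I: "finite I" and R: "Rhc R" and \<epsilon>: "0 < \<epsilon>" "\<epsilon> \<le> 1"
    and G: "\<And>x. 0 \<le> G1 x" "\<And>x. 0 \<le> G2 x"
    and m: "\<epsilon> \<le> pexp (\<lambda>_. aunif) I G1" "\<epsilon> \<le> pexp (\<lambda>_. aunif) I G2"
    and s: "pexp (\<lambda>_. aunif) I (\<lambda>x. (G1 x)\<^sup>2) \<le> 1" "pexp (\<lambda>_. aunif) I (\<lambda>x. (G2 x)\<^sup>2) \<le> 1"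
  shows "(\<epsilon> ^ 4 / 16) ^ R \<le>
    dexp (anu v0 (\<lambda>a. if a = v0 then 1 else lam a / sqrt \<kappa>) (sqrt \<kappa>)) I (\<lambda>x y. G1 x * G2 y)"
proof -
  let ?N = "anu v0 (\<lambda>a. if a = v0 then 1 else lam a / sqrt \<kappa>) (sqrt \<kappa>)"
  have a0: "0 \<le> aunif w" for w :: "'v \<times> bool" by (simp add: aunif_def)
  note N0 = damped_nu_nonneg
  \<comment> \<open>Maximizes \<open>\<epsilon> / T - 1 / T\<^sup>2\<close>, the lower bound for the
    mean after cutting and rescaling; the maximum is \<open>\<epsilon>\<^sup>2 / 4\<close>.\<close>
  define T where "T = 2 / \<epsilon>"
  have T: "1 \<le> T" using \<epsilon> by (simp add: T_def)
  define cut where "cut G x = min (G x) T / T" for G :: "(nat \<Rightarrow> 'v \<times> bool) \<Rightarrow> real" and x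
  have cut01: "0 \<le> cut G x \<and> cut G x \<le> 1" if "0 \<le> G x" for G x
    using that T by (auto simp: cut_def)
  have mean: "\<epsilon>\<^sup>2 / 4 \<le> pexp (\<lambda>_. aunif) I (cut G)"
    if G: "\<And>x. 0 \<le> G x" and m: "\<epsilon> \<le> pexp (\<lambda>_. aunif) I G" and s: "pexp (\<lambda>_. aunif) I (\<lambda>x. (G x)\<^sup>2) \<le> 1" for G
  proof -
    have pt: "(1 / T) * G x + (- 1 / T\<^sup>2) * (G x)\<^sup>2 \<le> cut G x" for x
    proof (cases "G x \<le> T")
      case False
      have "0 \<le> (G x - T)\<^sup>2 + T * (G x)" using G T by simp
      then have "G x * T - (G x)\<^sup>2 \<le> T\<^sup>2"
        by (simp add: power2_eq_square algebra_simps)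
      then show ?thesis using False T by (simp add: cut_def power2_eq_square field_simps)
    qed (use T in \<open>simp add: cut_def\<close>)
    have "\<epsilon>\<^sup>2 / 4 = (1 / T) * \<epsilon> + (- 1 / T\<^sup>2) * 1"
      using \<epsilon> by (simp add: T_def power2_eq_square field_simps)
    also have "\<dots> \<le> (1 / T) * pexp (\<lambda>_. aunif) I G + (- 1 / T\<^sup>2) * pexp (\<lambda>_. aunif) I (\<lambda>x. (G x)\<^sup>2)"
      using T m s by (intro add_mono mult_left_mono mult_left_mono_neg) auto
    also have "\<dots> = pexp (\<lambda>_. aunif) I (\<lambda>x. (1 / T) * G x + (- 1 / T\<^sup>2) * (G x)\<^sup>2)"
      unfolding pexp_add pexp_cmult ..
    also have "\<dots> \<le> pexp (\<lambda>_. aunif) I (cut G)"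
      by (rule pexp_mono [OF a0 pt])
    finally show ?thesis .
  qed
  have "(\<epsilon> ^ 4 / 16) ^ R = (\<epsilon>\<^sup>2 / 4 * (\<epsilon>\<^sup>2 / 4)) ^ R"
    by (simp add: power2_eq_square power4_eq_xxxx mult.assoc)
  also have "\<dots> \<le> (pexp (\<lambda>_. aunif) I (cut G1) * pexp (\<lambda>_. aunif) I (cut G2)) ^ R"
    using mean [OF G(1) m(1) s(1)] mean [OF G(2) m(2) s(2)]
    by (intro power_mono mult_mono) (auto intro: order_trans [of 0 "\<epsilon>\<^sup>2 / 4"])
  also have "\<dots> \<le> dexp ?N I (\<lambda>x y. cut G1 x * cut G2 y)"
    using R [unfolded Rhc_def, THEN spec, of I, THEN spec, of "cut G1", THEN spec, of "cut G2"] I cut01 G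
    by simp
  also have "\<dots> \<le> dexp ?N I (\<lambda>x y. G1 x * G2 y)"
  proof (intro dexp_mono N0 mult_mono)
    have "cut G x \<le> G x" if "0 \<le> G x" for G x
    proof -
      have "min (G x) T / T \<le> min (G x) T / 1" using T that by (intro divide_left_mono) auto
      then show ?thesis by (simp add: cut_def)
    qed
    then show "cut G1 x \<le> G1 x" "cut G2 x \<le> G2 x" for x using G by auto
  qed (use G cut01 in auto)
  finally show ?thesis .
qed

text \<open>Coordinates in the mask \<open>B\<close> are averaged out; on the others the noise operator with
  parameter \<open>rho\<close> is split off both functions.\<close>

theorem uninfluential_correlation:
  assumes I: "finite I" and K: "Hyp K" and R: "Rhc R" and \<epsilon>: "0 < \<epsilon>" "\<epsilon> \<le> 1"
    and f: "\<And>x. x \<in> cube I \<Longrightarrow> 0 \<le> f x \<and> f x \<le> 1" "\<And>x. x \<in> cube I \<Longrightarrow> 0 \<le> g x \<and> g x \<le> 1"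
    and m: "\<epsilon> \<le> pexp (\<lambda>_. \<mu>) I f" "\<epsilon> \<le> pexp (\<lambda>_. \<mu>) I g"
    and tau: "\<And>i. i \<in> I - B \<Longrightarrow> infl v0 I (low I d (fc I f)) i \<le> \<tau>"
      "\<And>i. i \<in> I - B \<Longrightarrow> infl v0 I (low I d (fc I g)) i \<le> \<tau>" "0 \<le> \<tau>" and a: "0 < a" "a \<le> 1"
    and e: "0 < e" "2 * (rho ^ (2 * d) + (a\<^sup>2 + (3 * rho ^ (2 * d) + 6 * K ^ d * sqrt \<tau> * real d) / a)) \<le> e\<^sup>2"
  shows "(\<epsilon> ^ 4 / 16) ^ R - 2 * e \<le>
    (\<Sum>s\<in>cube I. (\<Prod>i\<in>I. lam (s i)) * (\<Prod>i\<in>I. if s i = v0 then 1 else if i \<in> B then 0 else 1) * (fc I f s * fc I g s))"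
proof -
  let ?l = "\<lambda>a. if a = v0 then 1 else lam a / sqrt \<kappa>"
  let ?N = "anu v0 ?l (sqrt \<kappa>)"
  have a0: "0 \<le> aunif w" for w :: "'v \<times> bool" by (simp add: aunif_def)
  note N0 = damped_nu_nonneg
  have Nrow: "(\<Sum>v\<in>UNIV. ?N w v) = aunif w" for w by (rule anu_row)
  then have Ncol: "(\<Sum>w\<in>UNIV. ?N w v) = aunif v" for v by (subst anu_sym)
  define \<rho> where "\<rho> i = (if i \<in> B then 0 else rho)" for i
  have \<rho>: "0 \<le> \<rho> i \<and> \<rho> i \<le> rho" for i using rho by (simp add: \<rho>_def)
  \<comment> \<open>\<open>H\<close> carries the exact correlation but may be negative;
    \<open>G\<close>, the positive part of its truncation, is close to it in L2.\<close>
  define H where "H f = ser (aphi v0) I (damp I \<rho> f)" for f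
  define G where "G f x = max 0 (ser (aphi v0) I (low I d (damp I \<rho> f)) x)" for f x
  have G0: "0 \<le> G f x" for f x by (simp add: G_def)
  have one: "\<epsilon> \<le> pexp (\<lambda>_. aunif) I (G f) \<and> pexp (\<lambda>_. aunif) I (\<lambda>x. (G f x)\<^sup>2) \<le> 1 \<and>
      pexp (\<lambda>_. aunif) I (\<lambda>x. (H f x)\<^sup>2) \<le> 1 \<and> pexp (\<lambda>_. aunif) I (\<lambda>x. (H f x - G f x)\<^sup>2) \<le> e\<^sup>2"
    if f: "\<And>x. x \<in> cube I \<Longrightarrow> 0 \<le> f x \<and> f x \<le> 1" and m: "\<epsilon> \<le> pexp (\<lambda>_. \<mu>) I f"
      and tau': "\<And>i. i \<in> I - B \<Longrightarrow> infl v0 I (low I d (fc I f)) i \<le> \<tau>" for f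
  proof (intro conjI)
    let ?c = "damp I \<rho> f" let ?cd = "low I d (damp I \<rho> f)"
    note sums = damp_sums(1) [where \<rho> = \<rho> and f = f, OF I \<rho> f] damp_sums(2,3) [where \<rho> = \<rho> and f = f and d = d, OF I \<rho> f]
    have "deg v0 I (\<lambda>i\<in>I. v0) = 0" by (simp add: deg_def cong: conj_cong)
    then have "?cd (\<lambda>i\<in>I. v0) = pexp (\<lambda>_. \<mu>) I f"
      by (simp add: low_def damp_def fc_const)
    then have "\<epsilon> \<le> pexp (\<lambda>_. aunif) I (ser (aphi v0) I ?cd)"
      using m by (simp add: pexp_aunif_ser [OF I])
    also have "\<dots> \<le> pexp (\<lambda>_. aunif) I (G f)"
      by (rule pexp_mono [OF a0]) (simp add: G_def)
    finally show "\<epsilon> \<le> pexp (\<lambda>_. aunif) I (G f)" .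
    have "pexp (\<lambda>_. aunif) I (\<lambda>x. (G f x)\<^sup>2) \<le> pexp (\<lambda>_. aunif) I (\<lambda>x. (ser (aphi v0) I ?cd x)\<^sup>2)"
      by (rule pexp_mono [OF a0]) (auto simp: G_def max_def)
    then show "pexp (\<lambda>_. aunif) I (\<lambda>x. (G f x)\<^sup>2) \<le> 1"
      using sums(2) by (simp add: pexp_ser_sq(2) [OF I])
    show "pexp (\<lambda>_. aunif) I (\<lambda>x. (H f x)\<^sup>2) \<le> 1"
      using sums(1) by (simp add: H_def pexp_ser_sq(2) [OF I])
    have inf: "infl v0 I ?cd i \<le> \<tau>" if i: "i \<in> I" for i
    proof (cases "i \<in> B")
      case True
      \<comment> \<open>On the mask the damping parameter is 0, so no influence is left there; this
        is why the hypotheses on influences concern \<open>I - B\<close>.\<close>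
      have "?cd s = 0" if "s i \<noteq> v0" for s
      proof -
        have "(\<Prod>i\<in>I. if s i = v0 then 1 else \<rho> i) = 0"
          using i I that True by (intro prod_zero bexI [of _ i]) (auto simp: \<rho>_def)
        then show ?thesis by (simp add: low_def damp_def)
      qed
      then have "infl v0 I ?cd i = 0"
        unfolding infl_def by (intro sum.neutral) simp
      then show ?thesis using tau(3) by simp
    next
      case False
      have "infl v0 I ?cd i \<le> infl v0 I (low I d (fc I f)) i"
        unfolding infl_def
      proof (rule sum_mono)
        fix s :: "nat \<Rightarrow> 'v"
        have "(damp I \<rho> f s)\<^sup>2 \<le> (fc I f s)\<^sup>2 * rho ^ (2 * deg v0 I s)"
          by (rule damp_sq_le [where \<rho> = \<rho> and f = f, OF I \<rho>])
        also have "\<dots> \<le> (fc I f s)\<^sup>2 * 1"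
          using rho by (intro mult_left_mono power_le_one) auto
        finally show "(if s i = v0 then 0 else (?cd s)\<^sup>2) \<le> (if s i = v0 then 0 else (low I d (fc I f) s)\<^sup>2)"
          by (simp add: low_def)
      qed
      then show ?thesis using tau' [of i] i False by simp
    qed
    have "pexp (\<lambda>_. aunif) I (\<lambda>x. (H f x - G f x)\<^sup>2) \<le>
      pexp (\<lambda>_. aunif) I (\<lambda>x. 2 * ((ser (aphi v0) I (\<lambda>s. ?c s - ?cd s) x)\<^sup>2 + (max 0 (- ser (aphi v0) I ?cd x))\<^sup>2))"
    proof (rule pexp_mono [OF a0])
      fix x :: "nat \<Rightarrow> 'v \<times> bool"
      let ?u = "ser (aphi v0) I (\<lambda>s. ?c s - ?cd s) x" and ?v = "max 0 (- ser (aphi v0) I ?cd x)"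
      have "H f x - G f x = ?u - ?v"
        by (simp add: H_def G_def ser_diff max_def)
      moreover have "(?u - ?v)\<^sup>2 \<le> 2 * (?u\<^sup>2 + ?v\<^sup>2)"
        using zero_le_power2 [of "?u + ?v"] by (simp add: power2_eq_square algebra_simps)
      ultimately show "(H f x - G f x)\<^sup>2 \<le> 2 * (?u\<^sup>2 + ?v\<^sup>2)" by simp
    qed
    also have "\<dots> = 2 * ((\<Sum>s\<in>cube I. (?c s - ?cd s)\<^sup>2) + pexp (\<lambda>_. aunif) I (\<lambda>x. (max 0 (- ser (aphi v0) I ?cd x))\<^sup>2))"
      unfolding pexp_cmult pexp_add pexp_ser_sq(2) [OF I] ..
    also have "\<dots> \<le> 2 * (rho ^ (2 * d) + (a\<^sup>2 + (3 * rho ^ (2 * d) + 6 * K ^ d * sqrt \<tau> * real d) / a))"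
      by (intro mult_left_mono add_mono sums(3) neg_part_small I K \<rho> f inf tau(3) a) auto
    finally show "pexp (\<lambda>_. aunif) I (\<lambda>x. (H f x - G f x)\<^sup>2) \<le> e\<^sup>2"
      using e(2) by linarith
  qed
  note F = one [OF f(1) m(1) tau(1), simplified] and G = one [OF f(2) m(2) tau(2), simplified]
  have "(\<epsilon> ^ 4 / 16) ^ R - 2 * e = (\<epsilon> ^ 4 / 16) ^ R + (- e) + (- e)" by simp
  \<comment> \<open>The three terms telescope to the correlation of \<open>H f\<close> and
    \<open>H g\<close>. Reverse hypercontractivity handles the first, closeness in L2 the other
    two.\<close>
  also have "\<dots> \<le> dexp ?N I (\<lambda>x y. G f x * G g y) + dexp ?N I (\<lambda>x y. (H f x - G f x) * H g y)
      + dexp ?N I (\<lambda>x y. G f x * (H g y - G g y))"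
  proof (intro add_mono)
    show "(\<epsilon> ^ 4 / 16) ^ R \<le> dexp ?N I (\<lambda>x y. G f x * G g y)"
      by (rule truncated_correlation [OF I R \<epsilon> G0 G0]) (use F G in auto)
    show "- e \<le> dexp ?N I (\<lambda>x y. (H f x - G f x) * H g y)"
      by (rule dexp_ge_minus [OF I N0 Nrow Ncol e(1)]) (use F G in auto)
    have "- e \<le> dexp (\<lambda>x y. ?N y x) I (\<lambda>y x. (H g y - G g y) * G f x)"
      by (rule dexp_ge_minus [OF I N0 Ncol Nrow e(1)]) (use F G in auto)
    then show "- e \<le> dexp ?N I (\<lambda>x y. G f x * (H g y - G g y))"
      by (subst dexp_swap) (simp add: mult.commute)
  qed
  also have "\<dots> = dexp ?N I (\<lambda>x y. H f x * H g y)"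
    unfolding dexp_add [symmetric] by (rule dexp_cong) (auto simp: algebra_simps)
  also have "\<dots> = (\<Sum>s\<in>cube I. (\<Prod>i\<in>I. ?l (s i)) * (damp I \<rho> f s * damp I \<rho> g s))"
    unfolding H_def by (rule dexp_ser_mult [OF I anu_aphi]) (use rho in auto)
  also have "\<dots> = (\<Sum>s\<in>cube I. (\<Prod>i\<in>I. lam (s i)) * (\<Prod>i\<in>I. if s i = v0 then 1 else if i \<in> B then 0 else 1) * (fc I f s * fc I g s))"
  proof (rule sum.cong)
    fix s :: "nat \<Rightarrow> 'v"
    \<comment> \<open>Each nontrivial unmasked coordinate receives \<open>rho\<close> twice, which
      cancels the division by \<open>sqrt \<kappa>\<close>.\<close>
    have "(\<Prod>i\<in>I. ?l (s i)) * ((\<Prod>i\<in>I. if s i = v0 then 1 else \<rho> i) * (\<Prod>i\<in>I. if s i = v0 then 1 else \<rho> i)) =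
      (\<Prod>i\<in>I. lam (s i) * (if s i = v0 then 1 else if i \<in> B then 0 else 1))"
      unfolding prod.distrib [symmetric]
      by (intro prod.cong refl) (use rho(3,4) in \<open>auto simp: lam_v0 \<rho>_def power2_eq_square field_simps\<close>)
    then show "(\<Prod>i\<in>I. ?l (s i)) * (damp I \<rho> f s * damp I \<rho> g s) =
      (\<Prod>i\<in>I. lam (s i)) * (\<Prod>i\<in>I. if s i = v0 then 1 else if i \<in> B then 0 else 1) * (fc I f s * fc I g s)"
      unfolding damp_def prod.distrib by (simp add: mult_ac)
  qed simp
  finally show ?thesis .
qed

end

text \<open>Numerical constants are absorbed into spare powers of \<open>x\<close>, at the price of
  a fixed increase of the exponent.\<close>

lemma half_power_mult_le:
  fixes x :: real
  assumes "0 \<le> x" "x \<le> 1 / 2" shows "2 * x \<le> 1" "4 * x ^ 2 \<le> 1" "6 * x ^ 3 \<le> 1"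
proof -
  show "2 * x \<le> 1" using assms by simp
  have "x ^ 2 \<le> (1 / 2) ^ 2" "x ^ 3 \<le> (1 / 2) ^ 3"
    using assms by (intro power_mono; simp)+
  then show "4 * x ^ 2 \<le> 1" "6 * x ^ 3 \<le> 1"
    by (simp_all add: power2_eq_square power3_eq_cube)
qed

section \<open>Influential coordinates and the error of masking them\<close>

context spectral_chain
begin

lemma abs_lam_prod_le:
  assumes "finite I" shows "\<bar>\<Prod>i\<in>I. lam (s i)\<bar> \<le> \<kappa> ^ deg v0 I s"
proof -
  have "\<bar>\<Prod>i\<in>I. lam (s i)\<bar> = (\<Prod>i\<in>I. \<bar>lam (s i)\<bar>)"
    by (rule abs_prod)
  also have "\<dots> \<le> (\<Prod>i\<in>I. if s i = v0 then 1 else \<kappa>)"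
    by (intro prod_mono) (auto simp: lam_v0 lam_le)
  finally show ?thesis by (simp add: prod_if_power [OF assms])
qed

definition linf :: "nat set \<Rightarrow> nat \<Rightarrow> ((nat \<Rightarrow> 'v) \<Rightarrow> real) \<Rightarrow> nat \<Rightarrow> real" where
  "linf I d f i = infl v0 I (low I d (fc I f)) i"

lemma linf_nonneg: "0 \<le> linf I d f i"
  unfolding linf_def infl_def by (intro sum_nonneg) auto

lemma sum_low_sq_le: "finite I \<Longrightarrow> (\<And>x. x \<in> cube I \<Longrightarrow> 0 \<le> f x \<and> f x \<le> 1) \<Longrightarrow> (\<Sum>s\<in>cube I. (low I d (fc I f) s)\<^sup>2) \<le> 1"
  by (rule order_trans [OF sum_mono sum_fc_le_1 [of I f]]) (auto simp: low_def)

lemma linf_le_1: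
  assumes "finite I" "\<And>x. x \<in> cube I \<Longrightarrow> 0 \<le> f x \<and> f x \<le> 1"
  shows "linf I d f i \<le> 1"
  unfolding linf_def infl_def
  by (rule order_trans [OF sum_mono sum_low_sq_le [of I f d]]) (use assms in auto)

lemma sum_linf_le:
  assumes "finite I" "\<And>x. x \<in> cube I \<Longrightarrow> 0 \<le> f x \<and> f x \<le> 1"
  shows "(\<Sum>i\<in>I. linf I d f i) \<le> real d"
proof -
  have "(\<Sum>i\<in>I. linf I d f i) \<le> real d * (\<Sum>s\<in>cube I. (low I d (fc I f) s)\<^sup>2)"
    unfolding linf_def by (rule sum_infl_le [OF assms(1)]) (auto simp: low_def split: if_splits)
  also have "\<dots> \<le> real d * 1"
    using sum_low_sq_le [OF assms] by (intro mult_left_mono) auto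
  finally show ?thesis by simp
qed

text \<open>Markov's inequality for the total low-degree influence, which is at most
  \<open>d\<close>.\<close>

lemma card_influential_le:
  assumes "finite I" "\<And>x. x \<in> cube I \<Longrightarrow> 0 \<le> f x \<and> f x \<le> 1"
  shows "real (card {i\<in>I. \<tau> < linf I d f i}) * \<tau> \<le> real d"
proof -
  have "real (card {i\<in>I. \<tau> < linf I d f i}) * \<tau> = (\<Sum>i\<in>{i\<in>I. \<tau> < linf I d f i}. \<tau>)" by simp
  also have "\<dots> \<le> (\<Sum>i\<in>{i\<in>I. \<tau> < linf I d f i}. linf I d f i)"
    by (intro sum_mono) auto
  also have "\<dots> \<le> (\<Sum>i\<in>I. linf I d f i)"
    using assms(1) linf_nonneg by (intro sum_mono2) auto
  finally show ?thesis using sum_linf_le [OF assms] by (meson order_trans)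
qed

text \<open>Masking changes only the terms with a nontrivial index in \<open>B\<close>. Those of
  degree above \<open>d\<close> total at most \<open>\<kappa> ^ d\<close>. The others are charged to
  some \<open>i \<in> B\<close>, where Cauchy-Schwarz gives the geometric mean of two influences,
  one at most \<open>\<tau>\<^sup>2\<close> and the other at most 1.\<close>

lemma mask_error:
  assumes I: "finite I" and B: "B \<subseteq> I"
    and f: "\<And>x. x \<in> cube I \<Longrightarrow> 0 \<le> f x \<and> f x \<le> 1" and g: "\<And>x. x \<in> cube I \<Longrightarrow> 0 \<le> g x \<and> g x \<le> 1"
    and tau: "\<And>i. i \<in> B \<Longrightarrow> linf I d f i \<le> \<tau>\<^sup>2 \<or> linf I d g i \<le> \<tau>\<^sup>2" and tau0: "0 \<le> \<tau>"
  shows "(\<Sum>s\<in>cube I. (\<Prod>i\<in>I. lam (s i)) * (\<Prod>i\<in>I. if s i = v0 then 1 else if i \<in> B then 0 else 1) * (fc I f s * fc I g s))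
     \<le> dexp \<nu> I (\<lambda>x y. f x * g y) + (real (card B) * \<tau> + \<kappa> ^ d)"
proof -
  let ?l = "\<lambda>s. \<Prod>i\<in>I. lam (s i)" and ?m = "\<lambda>s. \<Prod>i\<in>I. if s i = v0 then 1 else if i \<in> B then 0 else (1::real)"
  let ?F = "fc I f" and ?G = "fc I g"
  let ?LF = "low I d ?F" and ?LG = "low I d ?G"
  have finB: "finite B" using B I finite_subset by blast
  have pt: "?l s * ?m s * (?F s * ?G s) \<le> ?l s * (?F s * ?G s) +
      ((\<Sum>i\<in>B. if s i = v0 then 0 else \<bar>?LF s\<bar> * \<bar>?LG s\<bar>) + \<kappa> ^ d * (((?F s)\<^sup>2 + (?G s)\<^sup>2) / 2))" for s
  proof (cases "\<exists>i\<in>B. s i \<noteq> v0")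
    case False
    then have "?m s = 1"
      by (intro prod.neutral) auto
    moreover have "0 \<le> (\<Sum>i\<in>B. if s i = v0 then 0 else \<bar>?LF s\<bar> * \<bar>?LG s\<bar>)"
      by (intro sum_nonneg) auto
    moreover have "0 \<le> \<kappa> ^ d * (((?F s)\<^sup>2 + (?G s)\<^sup>2) / 2)"
      using lam_range by simp
    ultimately show ?thesis by simp
  next
    case True
    then obtain i where i: "i \<in> B" "s i \<noteq> v0" by blast
    then have "?m s = 0"
      using I B by (intro prod_zero bexI [of _ i]) auto
    moreover have "- (?l s * (?F s * ?G s)) \<le> (\<Sum>i\<in>B. if s i = v0 then 0 else \<bar>?LF s\<bar> * \<bar>?LG s\<bar>) + \<kappa> ^ d * (((?F s)\<^sup>2 + (?G s)\<^sup>2) / 2)"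
    proof -
      have "- (?l s * (?F s * ?G s)) \<le> \<bar>?l s\<bar> * (\<bar>?F s\<bar> * \<bar>?G s\<bar>)"
        by (metis abs_ge_minus_self abs_mult)
      also have "\<dots> \<le> \<kappa> ^ deg v0 I s * (\<bar>?F s\<bar> * \<bar>?G s\<bar>)"
        by (intro mult_right_mono abs_lam_prod_le I) auto
      finally have le: "- (?l s * (?F s * ?G s)) \<le> \<kappa> ^ deg v0 I s * (\<bar>?F s\<bar> * \<bar>?G s\<bar>)" .
      show ?thesis
      proof (cases "deg v0 I s \<le> d")
        case True
        have "\<kappa> ^ deg v0 I s * (\<bar>?F s\<bar> * \<bar>?G s\<bar>) \<le> 1 * (\<bar>?F s\<bar> * \<bar>?G s\<bar>)"
          using lam_range by (intro mult_right_mono power_le_one) auto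
        also have "\<dots> = (if s i = v0 then 0 else \<bar>?LF s\<bar> * \<bar>?LG s\<bar>)"
          using True i by (simp add: low_def)
        also have "\<dots> \<le> (\<Sum>i\<in>B. if s i = v0 then 0 else \<bar>?LF s\<bar> * \<bar>?LG s\<bar>)"
          by (rule member_le_sum [of i B "\<lambda>i. if s i = v0 then 0 else \<bar>?LF s\<bar> * \<bar>?LG s\<bar>"]) (use i finB in auto)
        moreover have "0 \<le> \<kappa> ^ d * (((?F s)\<^sup>2 + (?G s)\<^sup>2) / 2)"
          using lam_range by simp
        ultimately show ?thesis using le by linarith
      next
        case False
        have "\<kappa> ^ deg v0 I s * (\<bar>?F s\<bar> * \<bar>?G s\<bar>) \<le> \<kappa> ^ d * (\<bar>?F s\<bar> * \<bar>?G s\<bar>)"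
          using lam_range False by (intro mult_right_mono power_decreasing) auto
        also have "\<dots> \<le> \<kappa> ^ d * (((?F s)\<^sup>2 + (?G s)\<^sup>2) / 2)"
        proof (intro mult_left_mono)
          show "\<bar>?F s\<bar> * \<bar>?G s\<bar> \<le> ((?F s)\<^sup>2 + (?G s)\<^sup>2) / 2"
            using zero_le_power2 [of "\<bar>?F s\<bar> - \<bar>?G s\<bar>"] by (simp add: power2_eq_square algebra_simps)
        qed (use lam_range in simp)
        moreover have "0 \<le> (\<Sum>i\<in>B. if s i = v0 then 0 else \<bar>?LF s\<bar> * \<bar>?LG s\<bar>)"
          by (intro sum_nonneg) auto
        ultimately show ?thesis using le by linarith
      qed
    qed
    ultimately show ?thesis by simp
  qed
  have CS: "(\<Sum>s\<in>cube I. if s i = v0 then 0 else \<bar>?LF s\<bar> * \<bar>?LG s\<bar>) \<le> \<tau>" if i: "i \<in> B" for i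
  proof (rule power2_le_imp_le [OF _ tau0])
    let ?u = "\<lambda>s. if s i = v0 then 0 else \<bar>?LF s\<bar>" and ?v = "\<lambda>s. if s i = v0 then 0 else \<bar>?LG s\<bar>"
    have "(\<Sum>s\<in>cube I. if s i = v0 then 0 else \<bar>?LF s\<bar> * \<bar>?LG s\<bar>)\<^sup>2 = (\<Sum>s\<in>cube I. ?u s * ?v s)\<^sup>2"
      by (intro arg_cong [where f = "\<lambda>x. x\<^sup>2"] sum.cong) auto
    also have "\<dots> \<le> (\<Sum>s\<in>cube I. (?u s)\<^sup>2) * (\<Sum>s\<in>cube I. (?v s)\<^sup>2)"
      by (rule Cauchy_Schwarz_ineq_sum)
    also have "(\<Sum>s\<in>cube I. (?u s)\<^sup>2) = linf I d f i"
      unfolding linf_def infl_def by (intro sum.cong) auto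
    also have "(\<Sum>s\<in>cube I. (?v s)\<^sup>2) = linf I d g i"
      unfolding linf_def infl_def by (intro sum.cong) auto
    also have "linf I d f i * linf I d g i \<le> \<tau>\<^sup>2"
      using tau [OF i]
    proof
      assume "linf I d f i \<le> \<tau>\<^sup>2"
      then have "linf I d f i * linf I d g i \<le> \<tau>\<^sup>2 * 1"
        using linf_nonneg linf_le_1 [OF I g] by (intro mult_mono) auto
      then show ?thesis by simp
    next
      assume "linf I d g i \<le> \<tau>\<^sup>2"
      then have "linf I d f i * linf I d g i \<le> 1 * \<tau>\<^sup>2"
        using linf_nonneg linf_le_1 [OF I f] by (intro mult_mono) auto
      then show ?thesis by simp
    qed
    finally show "(\<Sum>s\<in>cube I. if s i = v0 then 0 else \<bar>?LF s\<bar> * \<bar>?LG s\<bar>)\<^sup>2 \<le> \<tau>\<^sup>2" .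
  qed
  have "(\<Sum>s\<in>cube I. ?l s * ?m s * (?F s * ?G s)) \<le> (\<Sum>s\<in>cube I. ?l s * (?F s * ?G s) +
      ((\<Sum>i\<in>B. if s i = v0 then 0 else \<bar>?LF s\<bar> * \<bar>?LG s\<bar>) + \<kappa> ^ d * (((?F s)\<^sup>2 + (?G s)\<^sup>2) / 2)))"
    by (rule sum_mono [OF pt])
  also have "\<dots> = dexp \<nu> I (\<lambda>x y. f x * g y) + ((\<Sum>i\<in>B. \<Sum>s\<in>cube I. if s i = v0 then 0 else \<bar>?LF s\<bar> * \<bar>?LG s\<bar>)
      + \<kappa> ^ d * (((\<Sum>s\<in>cube I. (?F s)\<^sup>2) + (\<Sum>s\<in>cube I. (?G s)\<^sup>2)) / 2))"
    unfolding sum.distrib parseval_nu [OF I] sum.swap [of _ B]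
    by (simp add: sum.distrib sum_divide_distrib [symmetric] sum_distrib_left [symmetric])
  also have "\<dots> \<le> dexp \<nu> I (\<lambda>x y. f x * g y) + ((\<Sum>i\<in>B. \<tau>) + \<kappa> ^ d * ((1 + 1) / 2))"
    using lam_range sum_fc_le_1 [OF I f] sum_fc_le_1 [OF I g]
    by (intro add_left_mono add_mono sum_mono CS mult_left_mono divide_right_mono) auto
  finally show ?thesis by simp
qed

text \<open>Two thresholds are at work. The mask \<open>B\<close> collects the coordinates exceeding
  the larger one for either function, so outside \<open>B\<close> neither function is influenced
  much. On \<open>B\<close> one of the two influences is below the far smaller threshold, and as the
  size of \<open>B\<close> is bounded by means of the larger one, masking is cheap.\<close>

theorem correlation_or_influence:
  "\<exists>C D. \<forall>m\<ge>1. \<forall>I f g. finite I \<longrightarrow> (\<forall>x\<in>cube I. 0 \<le> f x \<and> f x \<le> 1 \<and> 0 \<le> g x \<and> g x \<le> 1) \<longrightarrow>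
     (1 / 2) ^ m \<le> pexp (\<lambda>_. \<mu>) I f \<longrightarrow> (1 / 2) ^ m \<le> pexp (\<lambda>_. \<mu>) I g \<longrightarrow>
     (\<forall>i\<in>I. linf I (D * m) f i \<le> (1 / 2) ^ (C * m) \<or> linf I (D * m) g i \<le> (1 / 2) ^ (C * m)) \<longrightarrow>
     (1 / 2) ^ (C * m) \<le> dexp \<nu> I (\<lambda>x y. f x * g y)"
proof -
  obtain k :: nat where K: "Hyp (2 ^ k)" using ex_Hyp by blast
  obtain R where R: "Rhc R" "1 \<le> R" using ex_Rhc by blast
  \<comment> \<open>\<open>b\<close> comes from \<open>x ^ 4 / 16 \<ge> x ^ 8\<close>; all errors
    must stay below a fraction of \<open>x ^ b\<close>. \<open>c\<close> leaves room for the
    division by \<open>a = x ^ (b + 4)\<close> and the square root that produces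
    \<open>e = x ^ (b + 2)\<close>.\<close>
  define b where "b = 8 * R"
  define c where "c = 4 * b + 20"
  have "rho\<^sup>2 < 1" using rho by simp
  then obtain D where D: "(rho\<^sup>2) ^ D < (1 / 2) ^ c"
    using real_arch_pow_inv [of "(1 / 2) ^ c" "rho\<^sup>2"] by auto
  \<comment> \<open>\<open>t\<close> pays for the factors 6, \<open>K ^ d\<close> and
    \<open>d\<close> of the replacement error, \<open>u\<close> for the size of \<open>B\<close>,
    and \<open>C\<close> puts the second threshold below the square of \<open>x ^ u\<close>.\<close>
  define t where "t = c + 3 + k * D + D"
  define u where "u = 2 * t + 1 + D + c"
  define C where "C = 2 * u + b + 2"
  have "(1 / 2) ^ (C * m) \<le> dexp \<nu> I (\<lambda>x y. f x * g y)"
    if m: "1 \<le> m" and I: "finite I" and fg: "\<forall>x\<in>cube I. 0 \<le> f x \<and> f x \<le> 1 \<and> 0 \<le> g x \<and> g x \<le> 1"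
      and mf: "(1 / 2) ^ m \<le> pexp (\<lambda>_. \<mu>) I f" and mg: "(1 / 2) ^ m \<le> pexp (\<lambda>_. \<mu>) I g"
      and inf: "\<forall>i\<in>I. linf I (D * m) f i \<le> (1 / 2) ^ (C * m) \<or> linf I (D * m) g i \<le> (1 / 2) ^ (C * m)"
    for m I f g
  proof -
    have f: "\<And>x. x \<in> cube I \<Longrightarrow> 0 \<le> f x \<and> f x \<le> 1" and g: "\<And>x. x \<in> cube I \<Longrightarrow> 0 \<le> g x \<and> g x \<le> 1"
      using fg by auto
    define x :: real where "x = (1 / 2) ^ m"
    have x: "0 < x" "x \<le> 1 / 2" "x \<le> 1"
      using m power_decreasing [of 1 m "1 / 2 :: real"] by (auto simp: x_def power_le_one)
    have xp: "(1 / 2) ^ (n * m) = x ^ n" for n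
      by (simp add: x_def power_mult [symmetric] mult.commute)
    note half = half_power_mult_le [OF less_imp_le [OF x(1)] x(2)]
    have xdec: "n \<le> n' \<Longrightarrow> x ^ n' \<le> x ^ n" for n n'
      using x by (intro power_decreasing) auto
    define d where "d = D * m"
    have rd: "rho ^ (2 * d) \<le> x ^ c"
    proof -
      have "rho ^ (2 * d) = ((rho\<^sup>2) ^ D) ^ m"
        by (simp add: d_def power_mult [symmetric] mult.assoc)
      also have "\<dots> \<le> ((1 / 2) ^ c) ^ m"
        using D by (intro power_mono) auto
      finally show ?thesis by (simp add: x_def power_mult [symmetric] mult.commute)
    qed
    have kd: "\<kappa> ^ d \<le> x ^ c"
    proof -
      have "\<kappa> = rho\<^sup>2 * rho\<^sup>2" using lam_range by (simp add: rho(3))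
      also have "\<dots> \<le> rho\<^sup>2 * 1" using rho by (intro mult_left_mono power_le_one) auto
      finally have "\<kappa> ^ d \<le> (rho\<^sup>2) ^ d" using lam_range by (intro power_mono) auto
      then show ?thesis using rd by (simp add: power_mult)
    qed
    have dx: "real d * x ^ D \<le> 1"
    proof -
      have "real d \<le> 2 ^ d" by (rule less_imp_le [OF of_nat_less_two_power])
      then have "real d * x ^ D \<le> 2 ^ d * x ^ D" using x by (intro mult_right_mono) auto
      also have "\<dots> = 1" by (simp add: d_def x_def power_mult [symmetric] mult.commute power_one_over)
      finally show ?thesis .
    qed
    have Kx: "(2 ^ k) ^ d * x ^ (k * D) = 1"
      by (simp add: d_def x_def power_mult [symmetric] mult_ac power_one_over)
    have err: "6 * (2 ^ k) ^ d * sqrt (x ^ (2 * t)) * real d \<le> x ^ c"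
    proof -
      have "sqrt (x ^ (2 * t)) = x ^ t"
        using x by (simp add: power_mult mult.commute [of 2] real_sqrt_power [symmetric])
      then have "6 * (2 ^ k) ^ d * sqrt (x ^ (2 * t)) * real d = x ^ c * (6 * x ^ 3) * ((2 ^ k) ^ d * x ^ (k * D)) * (real d * x ^ D)"
        by (simp add: t_def power_add mult_ac)
      also have "\<dots> \<le> x ^ c * 1 * 1 * 1"
        unfolding Kx using x by (intro mult_mono half dx) auto
      finally show ?thesis by simp
    qed
    define B where "B = {i\<in>I. x ^ (2 * t) < linf I d f i} \<union> {i\<in>I. x ^ (2 * t) < linf I d g i}"
    have BI: "B \<subseteq> I" by (auto simp: B_def)
    have cB: "real (card B) * x ^ (2 * t) \<le> 2 * real d"
    proof -
      have "real (card B) \<le> real (card {i\<in>I. x ^ (2 * t) < linf I d f i}) + real (card {i\<in>I. x ^ (2 * t) < linf I d g i})"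
        unfolding B_def of_nat_add [symmetric] of_nat_le_iff by (rule card_Un_le)
      then have "real (card B) * x ^ (2 * t) \<le> (real (card {i\<in>I. x ^ (2 * t) < linf I d f i}) + real (card {i\<in>I. x ^ (2 * t) < linf I d g i})) * x ^ (2 * t)"
        using x by (intro mult_right_mono) auto
      then show ?thesis
        using card_influential_le [where \<tau> = "x ^ (2 * t)" and d = d and f = f, OF I f] card_influential_le [where \<tau> = "x ^ (2 * t)" and d = d and f = g, OF I g]
        by (simp add: distrib_right)
    qed
    have cBu: "real (card B) * x ^ u \<le> x ^ c"
    proof -
      have "real (card B) * x ^ u = (real (card B) * x ^ (2 * t)) * x * x ^ D * x ^ c"
        by (simp add: u_def power_add mult_ac)
      also have "\<dots> \<le> (2 * real d) * x * x ^ D * x ^ c"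
        using x cB by (intro mult_right_mono) auto
      also have "\<dots> = (2 * x) * (real d * x ^ D) * x ^ c" by (simp add: mult_ac)
      also have "\<dots> \<le> 1 * 1 * x ^ c"
        using x by (intro mult_mono half dx) auto
      finally show ?thesis by simp
    qed
    let ?M = "\<Sum>s\<in>cube I. (\<Prod>i\<in>I. lam (s i)) * (\<Prod>i\<in>I. if s i = v0 then 1 else if i \<in> B then 0 else 1) * (fc I f s * fc I g s)"
    have "(x ^ 4 / 16) ^ R - 2 * x ^ (b + 2) \<le> ?M"
    proof (rule uninfluential_correlation [OF I K R(1) x(1,3) f g mf [folded x_def] mg [folded x_def]])
      show "infl v0 I (low I d (fc I f)) i \<le> x ^ (2 * t)" "infl v0 I (low I d (fc I g)) i \<le> x ^ (2 * t)" if "i \<in> I - B" for i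
        using that by (auto simp: B_def linf_def not_less)
      show "0 < x ^ (b + 4)" "x ^ (b + 4) \<le> 1" "0 < x ^ (b + 2)" "0 \<le> x ^ (2 * t)"
        using x by (auto intro: power_le_one)
      have "(3 * rho ^ (2 * d) + 6 * (2 ^ k) ^ d * sqrt (x ^ (2 * t)) * real d) / x ^ (b + 4) \<le> (4 * x ^ c) / x ^ (b + 4)"
        using rd err x by (intro divide_right_mono) auto
      also have "\<dots> = (4 * x ^ 2) * x ^ (3 * b + 14)"
      proof -
        have "c = (b + 4) + (2 + (3 * b + 14))" by (simp add: c_def)
        then have "x ^ c = x ^ (b + 4) * (x ^ 2 * x ^ (3 * b + 14))" by (simp only: power_add)
        then show ?thesis using x by simp
      qed
      also have "\<dots> \<le> 1 * x ^ (2 * b + 8)"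
        using x by (intro mult_mono xdec half) auto
      finally have q: "(3 * rho ^ (2 * d) + 6 * (2 ^ k) ^ d * sqrt (x ^ (2 * t)) * real d) / x ^ (b + 4) \<le> x ^ (2 * b + 8)"
        by simp
      have "(x ^ (b + 4))\<^sup>2 = x ^ (2 * b + 8)" by (simp add: power_mult [symmetric] mult.commute)
      moreover have three: "2 * (p + (q + r)) \<le> 6 * M" if "p \<le> M" "q = M" "r \<le> M" for p q r M :: real
        using that by simp
      moreover have "rho ^ (2 * d) \<le> x ^ (2 * b + 8)"
        using rd xdec [of "2 * b + 8" c] by (simp add: c_def)
      ultimately have "2 * (rho ^ (2 * d) + ((x ^ (b + 4))\<^sup>2 + (3 * rho ^ (2 * d) + 6 * (2 ^ k) ^ d * sqrt (x ^ (2 * t)) * real d) / x ^ (b + 4)))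
         \<le> 6 * x ^ (2 * b + 8)"
        using three [OF _ _ q] by blast
      also have "\<dots> = (6 * x ^ 3) * x ^ (2 * b + 5)"
        by (simp add: power_add [symmetric] eval_nat_numeral)
      also have "\<dots> \<le> 1 * x ^ (2 * b + 4)"
        using x by (intro mult_mono xdec half) auto
      also have "\<dots> = (x ^ (b + 2))\<^sup>2"
      proof -
        have "2 * b + 4 = (b + 2) * 2" by simp
        then show ?thesis by (simp only: power_mult mult_1)
      qed
      finally show "2 * (rho ^ (2 * d) + ((x ^ (b + 4))\<^sup>2 + (3 * rho ^ (2 * d) + 6 * (2 ^ k) ^ d * sqrt (x ^ (2 * t)) * real d) / x ^ (b + 4)))
         \<le> (x ^ (b + 2))\<^sup>2" .
    qed
    moreover have "?M \<le> dexp \<nu> I (\<lambda>x y. f x * g y) + (real (card B) * x ^ u + \<kappa> ^ d)"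
    proof (rule mask_error [OF I BI f g])
      fix i assume "i \<in> B"
      then have "linf I d f i \<le> x ^ C \<or> linf I d g i \<le> x ^ C"
        using inf BI by (auto simp: d_def xp)
      moreover have "x ^ C \<le> (x ^ u)\<^sup>2"
        using xdec [of "2 * u" C] by (simp add: C_def power_mult [symmetric] mult.commute)
      ultimately show "linf I d f i \<le> (x ^ u)\<^sup>2 \<or> linf I d g i \<le> (x ^ u)\<^sup>2" by linarith
    qed (use x in auto)
    ultimately have "(x ^ 4 / 16) ^ R - 2 * x ^ (b + 2) - 2 * x ^ c \<le> dexp \<nu> I (\<lambda>x y. f x * g y)"
      using cBu kd by linarith
    moreover have "x ^ b \<le> (x ^ 4 / 16) ^ R"
    proof -
      have "x ^ 4 \<le> (1 / 2) ^ 4" using x by (intro power_mono) auto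
      then have "x ^ 4 * x ^ 4 \<le> x ^ 4 * (1 / 16)" using x by (intro mult_left_mono) (auto simp: power4_eq_xxxx)
      then have "x ^ 8 \<le> x ^ 4 / 16" by (simp flip: power_add)
      then have "(x ^ 8) ^ R \<le> (x ^ 4 / 16) ^ R" using x by (intro power_mono) auto
      then show ?thesis by (simp add: b_def power_mult)
    qed
    moreover have b2: "4 * x ^ (b + 2) \<le> x ^ b"
    proof -
      have "4 * x ^ (b + 2) = 4 * x\<^sup>2 * x ^ b"
        unfolding power_add by (simp only: mult_ac)
      also have "\<dots> \<le> 1 * x ^ b" using x by (intro mult_right_mono half) auto
      finally show ?thesis by simp
    qed
    moreover have "2 * x ^ c \<le> x ^ b / 4"
    proof -
      have "2 * x ^ c \<le> 2 * x ^ (b + 3)" using xdec [of "b + 3" c] by (simp add: c_def)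
      also have "\<dots> = (2 * x) * (x ^ 2) * x ^ b" by (simp add: power_add power2_eq_square power3_eq_cube)
      also have "\<dots> \<le> 1 * (1 / 4) * x ^ b"
      proof (intro mult_mono)
        show "x\<^sup>2 \<le> 1 / 4" using half(2) by linarith
      qed (use half x in auto)
      finally show ?thesis by simp
    qed
    moreover have "x ^ C \<le> x ^ b / 4"
    proof -
      have "x ^ C \<le> x ^ (b + 2)" using xdec [of "b + 2" C] by (simp add: C_def)
      then show ?thesis using b2 by linarith
    qed
    ultimately show ?thesis unfolding xp by linarith
  qed
  then show ?thesis by blast
qed

end

section \<open>Approximation by juntas\<close>

context spectral_chain
begin

text \<open>A level inequality. \<open>W\<close> is the inner product of \<open>F\<close> with its
  low-degree part \<open>h\<close>; Cauchy-Schwarz twice and the fourth moment of \<open>h\<close>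
  give \<open>W ^ 4 \<le> a ^ 3 * (W * K ^ d)\<^sup>2\<close>, and
  \<open>a \<le> \<theta>\<^sup>2\<close>.\<close>

lemma low_weight_small_set:
  assumes I: "finite I" and K: "Hyp K" and F: "\<And>x. F x = 0 \<or> F x = 1"
    and small: "pexp (\<lambda>_. \<mu>) I F \<le> \<theta>\<^sup>2" "0 \<le> \<theta>"
  shows "(\<Sum>s\<in>cube I. (low I d (fc I F) s)\<^sup>2) \<le> \<theta> * K ^ d * pexp (\<lambda>_. \<mu>) I F"
proof -
  define a where "a = pexp (\<lambda>_. \<mu>) I F"
  define c where "c = low I d (fc I F)"
  define h where "h = ser \<phi> I c"
  define W where "W = (\<Sum>s\<in>cube I. (c s)\<^sup>2)"
  have a0: "0 \<le> a"
    unfolding a_def by (rule pexp_nonneg [OF mu_nonneg]) (use F in \<open>metis order_refl zero_le_one\<close>)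
  have W0: "0 \<le> W" unfolding W_def by (simp add: sum_nonneg)
  have K4: "4 \<le> K" using K by (simp add: Hyp_def)
  have FF: "(F x)\<^sup>2 = F x" "F x * F x = F x" for x
    using F [of x] by auto
  have fch: "fc I h s = c s" if "s \<in> cube I" for s
  proof -
    have "chi \<phi> I s x = ser \<phi> I (\<lambda>t. if t = s then 1 else 0) x" for x
      using that I by (simp add: ser_def sum.delta if_distrib [of "\<lambda>u. u * _"] cong: if_cong)
    then have "fc I h s = (\<Sum>t\<in>cube I. c t * (if t = s then 1 else 0))"
      unfolding fc_def h_def by (simp add: pexp_ser_mult I orthd_mu)
    then show ?thesis using that I by (simp add: sum.delta if_distrib [of "\<lambda>u. _ * u"] cong: if_cong)
  qed
  have "pexp (\<lambda>_. \<mu>) I (\<lambda>x. F x * h x) = (\<Sum>s\<in>cube I. fc I F s * c s)"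
    by (simp add: parseval [OF I] fch)
  also have "\<dots> = W"
    unfolding W_def by (intro sum.cong refl) (simp add: c_def low_def power2_eq_square)
  finally have Fh: "pexp (\<lambda>_. \<mu>) I (\<lambda>x. F x * h x) = W" .
  have "(\<Sum>s\<in>cube I. (c s)\<^sup>2 * K ^ deg v0 I s) \<le> (\<Sum>s\<in>cube I. (c s)\<^sup>2 * K ^ d)"
    by (intro sum_mono) (use K4 in \<open>auto simp: c_def low_def intro!: mult_left_mono power_increasing\<close>)
  then have le: "(\<Sum>s\<in>cube I. (c s)\<^sup>2 * K ^ deg v0 I s) \<le> W * K ^ d"
    by (simp add: W_def sum_distrib_right)
  have h4: "pexp (\<lambda>_. \<mu>) I (\<lambda>x. (h x) ^ 4) \<le> (W * K ^ d)\<^sup>2"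
  proof -
    have "(\<Sum>a\<in>UNIV - {v0}. (\<phi> a x)\<^sup>2) \<le> K\<^sup>2 / 3" for x
      using K by (simp add: Hyp_def mult.commute)
    then have "pexp (\<lambda>_. \<mu>) I (\<lambda>x. (h x) ^ 4) \<le> (\<Sum>s\<in>cube I. (c s)\<^sup>2 * K ^ deg v0 I s)\<^sup>2"
      unfolding h_def
      by (intro hypercontractive_4_2 [where ?a0.0 = v0 and B = "K\<^sup>2 / 3"] I K4) (auto simp: chi_v0 orthd_mu)
    also have "\<dots> \<le> (W * K ^ d)\<^sup>2"
      by (intro power_mono le sum_nonneg mult_nonneg_nonneg) (use K4 in auto)
    finally show ?thesis .
  qed
  have "W\<^sup>2 = (pexp (\<lambda>_. \<mu>) I (\<lambda>x. F x * (F x * h x)))\<^sup>2"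
    by (simp add: Fh [symmetric] mult.assoc [symmetric] FF)
  also have "\<dots> \<le> pexp (\<lambda>_. \<mu>) I (\<lambda>x. (F x)\<^sup>2) * pexp (\<lambda>_. \<mu>) I (\<lambda>x. (F x * h x)\<^sup>2)"
    by (rule pexp_CS [OF mu_nonneg])
  also have "\<dots> = a * pexp (\<lambda>_. \<mu>) I (\<lambda>x. F x * (h x)\<^sup>2)"
    by (simp add: power_mult_distrib FF a_def)
  finally have 1: "W\<^sup>2 \<le> a * pexp (\<lambda>_. \<mu>) I (\<lambda>x. F x * (h x)\<^sup>2)" .
  have "(pexp (\<lambda>_. \<mu>) I (\<lambda>x. F x * (h x)\<^sup>2))\<^sup>2 \<le> pexp (\<lambda>_. \<mu>) I (\<lambda>x. (F x)\<^sup>2) * pexp (\<lambda>_. \<mu>) I (\<lambda>x. ((h x)\<^sup>2)\<^sup>2)"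
    by (rule pexp_CS [OF mu_nonneg])
  also have "\<dots> = a * pexp (\<lambda>_. \<mu>) I (\<lambda>x. (h x) ^ 4)"
    by (simp add: FF a_def power_mult [symmetric])
  also have "\<dots> \<le> a * (W * K ^ d)\<^sup>2"
    by (intro mult_left_mono h4 a0)
  finally have 2: "(pexp (\<lambda>_. \<mu>) I (\<lambda>x. F x * (h x)\<^sup>2))\<^sup>2 \<le> a * (W * K ^ d)\<^sup>2" .
  have "W\<^sup>2 * W\<^sup>2 \<le> (a * pexp (\<lambda>_. \<mu>) I (\<lambda>x. F x * (h x)\<^sup>2)) * (a * pexp (\<lambda>_. \<mu>) I (\<lambda>x. F x * (h x)\<^sup>2))"
    using 1 by (intro mult_mono) (auto intro: order_trans [OF zero_le_power2])
  also have "\<dots> = a\<^sup>2 * (pexp (\<lambda>_. \<mu>) I (\<lambda>x. F x * (h x)\<^sup>2))\<^sup>2"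
    by (simp add: power2_eq_square mult_ac)
  also have "\<dots> \<le> a\<^sup>2 * (a * (W * K ^ d)\<^sup>2)"
    by (intro mult_left_mono 2) auto
  also have "\<dots> \<le> a\<^sup>2 * (\<theta>\<^sup>2 * (W * K ^ d)\<^sup>2)"
    using small(1) by (intro mult_left_mono mult_right_mono) (auto simp: a_def)
  finally have "W\<^sup>2 * W\<^sup>2 \<le> W\<^sup>2 * (\<theta> * K ^ d * a)\<^sup>2"
    by (simp add: power_mult_distrib mult_ac)
  then have "W\<^sup>2 \<le> (\<theta> * K ^ d * a)\<^sup>2 \<or> W = 0"
    by (cases "W = 0") (blast dest: mult_left_le_imp_le [of "W\<^sup>2"] intro: zero_less_power2 [THEN iffD2])+
  moreover have nn: "0 \<le> \<theta> * K ^ d * a" using small(2) K4 a0 by simp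
  ultimately have "W \<le> \<theta> * K ^ d * a"
    using power2_le_imp_le by auto
  then show ?thesis by (simp add: W_def c_def a_def)
qed

text \<open>Degrees up to \<open>d\<close> carry little of the weight of a small set, and higher
  ones are shrunk by \<open>\<kappa> ^ d\<close>.\<close>

lemma small_set_expansion:
  assumes I: "finite I" and K: "Hyp K" and F: "\<And>x. F x = 0 \<or> F x = 1" and G: "\<And>x. G x = 0 \<or> G x = 1"
    and small: "pexp (\<lambda>_. \<mu>) I F \<le> \<theta>\<^sup>2" "pexp (\<lambda>_. \<mu>) I G \<le> \<theta>\<^sup>2" "0 \<le> \<theta>"
  shows "dexp \<nu> I (\<lambda>x y. F x * G y) \<le> (\<theta> * K ^ d + \<kappa> ^ d) * (pexp (\<lambda>_. \<mu>) I F + pexp (\<lambda>_. \<mu>) I G)"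
proof -
  have one: "(\<Sum>s\<in>cube I. \<kappa> ^ deg v0 I s * (fc I F s)\<^sup>2) \<le> (\<theta> * K ^ d + \<kappa> ^ d) * pexp (\<lambda>_. \<mu>) I F"
    if F: "\<And>x. F x = 0 \<or> F x = 1" and small: "pexp (\<lambda>_. \<mu>) I F \<le> \<theta>\<^sup>2" for F
  proof -
    have "(\<Sum>s\<in>cube I. \<kappa> ^ deg v0 I s * (fc I F s)\<^sup>2) \<le> (\<Sum>s\<in>cube I. (low I d (fc I F) s)\<^sup>2 + \<kappa> ^ d * (fc I F s)\<^sup>2)"
    proof (rule sum_mono)
      fix s :: "nat \<Rightarrow> 'v"
      show "\<kappa> ^ deg v0 I s * (fc I F s)\<^sup>2 \<le> (low I d (fc I F) s)\<^sup>2 + \<kappa> ^ d * (fc I F s)\<^sup>2"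
      proof (cases "deg v0 I s \<le> d")
        case True
        have "\<kappa> ^ deg v0 I s * (fc I F s)\<^sup>2 \<le> 1 * (fc I F s)\<^sup>2"
          using lam_range by (intro mult_right_mono power_le_one) auto
        moreover have "0 \<le> \<kappa> ^ d * (fc I F s)\<^sup>2" using lam_range by simp
        ultimately show ?thesis using True by (simp add: low_def)
      next
        case False
        then show ?thesis
          using lam_range by (auto simp: low_def intro!: mult_right_mono power_decreasing)
      qed
    qed
    also have "\<dots> = (\<Sum>s\<in>cube I. (low I d (fc I F) s)\<^sup>2) + \<kappa> ^ d * (\<Sum>s\<in>cube I. (fc I F s)\<^sup>2)"
      by (simp add: sum.distrib sum_distrib_left)
    also have "(\<Sum>s\<in>cube I. (fc I F s)\<^sup>2) = pexp (\<lambda>_. \<mu>) I (\<lambda>x. F x * F x)"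
      by (simp add: parseval [OF I] power2_eq_square)
    also have "(\<lambda>x. F x * F x) = F"
    proof
      show "F x * F x = F x" for x using F [of x] by auto
    qed
    also have "(\<Sum>s\<in>cube I. (low I d (fc I F) s)\<^sup>2) \<le> \<theta> * K ^ d * pexp (\<lambda>_. \<mu>) I F"
      by (rule low_weight_small_set [OF I K F small \<open>0 \<le> \<theta>\<close>])
    finally show ?thesis by (simp add: algebra_simps)
  qed
  have "dexp \<nu> I (\<lambda>x y. F x * G y) \<le> (\<Sum>s\<in>cube I. \<kappa> ^ deg v0 I s * (fc I F s)\<^sup>2 + \<kappa> ^ deg v0 I s * (fc I G s)\<^sup>2)"
    unfolding parseval_nu [OF I]
  proof (rule sum_mono)
    fix s :: "nat \<Rightarrow> 'v"
    have "(\<Prod>i\<in>I. lam (s i)) * (fc I F s * fc I G s) \<le> \<bar>\<Prod>i\<in>I. lam (s i)\<bar> * \<bar>fc I F s * fc I G s\<bar>"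
      by (metis abs_ge_self abs_mult)
    also have "\<dots> \<le> \<kappa> ^ deg v0 I s * ((fc I F s)\<^sup>2 + (fc I G s)\<^sup>2)"
    proof (intro mult_mono abs_lam_prod_le I)
      have "2 * \<bar>fc I F s * fc I G s\<bar> \<le> (fc I F s)\<^sup>2 + (fc I G s)\<^sup>2"
        using zero_le_power2 [of "\<bar>fc I F s\<bar> - \<bar>fc I G s\<bar>"] by (simp add: power2_eq_square algebra_simps abs_mult)
      then show "\<bar>fc I F s * fc I G s\<bar> \<le> (fc I F s)\<^sup>2 + (fc I G s)\<^sup>2" by linarith
    qed (use lam_range in auto)
    finally show "(\<Prod>i\<in>I. lam (s i)) * (fc I F s * fc I G s) \<le> \<kappa> ^ deg v0 I s * (fc I F s)\<^sup>2 + \<kappa> ^ deg v0 I s * (fc I G s)\<^sup>2"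
      by (simp add: algebra_simps)
  qed
  also have "\<dots> \<le> (\<theta> * K ^ d + \<kappa> ^ d) * pexp (\<lambda>_. \<mu>) I F + (\<theta> * K ^ d + \<kappa> ^ d) * pexp (\<lambda>_. \<mu>) I G"
    unfolding sum.distrib by (intro add_mono one F G small)
  finally show ?thesis by (simp add: algebra_simps)
qed

text \<open>Adding \<open>i\<close> to \<open>J\<close> raises the potential by at least \<open>2\<^sup>-\<^sup>d\<close> times the weight of the
  low-degree sets through \<open>i\<close>, so a maximizer of the potential minus a linear cost works.\<close>

lemma exhaust_influential:
  fixes w :: "(nat \<Rightarrow> 'v) \<Rightarrow> real"
  assumes I: "finite I" and w: "\<And>s. 0 \<le> w s" "(\<Sum>s\<in>cube I. w s) \<le> 2" and k: "0 < k"
  shows "\<exists>J\<subseteq>I. real (card J) * k \<le> 2 \<and>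
    (\<forall>i\<in>I - J. (\<Sum>s\<in>cube I. if s i \<noteq> v0 \<and> deg v0 (I - J) s \<le> d then w s else 0) \<le> k * 2 ^ d)"
proof -
  define \<Phi> where "\<Phi> J = (\<Sum>s\<in>cube I. w s * (1 / 2) ^ deg v0 (I - J) s)" for J
  define \<Psi> where "\<Psi> J = \<Phi> J - k * real (card J)" for J
  have "finite (\<Psi> ` Pow I)" "\<Psi> ` Pow I \<noteq> {}" using I by auto
  then obtain J where J: "J \<subseteq> I" "\<Psi> J = Max (\<Psi> ` Pow I)"
    using imageE [OF Max_in [of "\<Psi> ` Pow I"]] by (metis Pow_iff)
  have Jmax: "\<Psi> L \<le> \<Psi> J" if "L \<subseteq> I" for L
    unfolding J(2) using that I by (intro Max_ge) auto
  have finJ: "finite J" using J I finite_subset by blast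
  \<comment> \<open>The potential lies between 0 and 2, so comparing the maximizer with the empty
    set bounds its size.\<close>
  have "0 \<le> \<Phi> {}" unfolding \<Phi>_def by (intro sum_nonneg mult_nonneg_nonneg w) auto
  moreover have "\<Phi> J \<le> (\<Sum>s\<in>cube I. w s * 1)"
    unfolding \<Phi>_def by (intro sum_mono mult_left_mono w power_le_one) auto
  ultimately have "real (card J) * k \<le> 2"
    using Jmax [of "{}"] w(2) by (simp add: \<Psi>_def mult.commute)
  moreover have "(\<Sum>s\<in>cube I. if s i \<noteq> v0 \<and> deg v0 (I - J) s \<le> d then w s else 0) \<le> k * 2 ^ d" if i: "i \<in> I - J" for i
  proof -
    have "(\<Sum>s\<in>cube I. (if s i \<noteq> v0 \<and> deg v0 (I - J) s \<le> d then w s else 0) * (1 / 2) ^ d) \<le>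
      (\<Sum>s\<in>cube I. w s * (1 / 2) ^ deg v0 (I - insert i J) s - w s * (1 / 2) ^ deg v0 (I - J) s)"
    proof (rule sum_mono)
      fix s :: "nat \<Rightarrow> 'v"
      have "{j \<in> I - J. s j \<noteq> v0} = (if s i = v0 then {} else {i}) \<union> {j \<in> I - insert i J. s j \<noteq> v0}"
        using i by auto
      then have dg: "deg v0 (I - J) s = (if s i = v0 then 0 else 1) + deg v0 (I - insert i J) s"
        using I by (simp add: deg_def)
      show "(if s i \<noteq> v0 \<and> deg v0 (I - J) s \<le> d then w s else 0) * (1 / 2) ^ d \<le>
          w s * (1 / 2) ^ deg v0 (I - insert i J) s - w s * (1 / 2) ^ deg v0 (I - J) s"
      proof (cases "s i = v0")
        case False
        then have "w s * (1 / 2) ^ deg v0 (I - insert i J) s - w s * (1 / 2) ^ deg v0 (I - J) s = w s * (1 / 2) ^ deg v0 (I - J) s"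
          by (simp add: dg)
        moreover have "w s * (1 / 2) ^ d \<le> w s * (1 / 2) ^ deg v0 (I - J) s" if "deg v0 (I - J) s \<le> d"
          using that by (intro mult_left_mono w power_decreasing) auto
        moreover have "0 \<le> w s * (1 / 2) ^ deg v0 (I - J) s" using w by simp
        ultimately show ?thesis by auto
      qed (simp add: dg)
    qed
    also have "\<dots> = \<Phi> (insert i J) - \<Phi> J"
      by (simp add: \<Phi>_def sum_subtractf)
    also have "\<dots> \<le> k"
      using Jmax [of "insert i J"] i J finJ by (simp add: \<Psi>_def algebra_simps)
    finally have "(\<Sum>s\<in>cube I. if s i \<noteq> v0 \<and> deg v0 (I - J) s \<le> d then w s else 0) * (1 / 2) ^ d \<le> k"
      by (simp only: sum_distrib_right)
    then show ?thesis by (simp add: field_simps)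
  qed
  ultimately show ?thesis using J(1) by blast
qed

section \<open>Fibres over a set of fixed coordinates\<close>

definition fibre :: "nat set \<Rightarrow> nat set \<Rightarrow> ((nat \<Rightarrow> 'v) \<Rightarrow> real) \<Rightarrow> (nat \<Rightarrow> 'v) \<Rightarrow> (nat \<Rightarrow> 'v) \<Rightarrow> real" where
  "fibre I J f x y = f (merge J (I - J) (x, y))"

definition avg :: "nat set \<Rightarrow> nat set \<Rightarrow> ((nat \<Rightarrow> 'v) \<Rightarrow> real) \<Rightarrow> (nat \<Rightarrow> 'v) \<Rightarrow> real" where
  "avg I J f x = pexp (\<lambda>_. \<mu>) (I - J) (fibre I J f x)"

lemma split_set: "J \<subseteq> I \<Longrightarrow> J \<union> (I - J) = I" by blast

lemma pexp_split:
  assumes "finite I" "J \<subseteq> I"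
  shows "pexp (\<lambda>_. \<mu>) I f = pexp (\<lambda>_. \<mu>) J (\<lambda>x. pexp (\<lambda>_. \<mu>) (I - J) (fibre I J f x))"
  using pexp_union [of J "I - J" "\<lambda>_. \<mu>" f, unfolded split_set [OF assms(2)]] assms finite_subset [OF assms(2,1)]
  by (simp add: fibre_def)

lemma dexp_split:
  assumes "finite I" "J \<subseteq> I"
  shows "dexp \<nu> I F = dexp \<nu> J (\<lambda>x x'. dexp \<nu> (I - J) (\<lambda>y y'. F (merge J (I - J) (x, y)) (merge J (I - J) (x', y'))))"
  using dexp_union [of J "I - J" \<nu> F, unfolded split_set [OF assms(2)]] assms finite_subset [OF assms(2,1)]
  by simp

lemma merge_cube:
  assumes "J \<subseteq> I"
  shows "merge J (I - J) (x, y) \<in> cube I"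
  using merge_in_cube [of J "I - J" x y, unfolded split_set [OF assms]] .

lemma fibre_01:
  assumes "J \<subseteq> I" "\<And>x. x \<in> cube I \<Longrightarrow> 0 \<le> f x \<and> f x \<le> 1"
  shows "0 \<le> fibre I J f x y \<and> fibre I J f x y \<le> 1"
  unfolding fibre_def by (rule assms(2)) (rule merge_cube [OF assms(1)])

lemma fc_fc_fibre:
  assumes I: "finite I" "J \<subseteq> I"
  shows "fc J (\<lambda>x. fc (I - J) (fibre I J f x) t) u = fc I f (merge J (I - J) (u, t))"
proof -
  have fin: "finite J" "finite (I - J)" "J \<inter> (I - J) = {}" using I finite_subset by auto
  have chi: "chi \<phi> I (merge J (I - J) (u, t)) (merge J (I - J) (x, y)) = chi \<phi> J u x * chi \<phi> (I - J) t y" for x y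
    using prod_union_merge2 [OF fin, of \<phi> u t x y] unfolding chi_def split_set [OF I(2)] .
  have "fc I f (merge J (I - J) (u, t)) = pexp (\<lambda>_. \<mu>) J (\<lambda>x. pexp (\<lambda>_. \<mu>) (I - J) (\<lambda>y. chi \<phi> J u x * (fibre I J f x y * chi \<phi> (I - J) t y)))"
    unfolding fc_def [of I] pexp_split [OF I] fibre_def chi by (simp add: mult_ac)
  then show ?thesis
    unfolding fc_def pexp_cmult by (simp add: mult_ac)
qed

text \<open>Parseval in the fixed coordinates turns averaged squares of coefficients of the fibres
  into squared coefficients of \<open>f\<close>. Only the degree outside \<open>J\<close> is
  restricted, which is why \<open>exhaust_influential\<close> counts degrees on
  \<open>I - J\<close>.\<close>

lemma pexp_linf_fibre:
  assumes I: "finite I" "J \<subseteq> I" and i: "i \<in> I - J"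
  shows "pexp (\<lambda>_. \<mu>) J (\<lambda>x. linf (I - J) d (fibre I J f x) i) =
    (\<Sum>s\<in>cube I. if s i \<noteq> v0 \<and> deg v0 (I - J) s \<le> d then (fc I f s)\<^sup>2 else 0)"
proof -
  have fin: "finite J" "finite (I - J)" "J \<inter> (I - J) = {}" using I finite_subset by auto
  have sq: "pexp (\<lambda>_. \<mu>) J (\<lambda>x. (fc (I - J) (fibre I J f x) t)\<^sup>2) = (\<Sum>u\<in>cube J. (fc I f (merge J (I - J) (u, t)))\<^sup>2)" for t
    unfolding power2_eq_square parseval [OF fin(1)] fc_fc_fibre [OF I] ..
  have "pexp (\<lambda>_. \<mu>) J (\<lambda>x. linf (I - J) d (fibre I J f x) i) =
     (\<Sum>t\<in>cube (I - J). pexp (\<lambda>_. \<mu>) J (\<lambda>x. if t i \<noteq> v0 \<and> deg v0 (I - J) t \<le> d then (fc (I - J) (fibre I J f x) t)\<^sup>2 else 0))"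
    unfolding linf_def infl_def pexp_sum by (intro sum.cong refl pexp_cong) (auto simp: low_def)
  also have "\<dots> = (\<Sum>t\<in>cube (I - J). \<Sum>u\<in>cube J. if t i \<noteq> v0 \<and> deg v0 (I - J) t \<le> d then (fc I f (merge J (I - J) (u, t)))\<^sup>2 else 0)"
  proof (intro sum.cong refl)
    fix t :: "nat \<Rightarrow> 'v"
    have "pexp (\<lambda>_. \<mu>) J (\<lambda>x. if b then (fc (I - J) (fibre I J f x) t)\<^sup>2 else 0) =
      (\<Sum>u\<in>cube J. if b then (fc I f (merge J (I - J) (u, t)))\<^sup>2 else 0)" for b
      by (cases b) (simp_all add: sq)
    then show "pexp (\<lambda>_. \<mu>) J (\<lambda>x. if t i \<noteq> v0 \<and> deg v0 (I - J) t \<le> d then (fc (I - J) (fibre I J f x) t)\<^sup>2 else 0) =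
      (\<Sum>u\<in>cube J. if t i \<noteq> v0 \<and> deg v0 (I - J) t \<le> d then (fc I f (merge J (I - J) (u, t)))\<^sup>2 else 0)" .
  qed
  also have "\<dots> = (\<Sum>u\<in>cube J. \<Sum>t\<in>cube (I - J). if t i \<noteq> v0 \<and> deg v0 (I - J) t \<le> d then (fc I f (merge J (I - J) (u, t)))\<^sup>2 else 0)"
    by (rule sum.swap)
  also have "\<dots> = (\<Sum>u\<in>cube J. \<Sum>t\<in>cube (I - J). if merge J (I - J) (u, t) i \<noteq> v0 \<and> deg v0 (I - J) (merge J (I - J) (u, t)) \<le> d
      then (fc I f (merge J (I - J) (u, t)))\<^sup>2 else 0)"
  proof (intro sum.cong refl)
    fix u t :: "nat \<Rightarrow> 'v"
    have "deg v0 (I - J) (merge J (I - J) (u, t)) = deg v0 (I - J) t"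
      unfolding deg_def by (intro arg_cong [where f = card]) auto
    then show "(if t i \<noteq> v0 \<and> deg v0 (I - J) t \<le> d then (fc I f (merge J (I - J) (u, t)))\<^sup>2 else 0) =
      (if merge J (I - J) (u, t) i \<noteq> v0 \<and> deg v0 (I - J) (merge J (I - J) (u, t)) \<le> d
      then (fc I f (merge J (I - J) (u, t)))\<^sup>2 else 0)"
      using i by simp
  qed
  also have "\<dots> = (\<Sum>s\<in>cube (J \<union> (I - J)). if s i \<noteq> v0 \<and> deg v0 (I - J) s \<le> d then (fc I f s)\<^sup>2 else 0)"
    by (rule sum_cube_union [symmetric]) auto
  finally show ?thesis by (simp only: split_set [OF I(2)])
qed

text \<open>An edge joining two heavy fibres either carries correlation, which is scarce, or its
  ends share an influential coordinate \<open>i\<close>. For each \<open>i\<close> the restrictions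
  influenced by \<open>i\<close> form a small set. Summed over \<open>i\<close> the measures of
  these sets are bounded but not small; small-set expansion supplies the small factor
  \<open>\<gamma>\<close>.\<close>

theorem junta_approximation:
  "\<exists>C. \<forall>m\<ge>1. \<forall>I f g. finite I \<longrightarrow> (\<forall>x\<in>cube I. 0 \<le> f x \<and> f x \<le> 1 \<and> 0 \<le> g x \<and> g x \<le> 1) \<longrightarrow>
     dexp \<nu> I (\<lambda>x y. f x * g y) \<le> (1 / 2) ^ (C * m) \<longrightarrow>
     (\<exists>J\<subseteq>I. card J \<le> 2 ^ (C * m) \<and>
        dexp \<nu> J (\<lambda>x y. of_bool ((1 / 2) ^ m \<le> avg I J f x \<and> (1 / 2) ^ m \<le> avg I J g y)) \<le> (1 / 2) ^ m)"
proof -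
  obtain C0 D0 where cor: "\<forall>m\<ge>1. \<forall>I f g. finite I \<longrightarrow> (\<forall>x\<in>cube I. 0 \<le> f x \<and> f x \<le> 1 \<and> 0 \<le> g x \<and> g x \<le> 1) \<longrightarrow>
     (1 / 2) ^ m \<le> pexp (\<lambda>_. \<mu>) I f \<longrightarrow> (1 / 2) ^ m \<le> pexp (\<lambda>_. \<mu>) I g \<longrightarrow>
     (\<forall>i\<in>I. linf I (D0 * m) f i \<le> (1 / 2) ^ (C0 * m) \<or> linf I (D0 * m) g i \<le> (1 / 2) ^ (C0 * m)) \<longrightarrow>
     (1 / 2) ^ (C0 * m) \<le> dexp \<nu> I (\<lambda>x y. f x * g y)"
    using correlation_or_influence by (elim exE) (rule that)
  obtain k :: nat where K: "Hyp (2 ^ k)" using ex_Hyp by blast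
  \<comment> \<open>\<open>D * m\<close> is the degree cut-off for small-set expansion, distinct
    from the cut-off \<open>D0 * m\<close> for influences.\<close>
  obtain D where D: "\<kappa> ^ D < (1 / 2) ^ (C0 + D0 + 4)"
    using real_arch_pow_inv [of "(1 / 2) ^ (C0 + D0 + 4)" \<kappa>] lam_range by auto
  \<comment> \<open>\<open>x ^ n\<close> serves as \<open>\<theta>\<close> and must beat
    \<open>K ^ (D * m)\<close>. Markov's inequality at level \<open>x ^ C0\<close> turns the weight
    bound \<open>x ^ e * 2 ^ (D0 * m)\<close> into the density \<open>(x ^ n)\<^sup>2\<close>, which
    dictates \<open>e\<close>.\<close>
  define n where "n = k * D + C0 + D0 + 4"
  define e where "e = 2 * n + C0 + D0"
  define C where "C = e + C0 + 2"
  have "\<exists>J\<subseteq>I. card J \<le> 2 ^ (C * m) \<and>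
        dexp \<nu> J (\<lambda>x y. of_bool ((1 / 2) ^ m \<le> avg I J f x \<and> (1 / 2) ^ m \<le> avg I J g y)) \<le> (1 / 2) ^ m"
    if m: "1 \<le> m" and I: "finite I" and fg: "\<forall>x\<in>cube I. 0 \<le> f x \<and> f x \<le> 1 \<and> 0 \<le> g x \<and> g x \<le> 1"
      and small: "dexp \<nu> I (\<lambda>x y. f x * g y) \<le> (1 / 2) ^ (C * m)" for m I f g
  proof -
    have f: "\<And>x. x \<in> cube I \<Longrightarrow> 0 \<le> f x \<and> f x \<le> 1" and g: "\<And>x. x \<in> cube I \<Longrightarrow> 0 \<le> g x \<and> g x \<le> 1"
      using fg by auto
    define x :: real where "x = (1 / 2) ^ m"
    have x: "0 < x" "x \<le> 1 / 2" "x \<le> 1"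
      using m power_decreasing [of 1 m "1 / 2 :: real"] by (auto simp: x_def power_le_one)
    have xp: "(1 / 2) ^ (n * m) = x ^ n" for n
      by (simp add: x_def power_mult [symmetric] mult.commute)
    note half = half_power_mult_le [OF less_imp_le [OF x(1)] x(2)]
    have xdec: "n \<le> n' \<Longrightarrow> x ^ n' \<le> x ^ n" for n n'
      using x by (intro power_decreasing) auto
    define d where "d = D0 * m"
    have dx: "real d * x ^ D0 \<le> 1"
    proof -
      have "real d \<le> 2 ^ d" by (rule less_imp_le [OF of_nat_less_two_power])
      then have "real d * x ^ D0 \<le> 2 ^ d * x ^ D0" using x by (intro mult_right_mono) auto
      also have "\<dots> = 1" by (simp add: d_def x_def power_mult [symmetric] mult.commute power_one_over)
      finally show ?thesis .
    qed
    have "(\<Sum>s\<in>cube I. (fc I f s)\<^sup>2 + (fc I g s)\<^sup>2) \<le> 2"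
      using sum_fc_le_1 [where f = f, OF I f] sum_fc_le_1 [where f = g, OF I g] by (simp add: sum.distrib)
    then obtain J where J: "J \<subseteq> I" "real (card J) * x ^ e \<le> 2"
      "\<And>i. i \<in> I - J \<Longrightarrow> (\<Sum>s\<in>cube I. if s i \<noteq> v0 \<and> deg v0 (I - J) s \<le> d then (fc I f s)\<^sup>2 + (fc I g s)\<^sup>2 else 0) \<le> x ^ e * 2 ^ d"
      using exhaust_influential [OF I, of "\<lambda>s. (fc I f s)\<^sup>2 + (fc I g s)\<^sup>2" "x ^ e" d] x by auto
    have fin: "finite J" "finite (I - J)" using I J finite_subset by auto
    have xinv: "x ^ n * 2 ^ (n * m) = 1" for n
      by (simp add: x_def power_mult [symmetric] mult.commute power_one_over)
    have "real (card J) \<le> 2 ^ (C * m)"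
    proof -
      have "real (card J) = (real (card J) * x ^ e) * 2 ^ (e * m)"
        using xinv [of e] by (simp add: mult.assoc)
      also have "\<dots> \<le> 2 * 2 ^ (e * m)"
        using J(2) by (intro mult_right_mono) auto
      also have "\<dots> = 2 ^ (1 + e * m)" by simp
      also have "\<dots> \<le> 2 ^ (C * m)"
        using m by (intro power_increasing) (auto simp: C_def algebra_simps)
      finally show ?thesis .
    qed
    then have card: "card J \<le> 2 ^ (C * m)"
      by (metis of_nat_le_iff of_nat_numeral of_nat_power)
    define S where "S h i z = (of_bool (x ^ C0 < linf (I - J) d (fibre I J h z) i) :: real)" for h i z
    have S01: "S h i z = 0 \<or> S h i z = 1" for h i z by (auto simp: S_def)
    have Slinf: "x ^ C0 * S h i z \<le> linf (I - J) d (fibre I J h z) i" for h i z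
      by (auto simp: S_def linf_nonneg)
    have W: "pexp (\<lambda>_. \<mu>) J (\<lambda>z. linf (I - J) d (fibre I J h z) i) \<le> x ^ e * 2 ^ d" if "i \<in> I - J" "h = f \<or> h = g" for h i
    proof -
      have "(\<Sum>s\<in>cube I. if s i \<noteq> v0 \<and> deg v0 (I - J) s \<le> d then (fc I h s)\<^sup>2 else 0) \<le>
          (\<Sum>s\<in>cube I. if s i \<noteq> v0 \<and> deg v0 (I - J) s \<le> d then (fc I f s)\<^sup>2 + (fc I g s)\<^sup>2 else 0)"
        using that(2) by (intro sum_mono) auto
      then show ?thesis
        using J(3) [OF that(1)] by (simp add: pexp_linf_fibre [OF I J(1) that(1)])
    qed
    have ES: "pexp (\<lambda>_. \<mu>) J (S h i) \<le> (x ^ n)\<^sup>2" if "i \<in> I - J" "h = f \<or> h = g" for h i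
    proof -
      have "x ^ C0 * pexp (\<lambda>_. \<mu>) J (S h i) = pexp (\<lambda>_. \<mu>) J (\<lambda>z. x ^ C0 * S h i z)"
        by (rule pexp_cmult [symmetric])
      also have "\<dots> \<le> pexp (\<lambda>_. \<mu>) J (\<lambda>z. linf (I - J) d (fibre I J h z) i)"
        by (rule pexp_mono [OF mu_nonneg Slinf])
      also have "\<dots> \<le> x ^ e * 2 ^ d" by (rule W [OF that])
      also have "\<dots> = x ^ C0 * ((x ^ n)\<^sup>2 * (x ^ D0 * 2 ^ (D0 * m)))"
        by (simp add: e_def d_def power_add power_mult [symmetric] mult_ac)
      also have "\<dots> = x ^ C0 * (x ^ n)\<^sup>2" by (simp only: xinv mult_1_right)
      finally show ?thesis using x by simp
    qed
    have sumS: "(\<Sum>i\<in>I - J. pexp (\<lambda>_. \<mu>) J (S h i)) * x ^ C0 \<le> real d" if "h = f \<or> h = g" for h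
    proof -
      have h01: "\<And>x. x \<in> cube I \<Longrightarrow> 0 \<le> h x \<and> h x \<le> 1" using that f g by auto
      have "(\<Sum>i\<in>I - J. pexp (\<lambda>_. \<mu>) J (S h i)) * x ^ C0 = pexp (\<lambda>_. \<mu>) J (\<lambda>z. \<Sum>i\<in>I - J. x ^ C0 * S h i z)"
        unfolding pexp_sum pexp_cmult by (simp add: sum_distrib_left mult.commute)
      also have "\<dots> \<le> pexp (\<lambda>_. \<mu>) J (\<lambda>z. real d)"
      proof (rule pexp_mono [OF mu_nonneg])
        fix z
        have "(\<Sum>i\<in>I - J. x ^ C0 * S h i z) \<le> (\<Sum>i\<in>I - J. linf (I - J) d (fibre I J h z) i)"
          by (rule sum_mono [OF Slinf])
        also have "\<dots> \<le> real d"
          by (rule sum_linf_le [OF fin(2) fibre_01 [where f = h, OF J(1) h01]])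
        finally show "(\<Sum>i\<in>I - J. x ^ C0 * S h i z) \<le> real d" .
      qed
      finally show ?thesis by (simp add: pexp_mu_const [OF fin(1)])
    qed
    let ?P = "\<lambda>z w. of_bool (x \<le> avg I J f z \<and> x \<le> avg I J g w) :: real"
    let ?E = "\<lambda>z w. dexp \<nu> (I - J) (\<lambda>y y'. fibre I J f z y * fibre I J g w y')"
    \<comment> \<open>The scaling by \<open>x ^ C0\<close> is the correlation guaranteed when two
      heavy fibres share no influential coordinate.\<close>
    have pt: "x ^ C0 * ?P z w \<le> ?E z w + (\<Sum>i\<in>I - J. x ^ C0 * (S f i z * S g i w))" for z w
    proof -
      have fz: "0 \<le> fibre I J f z y \<and> fibre I J f z y \<le> 1 \<and> 0 \<le> fibre I J g w y \<and> fibre I J g w y \<le> 1" for y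
        using fibre_01 [where f = f and x = z and y = y, OF J(1) f] fibre_01 [where f = g and x = w and y = y, OF J(1) g] by simp
      have E0: "0 \<le> ?E z w"
        by (rule dexp_nonneg [OF nu_nonneg]) (simp add: fz)
      have S0: "0 \<le> (\<Sum>i\<in>I - J. x ^ C0 * (S f i z * S g i w))"
        using x by (intro sum_nonneg) (simp add: S_def)
      show ?thesis
      proof (cases "x \<le> avg I J f z \<and> x \<le> avg I J g w")
        case True
        show ?thesis
        proof (cases "\<exists>i\<in>I - J. x ^ C0 < linf (I - J) d (fibre I J f z) i \<and> x ^ C0 < linf (I - J) d (fibre I J g w) i")
          case True
          then obtain i where i: "i \<in> I - J" "S f i z * S g i w = 1" by (auto simp: S_def)
          have "x ^ C0 * (S f i z * S g i w) \<le> (\<Sum>i\<in>I - J. x ^ C0 * (S f i z * S g i w))"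
            using i fin x by (intro member_le_sum [of i "I - J" "\<lambda>i. x ^ C0 * (S f i z * S g i w)"]) (auto simp: S_def)
          moreover have "x ^ C0 * ?P z w \<le> x ^ C0 * 1" using x by (intro mult_left_mono) auto
          ultimately show ?thesis using i E0 by simp
        next
          case False
          have "(1 / 2) ^ (C0 * m) \<le> ?E z w"
          proof (rule cor [THEN spec, THEN mp, OF m, THEN spec, THEN spec, THEN spec, THEN mp, OF fin(2), THEN mp, THEN mp, THEN mp, THEN mp])
            show "\<forall>y\<in>cube (I - J). 0 \<le> fibre I J f z y \<and> fibre I J f z y \<le> 1 \<and> 0 \<le> fibre I J g w y \<and> fibre I J g w y \<le> 1"
              using fz by blast
            show "(1 / 2) ^ m \<le> pexp (\<lambda>_. \<mu>) (I - J) (fibre I J f z)" "(1 / 2) ^ m \<le> pexp (\<lambda>_. \<mu>) (I - J) (fibre I J g w)"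
              using True by (auto simp: avg_def x_def)
            show "\<forall>i\<in>I - J. linf (I - J) (D0 * m) (fibre I J f z) i \<le> (1 / 2) ^ (C0 * m) \<or> linf (I - J) (D0 * m) (fibre I J g w) i \<le> (1 / 2) ^ (C0 * m)"
              using False unfolding xp d_def by (auto simp: not_less)
          qed
          then have "x ^ C0 * ?P z w \<le> ?E z w"
            using True by (simp add: xp)
          then show ?thesis using S0 by linarith
        qed
      qed (use E0 S0 in auto)
    qed
    define \<gamma> where "\<gamma> = x ^ n * (2 ^ k) ^ (D * m) + \<kappa> ^ (D * m)"
    have g0: "0 \<le> \<gamma>" using x lam_range by (simp add: \<gamma>_def)
    have g1: "\<gamma> \<le> 2 * x ^ (C0 + D0 + 4)"
    proof -
      have "x ^ n * (2 ^ k) ^ (D * m) = x ^ (C0 + D0 + 4) * (x ^ (k * D) * 2 ^ (k * D * m))"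
        by (simp add: n_def power_add power_mult [symmetric] mult_ac)
      also have "\<dots> = x ^ (C0 + D0 + 4)" by (simp only: xinv mult_1_right)
      finally have "x ^ n * (2 ^ k) ^ (D * m) = x ^ (C0 + D0 + 4)" .
      moreover have "\<kappa> ^ (D * m) \<le> ((1 / 2) ^ (C0 + D0 + 4)) ^ m"
        unfolding power_mult using D lam_range by (intro power_mono) auto
      ultimately show ?thesis
        by (simp add: \<gamma>_def x_def power_mult [symmetric] mult.commute)
    qed
    have "x ^ C0 * dexp \<nu> J ?P \<le> dexp \<nu> J (\<lambda>z w. ?E z w + (\<Sum>i\<in>I - J. x ^ C0 * (S f i z * S g i w)))"
      unfolding dexp_cmult [symmetric] by (rule dexp_mono [OF nu_nonneg pt])
    also have "\<dots> = dexp \<nu> I (\<lambda>x y. f x * g y) + x ^ C0 * (\<Sum>i\<in>I - J. dexp \<nu> J (\<lambda>z w. S f i z * S g i w))"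
      unfolding dexp_add dexp_sum dexp_cmult dexp_split [OF I J(1)] fibre_def by (simp add: sum_distrib_left)
    also have "\<dots> \<le> x ^ C + x ^ C0 * (\<Sum>i\<in>I - J. \<gamma> * (pexp (\<lambda>_. \<mu>) J (S f i) + pexp (\<lambda>_. \<mu>) J (S g i)))"
    proof (intro add_mono mult_left_mono sum_mono)
      show "dexp \<nu> I (\<lambda>x y. f x * g y) \<le> x ^ C" using small by (simp add: xp)
      show "dexp \<nu> J (\<lambda>z w. S f i z * S g i w) \<le> \<gamma> * (pexp (\<lambda>_. \<mu>) J (S f i) + pexp (\<lambda>_. \<mu>) J (S g i))"
        if "i \<in> I - J" for i
        unfolding \<gamma>_def by (rule small_set_expansion [OF fin(1) K S01 S01 ES ES]) (use that x in auto)
    qed (use x in auto)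
    also have "\<dots> = x ^ C + \<gamma> * ((\<Sum>i\<in>I - J. pexp (\<lambda>_. \<mu>) J (S f i)) * x ^ C0 + (\<Sum>i\<in>I - J. pexp (\<lambda>_. \<mu>) J (S g i)) * x ^ C0)"
      by (simp add: sum_distrib_left [symmetric] sum.distrib algebra_simps)
    also have "\<dots> \<le> x ^ C + (2 * x ^ (C0 + D0 + 4)) * (real d + real d)"
      using sumS [of f] sumS [of g] g0 g1 x
      by (intro add_left_mono mult_mono add_mono) (auto intro!: add_nonneg_nonneg mult_nonneg_nonneg sum_nonneg pexp_nonneg mu_nonneg simp: S_def)
    also have "\<dots> = x ^ C + x ^ C0 * (4 * x ^ 2 * x ^ 2 * (real d * x ^ D0))"
      by (simp add: power_add power2_eq_square power4_eq_xxxx mult_ac)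
    also have "\<dots> \<le> x ^ (C0 + 2) + x ^ C0 * (1 * x ^ 2 * 1)"
      using x by (intro add_mono xdec mult_left_mono mult_mono half dx) (auto simp: C_def)
    also have "\<dots> = x ^ C0 * (2 * x * x)"
      by (simp add: power_add power2_eq_square)
    also have "\<dots> \<le> x ^ C0 * (1 * x)"
      using x by (intro mult_left_mono mult_right_mono half) auto
    finally show ?thesis
      using x card J(1) by (auto simp: x_def)
  qed
  then show ?thesis by blast
qed

end

section \<open>Removing the remaining edges\<close>

text \<open>The edges are treated one by one, each taking as much weight as its two ends still
  allow; one end then becomes saturated and stays so. Hence the saturated vertices meet every
  edge.\<close>

lemma greedy_fractional_matching:
  fixes m :: "'a \<Rightarrow> real"
  assumes X: "finite X" and m: "\<And>x. x \<in> X \<Longrightarrow> 0 \<le> m x" and E: "finite E" "E \<subseteq> X \<times> X"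
  shows "\<exists>M. (\<forall>x y. 0 \<le> M x y \<and> M x y = M y x) \<and> (\<forall>x y. M x y \<noteq> 0 \<longrightarrow> (x, y) \<in> E \<or> (y, x) \<in> E) \<and>
    (\<forall>x\<in>X. (\<Sum>y\<in>X. M x y) \<le> m x) \<and>
    (\<forall>x y. (x, y) \<in> E \<longrightarrow> (\<Sum>z\<in>X. M x z) = m x \<or> (\<Sum>z\<in>X. M y z) = m y)"
  using E
proof (induction E rule: finite_induct)
  case empty
  show ?case by (rule exI [of _ "\<lambda>_ _. 0"]) (use m in auto)
next
  case (insert e E)
  obtain a b where e: "e = (a, b)" by force
  have ab: "a \<in> X" "b \<in> X" using insert.prems e by auto
  obtain M where "(\<forall>x y. 0 \<le> M x y \<and> M x y = M y x) \<and> (\<forall>x y. M x y \<noteq> 0 \<longrightarrow> (x, y) \<in> E \<or> (y, x) \<in> E) \<and>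
    (\<forall>x\<in>X. (\<Sum>y\<in>X. M x y) \<le> m x) \<and>
    (\<forall>x y. (x, y) \<in> E \<longrightarrow> (\<Sum>z\<in>X. M x z) = m x \<or> (\<Sum>z\<in>X. M y z) = m y)"
    using insert.IH insert.prems by auto
  then have M: "\<And>x y. 0 \<le> M x y" "\<And>x y. M x y = M y x" "\<And>x y. M x y \<noteq> 0 \<Longrightarrow> (x, y) \<in> E \<or> (y, x) \<in> E"
    "\<And>x. x \<in> X \<Longrightarrow> (\<Sum>y\<in>X. M x y) \<le> m x"
    "\<And>x y. (x, y) \<in> E \<Longrightarrow> (\<Sum>z\<in>X. M x z) = m x \<or> (\<Sum>z\<in>X. M y z) = m y"
    by blast+
  define t where "t = min (m a - (\<Sum>z\<in>X. M a z)) (m b - (\<Sum>z\<in>X. M b z))"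
  have t0: "0 \<le> t" using M(4) ab by (simp add: t_def)
  \<comment> \<open>The chain may stay put, so an edge can be a loop with \<open>a = b\<close>; the
    disjunction adds \<open>t\<close> once in that case.\<close>
  define M' where "M' x y = M x y + (if x = a \<and> y = b \<or> x = b \<and> y = a then t else 0)" for x y
  have row: "(\<Sum>y\<in>X. M' x y) = (\<Sum>y\<in>X. M x y) + (if x = a \<or> x = b then t else 0)" for x
  proof -
    have "(\<Sum>y\<in>X. if x = a \<and> y = b \<or> x = b \<and> y = a then t else 0) = (\<Sum>y\<in>X. if y = (if x = a then b else a) then (if x = a \<or> x = b then t else 0) else 0)"
      by (intro sum.cong) auto
    also have "\<dots> = (if x = a \<or> x = b then t else 0)"
      using X ab by (simp add: sum.delta)
    finally show ?thesis by (simp add: M'_def sum.distrib)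
  qed
  have "(\<Sum>y\<in>X. M' x y) \<le> m x" if "x \<in> X" for x
    using M(4) [OF that] by (auto simp: row t_def min_def)
  moreover have "(\<Sum>z\<in>X. M' x z) = m x \<or> (\<Sum>z\<in>X. M' y z) = m y" if "(x, y) \<in> insert e E" for x y
  proof (cases "(x, y) = e")
    case True
    then show ?thesis by (auto simp: e row t_def min_def)
  next
    case False
    have keep: "(\<Sum>z\<in>X. M' x z) = m x" if "x \<in> X" "(\<Sum>z\<in>X. M x z) = m x" for x
      using that t0 by (auto simp: row) (auto simp: t_def min_def split: if_splits)
    show ?thesis
      using False that M(5) keep insert.prems by blast
  qed
  moreover have "0 \<le> M' x y \<and> M' x y = M' y x" for x y
    using M(1,2) t0 by (auto simp: M'_def)
  moreover have "(x, y) \<in> insert e E \<or> (y, x) \<in> insert e E" if "M' x y \<noteq> 0" for x y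
    using that M(3) [of x y] by (auto simp: M'_def e split: if_splits)
  ultimately show ?case by (intro exI [of _ M']) blast
qed

section \<open>Entropy of the averages of a function\<close>

definition ent :: "real \<Rightarrow> real" where "ent t = t * ln t"

text \<open>The constant comes from \<open>u ln u - u + 1 \<ge> (1 - \<surd>u)\<^sup>2\<close>, which is at least \<open>1/4\<close> for \<open>u \<le> 1/4\<close>.\<close>

lemma ent_tangent:
  assumes "0 < a" "0 \<le> t"
  shows "ent a + (1 + ln a) * (t - a) + (if t < a / 4 then a / 4 else 0) \<le> ent t"
proof (cases "t = 0")
  case True
  then show ?thesis using assms by (simp add: ent_def algebra_simps)
next
  case False
  define w where "w = sqrt (t / a)"
  have tpos: "0 < t" using False assms by simp
  have w: "0 < w" "w\<^sup>2 = t / a" using tpos assms by (auto simp: w_def)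
  have t: "t = a * w\<^sup>2" using w assms by simp
  have lw: "1 - 1 / w \<le> ln w"
    using ln_le_minus_one [of "1 / w"] w(1) by (simp add: ln_div)
  have lnt: "ln t = ln a + 2 * ln w"
    unfolding t using assms w(1) by (simp add: ln_mult ln_realpow)
  have "ent t - (ent a + (1 + ln a) * (t - a)) = a * (2 * w\<^sup>2 * ln w - w\<^sup>2 + 1)"
    unfolding ent_def lnt by (simp add: t algebra_simps)
  also have "\<dots> \<ge> a * (1 - w)\<^sup>2"
  proof (intro mult_left_mono)
    have "2 * w\<^sup>2 * (1 - 1 / w) \<le> 2 * w\<^sup>2 * ln w"
      using lw by (intro mult_left_mono) auto
    moreover have "2 * w\<^sup>2 * (1 - 1 / w) = 2 * w\<^sup>2 - 2 * w"
      using w(1) by (simp add: power2_eq_square field_simps)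
    ultimately show "(1 - w)\<^sup>2 \<le> 2 * w\<^sup>2 * ln w - w\<^sup>2 + 1"
      unfolding power2_diff by simp
  qed (use assms in simp)
  finally have le: "a * (1 - w)\<^sup>2 \<le> ent t - (ent a + (1 + ln a) * (t - a))" .
  show ?thesis
  proof (cases "t < a / 4")
    case True
    then have "t / a < 1 / 4" using assms by (simp add: field_simps)
    then have "w\<^sup>2 < (1 / 2)\<^sup>2" unfolding w(2) by (simp add: power2_eq_square)
    then have "w < 1 / 2" by (rule power_less_imp_less_base) simp
    then have "(1 / 2)\<^sup>2 \<le> (1 - w)\<^sup>2" by (intro power_mono) auto
    then have "a * (1 / 4) \<le> a * (1 - w)\<^sup>2" using assms by (intro mult_left_mono) (auto simp: power2_eq_square)
    then show ?thesis using le True by simp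
  next
    case False
    have "0 \<le> a * (1 - w)\<^sup>2" using assms by simp
    then show ?thesis using le False by simp
  qed
qed

context spectral_chain
begin

definition Ent :: "nat set \<Rightarrow> nat set \<Rightarrow> ((nat \<Rightarrow> 'v) \<Rightarrow> real) \<Rightarrow> real" where
  "Ent I J f = pexp (\<lambda>_. \<mu>) J (\<lambda>x. ent (avg I J f x))"

lemma pexp_avg: "finite I \<Longrightarrow> J \<subseteq> I \<Longrightarrow> pexp (\<lambda>_. \<mu>) J (avg I J f) = pexp (\<lambda>_. \<mu>) I f"
  by (subst pexp_split) (simp_all add: avg_def [abs_def])

lemma avg_nonneg:
  assumes "J \<subseteq> I" "\<And>x. x \<in> cube I \<Longrightarrow> 0 \<le> f x"
  shows "0 \<le> avg I J f x"
  unfolding avg_def by (rule pexp_nonneg [OF mu_nonneg]) (simp add: fibre_def assms(2) merge_cube [OF assms(1)])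

lemma avg_le_1:
  assumes "finite I" "J \<subseteq> I" "\<And>x. x \<in> cube I \<Longrightarrow> f x \<le> 1"
  shows "avg I J f x \<le> 1"
proof -
  have "avg I J f x \<le> pexp (\<lambda>_. \<mu>) (I - J) (\<lambda>_. 1)"
    unfolding avg_def by (rule pexp_mono [OF mu_nonneg]) (simp add: fibre_def assms(3) merge_cube [OF assms(2)])
  then show ?thesis using assms(1) by (simp add: pexp_mu_const)
qed

lemma fibre_fibre:
  assumes "J \<subseteq> L" "L \<subseteq> I"
  shows "fibre (I - J) (L - J) (fibre I J f x) u = fibre I L f (merge J (L - J) (x, u))"
proof
  fix y
  have "merge J (I - J) (x, merge (L - J) (I - J - (L - J)) (u, y)) = merge L (I - L) (merge J (L - J) (x, u), y)"
    using assms by (auto simp: merge_def fun_eq_iff)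
  then show "fibre (I - J) (L - J) (fibre I J f x) u y = fibre I L f (merge J (L - J) (x, u)) y"
    by (simp add: fibre_def)
qed

lemma avg_fibre:
  assumes "J \<subseteq> L" "L \<subseteq> I"
  shows "avg (I - J) (L - J) (fibre I J f x) u = avg I L f (merge J (L - J) (x, u))"
proof -
  have "I - J - (L - J) = I - L" using assms by auto
  then show ?thesis unfolding avg_def fibre_fibre [OF assms] by simp
qed

text \<open>The coordinates in \<open>L\<close> are fixed in two stages; this localizes comparisons
  of entropy to single fibres over \<open>J\<close>.\<close>

lemma Ent_split:
  assumes "finite I" "J \<subseteq> L" "L \<subseteq> I"
  shows "Ent I L f = pexp (\<lambda>_. \<mu>) J (\<lambda>x. Ent (I - J) (L - J) (fibre I J f x))"
proof -
  have fin: "finite L" using assms finite_subset by auto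
  show ?thesis
    unfolding Ent_def by (subst pexp_split [OF fin assms(2)]) (simp add: fibre_def avg_fibre [OF assms(2,3)])
qed

text \<open>Jensen's inequality with its deficit: the tangent of \<open>ent\<close> at the mean
  \<open>a\<close> is integrated, the linear term drops out, and the values below
  \<open>a / 4\<close> contribute the surplus of \<open>ent_tangent\<close>.\<close>

lemma Ent_gain:
  assumes I: "finite I" "L \<subseteq> I" and f: "\<And>x. x \<in> cube I \<Longrightarrow> 0 \<le> f x"
  defines "a \<equiv> pexp (\<lambda>_. \<mu>) I f"
  shows "ent a + a / 4 * pexp (\<lambda>_. \<mu>) L (\<lambda>z. of_bool (avg I L f z < a / 4)) \<le> Ent I L f"
proof (cases "a = 0")
  case True
  have fin: "finite L" using I finite_subset by auto
  \<comment> \<open>There is no tangent at 0; but mean 0 forces every average to vanish, as all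
    point masses are positive.\<close>
  have "avg I L f z = 0" if z: "z \<in> cube L" for z
  proof -
    have "(\<Sum>x\<in>cube L. (\<Prod>i\<in>L. \<mu> (x i)) * avg I L f x) = 0"
      using True pexp_avg [OF I, of f] by (simp add: a_def pexp_def)
    then have "(\<Prod>i\<in>L. \<mu> (z i)) * avg I L f z = 0"
      using z fin by (subst (asm) sum_nonneg_eq_0_iff) (auto intro!: mult_nonneg_nonneg prod_nonneg mu_nonneg avg_nonneg [OF I(2) f])
    moreover have "0 < (\<Prod>i\<in>L. \<mu> (z i))" by (intro prod_pos) (simp add: mu_pos)
    ultimately show ?thesis by simp
  qed
  then have "Ent I L f = 0" by (simp add: Ent_def ent_def)
  then show ?thesis using True by (simp add: ent_def)
next
  case False
  have fin: "finite L" using I finite_subset by auto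
  have "0 \<le> a" unfolding a_def by (rule pexp_nonneg [OF mu_nonneg f])
  then have apos: "0 < a" using False by simp
  have "ent a + a / 4 * pexp (\<lambda>_. \<mu>) L (\<lambda>z. of_bool (avg I L f z < a / 4)) =
     pexp (\<lambda>_. \<mu>) L (\<lambda>z. (ent a - (1 + ln a) * a) + (1 + ln a) * avg I L f z + a / 4 * of_bool (avg I L f z < a / 4))"
    unfolding pexp_add pexp_cmult pexp_mu_const [OF fin] pexp_avg [OF I] by (simp add: a_def)
  also have "\<dots> \<le> Ent I L f"
    unfolding Ent_def
  proof (rule pexp_mono [OF mu_nonneg])
    fix z
    show "(ent a - (1 + ln a) * a) + (1 + ln a) * avg I L f z + a / 4 * of_bool (avg I L f z < a / 4) \<le> ent (avg I L f z)"
      using ent_tangent [OF apos avg_nonneg [where f = f and x = z, OF I(2) f]] by (simp add: algebra_simps split: if_splits)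
  qed
  finally show ?thesis .
qed

lemma Ent_ge_ent:
  assumes I: "finite I" "L \<subseteq> I" and f: "\<And>x. x \<in> cube I \<Longrightarrow> 0 \<le> f x"
  shows "ent (pexp (\<lambda>_. \<mu>) I f) \<le> Ent I L f"
proof -
  have "0 \<le> pexp (\<lambda>_. \<mu>) I f" by (rule pexp_nonneg [OF mu_nonneg f])
  moreover have "0 \<le> pexp (\<lambda>_. \<mu>) L (\<lambda>z. of_bool (avg I L f z < pexp (\<lambda>_. \<mu>) I f / 4))"
    by (rule pexp_nonneg [OF mu_nonneg]) simp
  ultimately show ?thesis
    using Ent_gain [where L = L and f = f, OF I f] by (smt (verit) mult_nonneg_nonneg divide_nonneg_pos)
qed

lemma Ent_mono:
  assumes I: "finite I" "J \<subseteq> L" "L \<subseteq> I" and f: "\<And>x. x \<in> cube I \<Longrightarrow> 0 \<le> f x"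
  shows "Ent I J f \<le> Ent I L f"
  unfolding Ent_split [OF I]
proof (subst Ent_def, rule pexp_mono [OF mu_nonneg])
  fix x
  have JI: "J \<subseteq> I" using I by blast
  show "ent (avg I J f x) \<le> Ent (I - J) (L - J) (fibre I J f x)"
    unfolding avg_def by (rule Ent_ge_ent) (use I in \<open>auto simp: fibre_def f merge_cube [OF JI]\<close>)
qed

text \<open>One of the two fibres over an edge gains entropy: if both kept their mass away from \<open>0\<close>,
  the edge would carry too much correlation.\<close>

lemma edge_gain:
  assumes I: "finite I" and J: "J \<subseteq> L" "L \<subseteq> I"
    and f: "\<And>x. x \<in> cube I \<Longrightarrow> 0 \<le> f x" and g: "\<And>x. x \<in> cube I \<Longrightarrow> 0 \<le> g x"
    and \<eta>: "\<eta> \<le> 1 / 10" "4 * \<eta> \<le> pexp (\<lambda>_. \<mu>) I f" "4 * \<eta> \<le> pexp (\<lambda>_. \<mu>) I g"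
    and P: "dexp \<nu> J (\<lambda>x y. of_bool (\<eta> \<le> avg I J f x \<and> \<eta> \<le> avg I J g y)) \<le> \<eta>"
  shows "ent (pexp (\<lambda>_. \<mu>) I f) + pexp (\<lambda>_. \<mu>) I f / 10 \<le> Ent I L f \<or>
    ent (pexp (\<lambda>_. \<mu>) I g) + pexp (\<lambda>_. \<mu>) I g / 10 \<le> Ent I L g"
proof -
  have JI: "J \<subseteq> I" using J by blast
  have fin: "finite J" using JI I finite_subset by auto
  define p where "p h = pexp (\<lambda>_. \<mu>) J (\<lambda>z. of_bool (avg I J h z < pexp (\<lambda>_. \<mu>) I h / 4))" for h
  have "1 = dexp \<nu> J (\<lambda>x y. 1)"
    using dexp_left [OF fin nu_row, where F = "\<lambda>_. 1"] by (simp add: pexp_mu_const [OF fin])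
  also have "\<dots> \<le> dexp \<nu> J (\<lambda>x y. of_bool (\<eta> \<le> avg I J f x \<and> \<eta> \<le> avg I J g y) +
      (of_bool (avg I J f x < pexp (\<lambda>_. \<mu>) I f / 4) + of_bool (avg I J g y < pexp (\<lambda>_. \<mu>) I g / 4)))"
    by (rule dexp_mono [OF nu_nonneg]) (use \<eta> in auto)
  also have "\<dots> \<le> \<eta> + (p f + p g)"
    unfolding dexp_add dexp_left [OF fin nu_row] dexp_right [OF fin nu_col] p_def using P by simp
  \<comment> \<open>At least 9/10 is left for \<open>p f + p g\<close>; a quarter of 4/10 is then
    the 1/10 of the statement.\<close>
  finally have "4 / 10 \<le> p f \<or> 4 / 10 \<le> p g" using \<eta>(1) by linarith
  moreover have "ent (pexp (\<lambda>_. \<mu>) I h) + pexp (\<lambda>_. \<mu>) I h / 10 \<le> Ent I L h"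
    if h: "\<And>x. x \<in> cube I \<Longrightarrow> 0 \<le> h x" and p: "4 / 10 \<le> p h" for h
  proof -
    have "0 \<le> pexp (\<lambda>_. \<mu>) I h" by (rule pexp_nonneg [OF mu_nonneg h])
    then have "pexp (\<lambda>_. \<mu>) I h / 4 * (4 / 10) \<le> pexp (\<lambda>_. \<mu>) I h / 4 * p h"
      using p by (intro mult_left_mono) auto
    moreover have "ent (pexp (\<lambda>_. \<mu>) I h) + pexp (\<lambda>_. \<mu>) I h / 4 * p h \<le> Ent I J h"
      unfolding p_def by (rule Ent_gain [OF I JI h])
    moreover have "Ent I J h \<le> Ent I L h" by (rule Ent_mono [OF I J h])
    ultimately show ?thesis by simp
  qed
  ultimately show ?thesis using f g by blast
qed

end

text \<open>Bounds the number of fixed coordinates: with \<open>N\<close> of them there are at most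
  \<open>v ^ (2 * N)\<close> pairs of vertices, and each edge among these adds at most
  \<open>2 ^ c\<close> new coordinates.\<close>

fun budget :: "nat \<Rightarrow> nat \<Rightarrow> nat \<Rightarrow> nat" where
  "budget v c 0 = 0"
| "budget v c (Suc k) = budget v c k + v ^ (2 * budget v c k) * 2 ^ c"

lemma budget_mono: "k \<le> l \<Longrightarrow> budget v c k \<le> budget v c l"
  by (rule lift_Suc_mono_le) simp_all

section \<open>Couplings along edges and the entropy increment\<close>

context spectral_chain
begin

definition Junta :: "nat \<Rightarrow> bool" where
  "Junta C \<longleftrightarrow> (\<forall>m\<ge>1. \<forall>I f g. finite I \<longrightarrow> (\<forall>x\<in>cube I. 0 \<le> f x \<and> f x \<le> 1 \<and> 0 \<le> g x \<and> g x \<le> 1) \<longrightarrow>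
     dexp \<nu> I (\<lambda>x y. f x * g y) \<le> (1 / 2) ^ (C * m) \<longrightarrow>
     (\<exists>J\<subseteq>I. card J \<le> 2 ^ (C * m) \<and>
        dexp \<nu> J (\<lambda>x y. of_bool ((1 / 2) ^ m \<le> avg I J f x \<and> (1 / 2) ^ m \<le> avg I J g y)) \<le> (1 / 2) ^ m))"

lemma JuntaD:
  assumes "Junta C" "1 \<le> m" "finite I" "\<And>x. x \<in> cube I \<Longrightarrow> 0 \<le> f x \<and> f x \<le> 1" "\<And>x. x \<in> cube I \<Longrightarrow> 0 \<le> g x \<and> g x \<le> 1"
    "dexp \<nu> I (\<lambda>x y. f x * g y) \<le> (1 / 2) ^ (C * m)"
  shows "\<exists>J\<subseteq>I. card J \<le> 2 ^ (C * m) \<and>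
        dexp \<nu> J (\<lambda>x y. of_bool ((1 / 2) ^ m \<le> avg I J f x \<and> (1 / 2) ^ m \<le> avg I J g y)) \<le> (1 / 2) ^ m"
  using assms(1) [unfolded Junta_def, THEN spec, THEN mp, OF assms(2), THEN spec, THEN spec, THEN spec, THEN mp, OF assms(3),
      of f g] assms(4-) by blast

definition wt :: "nat set \<Rightarrow> (nat \<Rightarrow> 'v) \<Rightarrow> real" where "wt I x = (\<Prod>i\<in>I. \<mu> (x i))"
definition edge :: "nat set \<Rightarrow> (nat \<Rightarrow> 'v) \<Rightarrow> (nat \<Rightarrow> 'v) \<Rightarrow> real" where "edge I x y = (\<Prod>i\<in>I. \<nu> (x i) (y i))"

lemma edge_nonneg: "0 \<le> edge I x y"
  unfolding edge_def by (intro prod_nonneg) (simp add: nu_nonneg)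

text \<open>The bound depends on \<open>card J\<close> alone, so a sufficiently small total
  correlation stays small on the fibres over every single edge.\<close>

lemma edge_ge:
  assumes \<beta>: "\<And>x y. 0 < \<nu> x y \<Longrightarrow> \<beta> \<le> \<nu> x y" "0 < \<beta>" and pos: "0 < edge J x y"
  shows "\<beta> ^ card J \<le> edge J x y"
proof (cases "finite J")
  case True
  have "0 < \<nu> (x i) (y i)" if "i \<in> J" for i
  proof -
    have "\<nu> (x i) (y i) \<noteq> 0"
    proof
      assume "\<nu> (x i) (y i) = 0"
      then have "edge J x y = 0"
        unfolding edge_def using True that by (intro prod_zero) auto
      then show False using pos by simp
    qed
    then show ?thesis using nu_nonneg [of "x i" "y i"] by simp
  qed
  then have "(\<Prod>i\<in>J. \<beta>) \<le> edge J x y"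
    unfolding edge_def by (intro prod_mono) (use \<beta> in force)
  then show ?thesis by simp
qed (simp add: edge_def)

lemma card_cube: "finite J \<Longrightarrow> card (cube J :: (nat \<Rightarrow> 'v) set) = CARD('v) ^ card J"
  by (simp add: card_PiE)

text \<open>A fractional matching along edges, with \<open>f\<close> as the density of its
  marginals. In this form it can be averaged over coordinates, which the iteration requires.\<close>

definition coupling :: "nat set \<Rightarrow> ((nat \<Rightarrow> 'v) \<Rightarrow> (nat \<Rightarrow> 'v) \<Rightarrow> real) \<Rightarrow> ((nat \<Rightarrow> 'v) \<Rightarrow> real) \<Rightarrow> bool" where
  "coupling I M f \<longleftrightarrow> (\<forall>x\<in>cube I. \<forall>y\<in>cube I. 0 \<le> M x y \<and> M x y = M y x \<and> (M x y \<noteq> 0 \<longrightarrow> 0 < edge I x y)) \<and>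
     (\<forall>x\<in>cube I. (\<Sum>y\<in>cube I. M x y) = wt I x * f x)"

lemma couplingD:
  assumes "coupling I M f" "x \<in> cube I"
  shows "y \<in> cube I \<Longrightarrow> 0 \<le> M x y" "y \<in> cube I \<Longrightarrow> M x y = M y x"
    "y \<in> cube I \<Longrightarrow> M x y \<noteq> 0 \<Longrightarrow> 0 < edge I x y" "(\<Sum>y\<in>cube I. M x y) = wt I x * f x"
  using assms by (auto simp: coupling_def)

text \<open>The mass is summed over pairs of fibres. An edge projects to an edge, because the edge
  weight is a product over the coordinates.\<close>

lemma coupling_project:
  assumes I: "finite I" "J \<subseteq> I" and M: "coupling I M f"
  shows "\<exists>M'. coupling J M' (avg I J f)"
proof -
  have fin: "finite J" "finite (I - J)" "J \<inter> (I - J) = {}" using I finite_subset by auto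
  let ?m = "\<lambda>x u. merge J (I - J) (x, u) :: nat \<Rightarrow> 'v"
  have mc: "?m x u \<in> cube I" for x u by (rule merge_cube [OF I(2)])
  define M' where "M' x y = (\<Sum>u\<in>cube (I - J). \<Sum>u'\<in>cube (I - J). M (?m x u) (?m y u'))" for x y
  have M0: "0 \<le> M (?m x u) (?m y u')" and Msym: "M (?m x u) (?m y u') = M (?m y u') (?m x u)"
    and Medge: "M (?m x u) (?m y u') \<noteq> 0 \<Longrightarrow> 0 < edge I (?m x u) (?m y u')" for x y u u'
    by (rule couplingD(1) [OF M mc mc], rule couplingD(2) [OF M mc mc], rule couplingD(3) [OF M mc mc])
  have "0 < edge J x y" if "M' x y \<noteq> 0" for x y
  proof -
    have "\<exists>u u'. M (?m x u) (?m y u') \<noteq> 0"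
    proof (rule ccontr)
      assume "\<not> ?thesis"
      then have "M' x y = 0" unfolding M'_def by (intro sum.neutral ballI) auto
      then show False using that by simp
    qed
    then obtain u u' where "M (?m x u) (?m y u') \<noteq> 0" by blast
    then have "0 < edge I (?m x u) (?m y u')" by (rule Medge)
    then have "edge J x y \<noteq> 0"
      using prod_union_merge2 [OF fin, of \<nu> x u y u', unfolded split_set [OF I(2)]] by (auto simp: edge_def)
    then show ?thesis using edge_nonneg [of J x y] by simp
  qed
  moreover have "0 \<le> M' x y" for x y
    unfolding M'_def by (intro sum_nonneg M0)
  moreover have "M' x y = M' y x" for x y
    unfolding M'_def by (subst sum.swap) (intro sum.cong refl Msym)
  moreover have "(\<Sum>y\<in>cube J. M' x y) = wt J x * avg I J f x" for x
  proof -
    have "(\<Sum>y\<in>cube J. M' x y) = (\<Sum>u\<in>cube (I - J). \<Sum>y\<in>cube J. \<Sum>u'\<in>cube (I - J). M (?m x u) (?m y u'))"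
      unfolding M'_def by (rule sum.swap)
    also have "\<dots> = (\<Sum>u\<in>cube (I - J). \<Sum>y\<in>cube I. M (?m x u) y)"
      by (intro sum.cong refl sum_cube_union [OF fin(3), unfolded split_set [OF I(2)], symmetric])
    also have "\<dots> = (\<Sum>u\<in>cube (I - J). wt I (?m x u) * f (?m x u))"
      by (intro sum.cong refl couplingD(4) [OF M mc])
    also have "\<dots> = (\<Sum>u\<in>cube (I - J). wt J x * (wt (I - J) u * f (?m x u)))"
      using prod_union_merge [OF fin, of "\<lambda>_. \<mu>", unfolded split_set [OF I(2)]] by (simp add: wt_def mult.assoc)
    also have "\<dots> = wt J x * avg I J f x"
      unfolding sum_distrib_left [symmetric] by (simp add: avg_def pexp_def fibre_def wt_def)
    finally show ?thesis .
  qed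
  ultimately show ?thesis
    unfolding coupling_def by (intro exI [of _ M']) blast
qed

text \<open>The left side is one term of a sum of non-negative terms over the pairs of vertices of
  the cube on \<open>J\<close>.\<close>

lemma edge_restrict_le:
  assumes I: "finite I" "J \<subseteq> I" and f: "\<And>x. x \<in> cube I \<Longrightarrow> 0 \<le> f x" and xy: "x \<in> cube J" "y \<in> cube J"
  shows "edge J x y * dexp \<nu> (I - J) (\<lambda>u u'. fibre I J f x u * fibre I J f y u') \<le> dexp \<nu> I (\<lambda>x y. f x * f y)"
proof -
  have fin: "finite J" using I finite_subset by auto
  let ?E = "\<lambda>x y. edge J x y * dexp \<nu> (I - J) (\<lambda>u u'. fibre I J f x u * fibre I J f y u')"
  have E0: "0 \<le> ?E x y" for x y
    by (intro mult_nonneg_nonneg edge_nonneg dexp_nonneg nu_nonneg) (simp_all add: fibre_def f merge_cube [OF I(2)])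
  have "?E x y \<le> (\<Sum>y\<in>cube J. ?E x y)"
    using xy fin by (intro member_le_sum [of y _ "?E x"] E0) auto
  also have "\<dots> \<le> (\<Sum>x\<in>cube J. \<Sum>y\<in>cube J. ?E x y)"
    using xy fin by (intro member_le_sum [of x _ "\<lambda>x. \<Sum>y\<in>cube J. ?E x y"] sum_nonneg E0) auto
  also have "\<dots> = dexp \<nu> I (\<lambda>x y. f x * f y)"
    by (subst dexp_split [OF I]) (simp add: dexp_def [of \<nu> J] edge_def fibre_def)
  finally show ?thesis .
qed

text \<open>\<open>edge_gain\<close> speaks of edges and entropy of vertices; the projected coupling
  mediates. All its mass lies on edges with an end that gains or an end of negligible average, and
  both its marginals have density \<open>avg I J f\<close>.\<close>

lemma entropy_increment:
  assumes C: "Junta C" and \<beta>: "\<And>x y. 0 < \<nu> x y \<Longrightarrow> \<beta> \<le> \<nu> x y" "0 < \<beta>" "\<beta> \<le> 1"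
    and I: "finite I" "J \<subseteq> I" and N: "card J \<le> N" and m: "4 \<le> m"
    and f: "\<And>x. x \<in> cube I \<Longrightarrow> 0 \<le> f x \<and> f x \<le> 1" and M: "coupling I M f"
    and F: "16 * (1 / 2) ^ m \<le> pexp (\<lambda>_. \<mu>) I f"
    and small: "dexp \<nu> I (\<lambda>x y. f x * f y) \<le> \<beta> ^ N * (1 / 2) ^ (C * m)"
  shows "\<exists>L\<subseteq>I. card L \<le> N + CARD('v) ^ (2 * N) * 2 ^ (C * m) \<and> Ent I J f + pexp (\<lambda>_. \<mu>) I f / 40 \<le> Ent I L f"
proof -
  have fin: "finite J" using I finite_subset by auto
  define \<eta> :: real where "\<eta> = (1 / 2) ^ m"
  define F0 where "F0 = pexp (\<lambda>_. \<mu>) I f"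
  have \<eta>: "0 < \<eta>" "\<eta> \<le> 1 / 10"
    using power_decreasing [OF m, of "1 / 2 :: real"] by (auto simp: \<eta>_def eval_nat_numeral)
  have f0: "\<And>x. x \<in> cube I \<Longrightarrow> 0 \<le> f x" using f by blast
  let ?fib = "fibre I J f"
  have fib: "0 \<le> ?fib x u \<and> ?fib x u \<le> 1" for x u by (rule fibre_01 [where f = f, OF I(2) f])
  have avgE: "avg I J f x = pexp (\<lambda>_. \<mu>) (I - J) (?fib x)" for x by (simp add: avg_def)
  have "\<exists>K\<subseteq>I - J. card K \<le> 2 ^ (C * m) \<and>
        dexp \<nu> K (\<lambda>u v. of_bool (\<eta> \<le> avg (I - J) K (?fib x) u \<and> \<eta> \<le> avg (I - J) K (?fib y) v)) \<le> \<eta>"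
    if xy: "x \<in> cube J" "y \<in> cube J" and pos: "0 < edge J x y" for x y
  proof -
    let ?D = "dexp \<nu> (I - J) (\<lambda>u u'. ?fib x u * ?fib y u')"
    have D0: "0 \<le> ?D" by (intro dexp_nonneg nu_nonneg) (simp add: fib)
    have "\<beta> ^ N \<le> \<beta> ^ card J" using N \<beta> by (intro power_decreasing) auto
    also have "\<dots> \<le> edge J x y" by (rule edge_ge [OF \<beta>(1,2) pos])
    finally have "\<beta> ^ N * ?D \<le> edge J x y * ?D" by (intro mult_right_mono D0)
    also have "\<dots> \<le> dexp \<nu> I (\<lambda>x y. f x * f y)"
      by (rule edge_restrict_le [OF I f0 xy])
    finally have "\<beta> ^ N * ?D \<le> \<beta> ^ N * (1 / 2) ^ (C * m)" using small by linarith
    then have "?D \<le> (1 / 2) ^ (C * m)" using \<beta>(2) by simp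
    then show ?thesis
      unfolding \<eta>_def using m I by (intro JuntaD [OF C]) (auto simp: fib)
  qed
  then obtain Jf where Jf: "\<And>x y. x \<in> cube J \<Longrightarrow> y \<in> cube J \<Longrightarrow> 0 < edge J x y \<Longrightarrow> Jf x y \<subseteq> I - J \<and> card (Jf x y) \<le> 2 ^ (C * m) \<and>
        dexp \<nu> (Jf x y) (\<lambda>u v. of_bool (\<eta> \<le> avg (I - J) (Jf x y) (?fib x) u \<and> \<eta> \<le> avg (I - J) (Jf x y) (?fib y) v)) \<le> \<eta>"
    by metis
  define P where "P = {(x, y) \<in> cube J \<times> cube J. 0 < edge J x y}"
  have PS: "P \<subseteq> cube J \<times> cube J" by (auto simp: P_def)
  have finP: "finite P" using PS fin finite_subset by (metis finite_SigmaI finite_cube)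
  \<comment> \<open>One refinement for all edges at once: since entropy does not decrease under
    refinement, the gain made for one edge is not lost by treating the others.\<close>
  define U where "U = (\<Union>(x, y)\<in>P. Jf x y)"
  have UI: "U \<subseteq> I - J"
    unfolding U_def
  proof (rule UN_least)
    fix p assume "p \<in> P"
    then obtain x y where "p = (x, y)" "x \<in> cube J" "y \<in> cube J" "0 < edge J x y" by (auto simp: P_def)
    then show "(case p of (x, y) \<Rightarrow> Jf x y) \<subseteq> I - J" using Jf [of x y] by simp
  qed
  define L where "L = J \<union> U"
  have L: "L \<subseteq> I" "J \<subseteq> L" "L - J = U" using UI I(2) by (auto simp: L_def)
  have cardL: "card L \<le> N + CARD('v) ^ (2 * N) * 2 ^ (C * m)"
  proof -
    have "card U \<le> (\<Sum>p\<in>P. card (case p of (x, y) \<Rightarrow> Jf x y))"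
      unfolding U_def by (rule card_UN_le [OF finP])
    also have "\<dots> \<le> (\<Sum>p\<in>P. 2 ^ (C * m))"
      by (intro sum_mono) (use Jf in \<open>auto simp: P_def\<close>)
    also have "\<dots> = card P * 2 ^ (C * m)" by simp
    also have "card P \<le> card (cube J \<times> cube J :: ((nat \<Rightarrow> 'v) \<times> (nat \<Rightarrow> 'v)) set)"
      using PS fin by (intro card_mono) auto
    also have "\<dots> = CARD('v) ^ (2 * card J)"
      by (simp add: card_cartesian_product card_cube [OF fin] power_add [symmetric] mult_2)
    also have "\<dots> \<le> CARD('v) ^ (2 * N)"
      using N by (intro power_increasing) auto
    finally have "card U \<le> CARD('v) ^ (2 * N) * 2 ^ (C * m)" by simp
    moreover have "card L \<le> card J + card U" unfolding L_def by (rule card_Un_le)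
    ultimately show ?thesis using N by linarith
  qed
  define gain where "gain x = Ent (I - J) U (?fib x) - ent (avg I J f x)" for x
  have gain0: "0 \<le> gain x" for x
    using Ent_ge_ent [of "I - J" U "?fib x"] I UI fib by (simp add: gain_def avgE)
  define good where "good x \<longleftrightarrow> avg I J f x / 10 \<le> gain x" for x
  have dich: "good x \<or> good y \<or> avg I J f x < 4 * \<eta> \<or> avg I J f y < 4 * \<eta>"
    if xy: "x \<in> cube J" "y \<in> cube J" and pos: "0 < edge J x y" for x y
  proof (rule ccontr)
    assume neg: "\<not> ?thesis"
    have "Jf x y \<subseteq> U" using xy pos by (auto simp: U_def P_def)
    then have "ent (pexp (\<lambda>_. \<mu>) (I - J) (?fib x)) + pexp (\<lambda>_. \<mu>) (I - J) (?fib x) / 10 \<le> Ent (I - J) U (?fib x) \<or>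
      ent (pexp (\<lambda>_. \<mu>) (I - J) (?fib y)) + pexp (\<lambda>_. \<mu>) (I - J) (?fib y) / 10 \<le> Ent (I - J) U (?fib y)"
      using neg Jf [OF xy pos] UI I fib \<eta> by (intro edge_gain [where J = "Jf x y" and \<eta> = \<eta>]) (auto simp: avgE)
    then show False using neg by (auto simp: good_def gain_def avgE)
  qed
  obtain M' where M': "coupling J M' (avg I J f)" using coupling_project [OF I M] by blast
  have M'0: "0 \<le> M' x y" and M'sym: "M' x y = M' y x" and M'edge: "M' x y \<noteq> 0 \<Longrightarrow> 0 < edge J x y"
    if "x \<in> cube J" "y \<in> cube J" for x y
    by (rule couplingD(1) [OF M' that], rule couplingD(2) [OF M' that], rule couplingD(3) [OF M' that])
  have M'row: "(\<Sum>y\<in>cube J. M' x y) = wt J x * avg I J f x" if "x \<in> cube J" for x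
    by (rule couplingD(4) [OF M' that])
  have wt0: "0 \<le> wt J x" for x unfolding wt_def by (intro prod_nonneg) (simp add: mu_nonneg)
  have avg0: "0 \<le> avg I J f x" for x by (rule avg_nonneg [OF I(2) f0])
  have total: "(\<Sum>x\<in>cube J. wt J x * avg I J f x) = F0"
    using pexp_avg [OF I, of f] by (simp add: pexp_def wt_def F0_def)
  have wt1: "(\<Sum>x\<in>cube J. wt J x) = 1"
    using pexp_mu_const [OF fin, of 1] by (simp add: pexp_def wt_def)
  let ?b = "\<lambda>x. of_bool (avg I J f x < 4 * \<eta>) :: real" and ?g = "\<lambda>x. of_bool (good x) :: real"
  have low: "(\<Sum>x\<in>cube J. \<Sum>y\<in>cube J. M' x y * ?b x) \<le> 4 * \<eta>"
  proof -
    have "(\<Sum>x\<in>cube J. \<Sum>y\<in>cube J. M' x y * ?b x) = (\<Sum>x\<in>cube J. wt J x * avg I J f x * ?b x)"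
      by (simp add: sum_distrib_right [symmetric] M'row)
    also have "\<dots> \<le> (\<Sum>x\<in>cube J. wt J x * (4 * \<eta>))"
      unfolding mult.assoc by (intro sum_mono mult_left_mono wt0) (use \<eta> in auto)
    also have "\<dots> = 4 * \<eta>" by (simp add: sum_distrib_right [symmetric] wt1)
    finally show ?thesis .
  qed
  have swap: "(\<Sum>x\<in>cube J. \<Sum>y\<in>cube J. M' x y * h y) = (\<Sum>x\<in>cube J. \<Sum>y\<in>cube J. M' x y * h x)" for h
    by (subst sum.swap) (intro sum.cong refl, simp add: M'sym)
  have "F0 = (\<Sum>x\<in>cube J. \<Sum>y\<in>cube J. M' x y)"
    by (simp add: M'row total)
  also have "\<dots> \<le> (\<Sum>x\<in>cube J. \<Sum>y\<in>cube J. M' x y * ?g x + M' x y * ?g y + M' x y * ?b x + M' x y * ?b y)"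
  proof (intro sum_mono)
    fix x y :: "nat \<Rightarrow> 'v" assume xy: "x \<in> cube J" "y \<in> cube J"
    show "M' x y \<le> M' x y * ?g x + M' x y * ?g y + M' x y * ?b x + M' x y * ?b y"
    proof (cases "M' x y = 0")
      case False
      then have "1 \<le> ?g x + ?g y + ?b x + ?b y"
        using dich [OF xy M'edge [OF xy]] by auto
      then have "M' x y * 1 \<le> M' x y * (?g x + ?g y + ?b x + ?b y)"
        by (intro mult_left_mono M'0 xy)
      then show ?thesis by (simp only: distrib_left mult_1_right)
    qed simp
  qed
  also have "\<dots> = 2 * (\<Sum>x\<in>cube J. \<Sum>y\<in>cube J. M' x y * ?g x) + 2 * (\<Sum>x\<in>cube J. \<Sum>y\<in>cube J. M' x y * ?b x)"
    unfolding sum.distrib swap by simp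
  \<comment> \<open>Small averages, at either end, account for at most
    \<open>8 * \<eta> \<le> F0 / 2\<close> of the mass. The rest meets a gaining vertex at one end
    or the other, whence the second factor 1/2. The gain of one tenth then makes 1/40.\<close>
  finally have "F0 / 4 \<le> (\<Sum>x\<in>cube J. \<Sum>y\<in>cube J. M' x y * ?g x)"
    using low F by (simp add: F0_def \<eta>_def)
  also have "\<dots> = (\<Sum>x\<in>cube J. wt J x * (avg I J f x * ?g x))"
    by (simp add: sum_distrib_right [symmetric] M'row mult.assoc)
  also have "\<dots> \<le> (\<Sum>x\<in>cube J. wt J x * (10 * gain x))"
    by (intro sum_mono mult_left_mono wt0) (use gain0 in \<open>auto simp: good_def\<close>)
  also have "\<dots> = 10 * (Ent I L f - Ent I J f)"
    unfolding Ent_split [OF I(1) L(2,1)] L(3) Ent_def [of I J] pexp_diff [symmetric] pexp_cmult [symmetric]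
    by (simp add: pexp_def gain_def wt_def)
  finally have "Ent I J f + F0 / 40 \<le> Ent I L f" by simp
  then show ?thesis using L(1) cardL by (auto simp: F0_def)
qed

text \<open>Each refinement raises the entropy by \<open>F0 / 40\<close>, and the entropy starts at
  \<open>F0 * ln F0\<close> and never becomes positive. Both quantities are proportional to
  \<open>F0\<close>, so at most \<open>40 * ln (1 / F0)\<close> steps fit.\<close>

lemma coupling_correlation:
  assumes C: "Junta C" and \<beta>: "\<And>x y. 0 < \<nu> x y \<Longrightarrow> \<beta> \<le> \<nu> x y" "0 < \<beta>" "\<beta> \<le> 1"
    and I: "finite I" and m: "4 \<le> m"
    and f: "\<And>x. x \<in> cube I \<Longrightarrow> 0 \<le> f x \<and> f x \<le> 1" and M: "coupling I M f"
    and F: "16 * (1 / 2) ^ m \<le> \<epsilon>" "\<epsilon> < pexp (\<lambda>_. \<mu>) I f" and l: "40 * ln (1 / \<epsilon>) \<le> real l"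
  shows "\<beta> ^ budget CARD('v) (C * m) l * (1 / 2) ^ (C * m) < dexp \<nu> I (\<lambda>x y. f x * f y)"
proof (rule ccontr)
  assume "\<not> ?thesis"
  then have small: "dexp \<nu> I (\<lambda>x y. f x * f y) \<le> \<beta> ^ budget CARD('v) (C * m) l * (1 / 2) ^ (C * m)" by simp
  define F0 where "F0 = pexp (\<lambda>_. \<mu>) I f"
  have \<epsilon>: "0 < \<epsilon>" by (rule less_le_trans [OF _ F(1)]) simp
  have F0: "0 < F0" "\<epsilon> < F0" using \<epsilon> F by (auto simp: F0_def)
  have "\<exists>J\<subseteq>I. card J \<le> budget CARD('v) (C * m) k \<and> Ent I {} f + real k * (F0 / 40) \<le> Ent I J f" if "k \<le> l" for k
    using that
  proof (induction k)
    case 0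
    show ?case by (rule exI [of _ "{}"]) simp
  next
    case (Suc k)
    then obtain J where J: "J \<subseteq> I" "card J \<le> budget CARD('v) (C * m) k" "Ent I {} f + real k * (F0 / 40) \<le> Ent I J f" by auto
    have "\<beta> ^ budget CARD('v) (C * m) l * (1 / 2) ^ (C * m) \<le> \<beta> ^ budget CARD('v) (C * m) k * (1 / 2) ^ (C * m)"
      using \<beta> Suc.prems by (intro mult_right_mono power_decreasing budget_mono) auto
    then have sm: "dexp \<nu> I (\<lambda>x y. f x * f y) \<le> \<beta> ^ budget CARD('v) (C * m) k * (1 / 2) ^ (C * m)"
      using small by linarith
    have "16 * (1 / 2) ^ m \<le> pexp (\<lambda>_. \<mu>) I f" using F by linarith
    from entropy_increment [OF C \<beta> I J(1,2) m f M this sm]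
    obtain L where "L \<subseteq> I" "card L \<le> budget CARD('v) (C * m) (Suc k)" "Ent I J f + F0 / 40 \<le> Ent I L f"
      unfolding F0_def budget.simps by blast
    then show ?case using J(3) by (intro exI [of _ L]) (auto simp: algebra_simps add_divide_distrib)
  qed
  then obtain J where J: "J \<subseteq> I" "Ent I {} f + real l * (F0 / 40) \<le> Ent I J f" by blast
  have "Ent I {} f = ent F0"
  proof -
    have "fibre I {} f x y = f y" if "y \<in> cube I" for x y
    proof -
      have "merge {} I (x, y) = y" using that by (auto simp: merge_def fun_eq_iff PiE_def extensional_def)
      then show ?thesis by (simp add: fibre_def)
    qed
    then show ?thesis by (simp add: Ent_def avg_def F0_def)
  qed
  moreover have "Ent I J f \<le> pexp (\<lambda>_. \<mu>) J (\<lambda>_. 0)"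
    unfolding Ent_def
  proof (rule pexp_mono [OF mu_nonneg])
    fix x
    have "0 \<le> avg I J f x" "avg I J f x \<le> 1"
      using avg_nonneg [where f = f and x = x, OF J(1)] avg_le_1 [where f = f and x = x, OF I J(1)] f by blast+
    then show "ent (avg I J f x) \<le> 0"
      by (cases "avg I J f x = 0") (auto simp: ent_def mult_nonneg_nonpos)
  qed
  ultimately have "ent F0 + real l * (F0 / 40) \<le> 0" using J(2) by simp
  then have "F0 * (real l / 40 + ln F0) \<le> 0" by (simp add: ent_def algebra_simps)
  then have "real l \<le> - 40 * ln F0" using F0(1) by (simp add: mult_le_0_iff)
  moreover have "- ln F0 < ln (1 / \<epsilon>)" using F0 \<epsilon> by (simp add: ln_div)
  ultimately show False using l by simp
qed

text \<open>Let \<open>f\<close> be the density of a greedy fractional matching inside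
  \<open>S\<close>. Vertices with \<open>f < 1\<close> span no edge. The removed ones have
  \<open>f = 1\<close>, so their measure is at most the mean of \<open>f\<close>, and a mean above
  \<open>\<epsilon>\<close> would force more correlation in \<open>S\<close> than there is.\<close>

theorem edge_removal:
  assumes C: "Junta C" and \<beta>: "\<And>x y. 0 < \<nu> x y \<Longrightarrow> \<beta> \<le> \<nu> x y" "0 < \<beta>" "\<beta> \<le> 1"
    and I: "finite I" and m: "4 \<le> m" "16 * (1 / 2) ^ m \<le> \<epsilon>" and l: "40 * ln (1 / \<epsilon>) \<le> real l"
    and S: "S \<subseteq> cube I" and few: "dexp \<nu> I (\<lambda>x y. indicator S x * indicator S y) \<le> \<beta> ^ budget CARD('v) (C * m) l * (1 / 2) ^ (C * m)"
  shows "\<exists>T\<subseteq>S. dexp \<nu> I (\<lambda>x y. indicator T x * indicator T y) = 0 \<and> pexp (\<lambda>_. \<mu>) I (indicator (S - T)) \<le> \<epsilon>"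
proof -
  define E where "E = {(x, y) \<in> S \<times> S. 0 < edge I x y}"
  have ES: "E \<subseteq> cube I \<times> cube I" using S by (auto simp: E_def)
  have finE: "finite E" using ES I finite_subset by (metis finite_SigmaI finite_cube)
  have wtpos: "0 < wt I x" for x unfolding wt_def by (intro prod_pos) (simp add: mu_pos)
  have "\<exists>M. (\<forall>x y. 0 \<le> M x y \<and> M x y = M y x) \<and> (\<forall>x y. M x y \<noteq> 0 \<longrightarrow> (x, y) \<in> E \<or> (y, x) \<in> E) \<and>
    (\<forall>x\<in>cube I. (\<Sum>y\<in>cube I. M x y) \<le> wt I x) \<and>
    (\<forall>x y. (x, y) \<in> E \<longrightarrow> (\<Sum>z\<in>cube I. M x z) = wt I x \<or> (\<Sum>z\<in>cube I. M y z) = wt I y)"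
    by (rule greedy_fractional_matching) (use I finE ES wtpos in \<open>auto intro: less_imp_le\<close>)
  then obtain M where "(\<forall>x y. 0 \<le> M x y \<and> M x y = M y x) \<and> (\<forall>x y. M x y \<noteq> 0 \<longrightarrow> (x, y) \<in> E \<or> (y, x) \<in> E) \<and>
    (\<forall>x\<in>cube I. (\<Sum>y\<in>cube I. M x y) \<le> wt I x) \<and>
    (\<forall>x y. (x, y) \<in> E \<longrightarrow> (\<Sum>z\<in>cube I. M x z) = wt I x \<or> (\<Sum>z\<in>cube I. M y z) = wt I y)"
    by (elim exE) (rule that)
  then have M: "\<And>x y. 0 \<le> M x y" "\<And>x y. M x y = M y x" "\<And>x y. M x y \<noteq> 0 \<Longrightarrow> (x, y) \<in> E \<or> (y, x) \<in> E"
    "\<And>x. x \<in> cube I \<Longrightarrow> (\<Sum>y\<in>cube I. M x y) \<le> wt I x"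
    "\<And>x y. (x, y) \<in> E \<Longrightarrow> (\<Sum>z\<in>cube I. M x z) = wt I x \<or> (\<Sum>z\<in>cube I. M y z) = wt I y"
    by blast+
  define f where "f x = (\<Sum>y\<in>cube I. M x y) / wt I x" for x
  have row: "(\<Sum>y\<in>cube I. M x y) = wt I x * f x" for x
    using wtpos [of x] by (simp add: f_def)
  have f01: "0 \<le> f x \<and> f x \<le> 1" if "x \<in> cube I" for x
    using M(4) [OF that] wtpos [of x] by (auto simp: f_def divide_le_eq intro!: divide_nonneg_pos sum_nonneg M(1))
  have edge_sym: "edge I x y = edge I y x" for x y
    by (simp add: edge_def nu_sym)
  have supp: "f x = 0" if "x \<notin> S" for x
  proof -
    have "M x y = 0" for y using M(3) [of x y] that by (auto simp: E_def)
    then show ?thesis by (simp add: f_def)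
  qed
  have coup: "coupling I M f"
  proof -
    have "0 < edge I x y" if "M x y \<noteq> 0" for x y
      using M(3) [OF that] edge_sym [of x y] by (auto simp: E_def)
    then show ?thesis
      unfolding coupling_def using M(1,2) row by blast
  qed
  define T where "T = {x \<in> S. f x < 1}"
  have "edge I x y = 0" if "x \<in> T" "y \<in> T" for x y
  proof (rule ccontr)
    assume "edge I x y \<noteq> 0"
    then have "(x, y) \<in> E" using that edge_nonneg [of I x y] by (auto simp: E_def T_def)
    from M(5) [OF this] have "f x = 1 \<or> f y = 1" using wtpos [of x] wtpos [of y] by (auto simp: f_def)
    then show False using that by (auto simp: T_def)
  qed
  then have "dexp \<nu> I (\<lambda>x y. indicator T x * indicator T y) = 0"
    unfolding dexp_def edge_def [symmetric] by (intro sum.neutral ballI) (auto simp: indicator_def)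
  moreover have "pexp (\<lambda>_. \<mu>) I (indicator (S - T)) \<le> \<epsilon>"
  proof (rule ccontr)
    assume "\<not> ?thesis"
    then have "\<epsilon> < pexp (\<lambda>_. \<mu>) I (indicator (S - T))" by simp
    also have "\<dots> \<le> pexp (\<lambda>_. \<mu>) I f"
      by (rule pexp_mono [OF mu_nonneg]) (use f01 in \<open>auto simp: indicator_def T_def\<close>)
    finally have "\<beta> ^ budget CARD('v) (C * m) l * (1 / 2) ^ (C * m) < dexp \<nu> I (\<lambda>x y. f x * f y)"
      by (intro coupling_correlation [OF C \<beta> I m(1) f01 coup m(2) _ l])
    also have "\<dots> \<le> dexp \<nu> I (\<lambda>x y. indicator S x * indicator S y)"
    proof (rule dexp_mono [OF nu_nonneg])
      have le: "f x \<le> indicator S x" if "x \<in> cube I" for x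
        using f01 [OF that] supp [of x] by (auto simp: indicator_def)
      show "f x * f y \<le> indicator S x * indicator S y" if "x \<in> cube I" "y \<in> cube I" for x y
        using le f01 that by (intro mult_mono) auto
    qed
    finally show False using few by simp
  qed
  ultimately show ?thesis by (intro exI [of _ T]) (auto simp: T_def)
qed

end

section \<open>Tower bounds\<close>

lemma tower_add_ge: "tower n + k \<le> tower (n + k)"
proof (induction k)
  case (Suc k)
  have "tower n + Suc k \<le> Suc (tower (n + k))" using Suc by simp
  also have "\<dots> \<le> 2 ^ tower (n + k)" by (rule Suc_leI) simp
  finally show ?case by simp
qed simp

lemma le_tower: "n \<le> tower n"
  using tower_add_ge [of 0 n] by simp

lemma pow4_le_double_exp:
  fixes x :: nat
  assumes "4 \<le> x" shows "x ^ 4 \<le> 2 ^ (2 ^ x)"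
proof -
  have sq: "x\<^sup>2 \<le> 2 ^ x"
    using assms
  proof (induction x rule: nat_induct_at_least)
    case (Suc n)
    have "4 * n \<le> n * n" using Suc.hyps by (rule mult_right_mono) simp
    then have "2 * n + 1 \<le> n * n" using Suc.hyps by linarith
    then have "(Suc n)\<^sup>2 \<le> 2 * n\<^sup>2" by (simp add: power2_eq_square)
    then show ?case using Suc.IH by simp
  qed simp
  have "x ^ 4 = (x\<^sup>2)\<^sup>2" by (simp add: power_mult [symmetric])
  also have "\<dots> \<le> (2 ^ x)\<^sup>2" using sq by (rule power_mono) simp
  also have "\<dots> = 2 ^ (2 * x)" by (simp add: power_mult [symmetric] mult.commute)
  also have "\<dots> \<le> 2 ^ (2 ^ x)"
  proof (rule power_increasing)
    have "2 * x \<le> x * x" using assms by simp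
    also have "x * x \<le> 2 ^ x" using sq by (simp add: power2_eq_square)
    finally show "2 * x \<le> 2 ^ x" .
  qed simp
  finally show ?thesis .
qed

lemma tower_add_3: "tower (n + 3) = 2 ^ (2 ^ (2 ^ tower n))"
  by (simp add: numeral_3_eq_3)

text \<open>One step of the recurrence fits into three exponentials. The summands
  \<open>c + v + 4\<close> are carried along so that the base, the exponent \<open>c\<close> and the
  condition of \<open>pow4_le_double_exp\<close> are all dominated by the induction
  variable.\<close>

lemma budget_le_tower:
  assumes "c + v + 4 \<le> tower s"
  shows "budget v c k + c + v + 4 \<le> tower (s + 3 * k)"
proof (induction k)
  case 0
  then show ?case using assms by simp
next
  case (Suc k)
  define B where "B = budget v c k"
  define X where "X = B + c + v + 4"
  have X4: "4 \<le> X" by (simp add: X_def)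
  have "v \<le> 2 ^ X"
    by (rule order_trans [OF _ less_imp_le [OF less_exp]]) (simp add: X_def)
  then have "v ^ (2 * B) \<le> (2 ^ X) ^ (2 * B)" by (rule power_mono) simp
  also have "\<dots> \<le> (2 ^ X) ^ (2 * X)" by (rule power_increasing) (auto simp: X_def)
  finally have "v ^ (2 * B) * 2 ^ c \<le> (2 ^ X) ^ (2 * X) * 2 ^ X"
    by (intro mult_mono power_increasing) (auto simp: X_def)
  also have "\<dots> = 2 ^ (2 * X * X + X)" by (simp add: power_mult [symmetric] power_add mult_ac)
  finally have 1: "v ^ (2 * B) * 2 ^ c \<le> 2 ^ (2 * X * X + X)" .
  have 2: "X \<le> 2 ^ (2 * X * X + X)"
    by (rule order_trans [OF less_imp_le [OF less_exp] power_increasing]) auto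
  have "2 * X * X + X + 1 \<le> X ^ 4"
  proof -
    have "X * X \<ge> X * 4" using X4 by (intro mult_left_mono) auto
    moreover have "X ^ 4 = (X * X) * (X * X)" by (simp add: power4_eq_xxxx mult.assoc)
    moreover have "(X * X) * 16 \<le> (X * X) * (X * X)" using X4 by (intro mult_left_mono) (use mult_mono [OF X4 X4] in auto)
    ultimately show ?thesis using X4 by linarith
  qed
  also have "\<dots> \<le> 2 ^ (2 ^ X)" by (rule pow4_le_double_exp [OF X4])
  finally have 3: "2 * X * X + X + 1 \<le> 2 ^ (2 ^ X)" .
  have "budget v c (Suc k) + c + v + 4 = X + v ^ (2 * B) * 2 ^ c"
    by (simp add: X_def B_def)
  also have "\<dots> \<le> 2 ^ (2 * X * X + X + 1)" using 1 2 by simp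
  also have "\<dots> \<le> 2 ^ (2 ^ (2 ^ X))" using 3 by (rule power_increasing) simp
  also have "\<dots> \<le> 2 ^ (2 ^ (2 ^ tower (s + 3 * k)))"
    using Suc by (intro power_increasing) (auto simp: X_def B_def)
  also have "\<dots> = tower (s + 3 * k + 3)" by (rule tower_add_3 [symmetric])
  also have "s + 3 * k + 3 = s + 3 * Suc k" by simp
  finally show ?case .
qed

text \<open>The exponent is a polynomial in the budget: \<open>C + b + m\<close> further levels
  absorb the parameters, and three more absorb the polynomial and the outer power.\<close>

lemma exponent_le_tower:
  fixes b C l m v :: nat
  defines "B \<equiv> budget v (C * m) l"
  shows "2 ^ (C * (b * B + C * m + m)) \<le> tower ((C * m + v + 4) + 3 * l + C + b + m + 3)"
proof -
  define Z where "Z = B + C * m + v + 4 + C + b + m"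
  have Z4: "4 \<le> Z" by (simp add: Z_def)
  have "B + C * m + v + 4 \<le> tower ((C * m + v + 4) + 3 * l)"
    unfolding B_def by (rule budget_le_tower [OF le_tower])
  then have "Z \<le> tower ((C * m + v + 4) + 3 * l) + (C + b + m)" by (simp add: Z_def)
  also have "\<dots> \<le> tower ((C * m + v + 4) + 3 * l + (C + b + m))" by (rule tower_add_ge)
  finally have Zt: "Z \<le> tower ((C * m + v + 4) + 3 * l + C + b + m)" by (simp add: add.assoc)
  have "C * (b * B + C * m + m) \<le> Z * (Z * Z + Z + Z)"
    by (intro mult_mono add_mono) (auto simp: Z_def)
  also have "\<dots> \<le> Z ^ 4"
  proof -
    have "Z * Z + Z + Z \<le> Z * (Z * Z)"
    proof -
      have "Z * 4 \<le> Z * Z" using Z4 by (intro mult_left_mono) auto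
      moreover have "Z * (4 * Z) \<le> Z * (Z * Z)" using Z4 by (intro mult_left_mono mult_right_mono) auto
      moreover have "Z * (4 * Z) = 4 * (Z * Z)" by simp
      ultimately show ?thesis by linarith
    qed
    then show ?thesis by (simp add: power4_eq_xxxx mult.assoc)
  qed
  also have "\<dots> \<le> 2 ^ (2 ^ Z)" by (rule pow4_le_double_exp [OF Z4])
  finally have "2 ^ (C * (b * B + C * m + m)) \<le> (2::nat) ^ (2 ^ (2 ^ Z))"
    by (rule power_increasing) simp
  also have "\<dots> \<le> 2 ^ (2 ^ (2 ^ tower ((C * m + v + 4) + 3 * l + C + b + m)))"
    using Zt by (intro power_increasing) auto
  also have "\<dots> = tower ((C * m + v + 4) + 3 * l + C + b + m + 3)"
    by (rule tower_add_3 [symmetric])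
  finally show ?thesis .
qed

text \<open>The accuracy \<open>m'\<close> of the junta step is set so that the edges among the
  heavy vertices \<open>S\<close> fall below the threshold of \<open>edge_removal\<close>. Light
  vertices and removed ones cost at most \<open>\<epsilon>\<close> each; hence
  \<open>2 * \<epsilon>\<close> here and \<open>\<epsilon> / 2\<close> in the final bounds.\<close>

lemma (in spectral_chain) almost_in_junta:
  assumes C: "Junta C" and b: "\<And>x y. 0 < \<nu> x y \<Longrightarrow> (1 / 2) ^ b \<le> \<nu> x y"
    and I: "finite I" and m: "4 \<le> m" "16 * (1 / 2) ^ m \<le> \<epsilon>" and l: "40 * ln (1 / \<epsilon>) \<le> real l"
    and g: "\<And>x. x \<in> cube I \<Longrightarrow> 0 \<le> g x \<and> g x \<le> 1"
  defines "m' \<equiv> b * budget CARD('v) (C * m) l + C * m + m"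
  assumes small: "dexp \<nu> I (\<lambda>x y. g x * g y) \<le> (1 / 2) ^ (C * m')"
  shows "\<exists>J T. J \<subseteq> I \<and> card J \<le> 2 ^ (C * m') \<and> T \<subseteq> cube J \<and> dexp \<nu> J (\<lambda>x y. indicator T x * indicator T y) = 0 \<and>
    pexp (\<lambda>_. \<mu>) J (\<lambda>x. indicator (cube J - T) x * avg I J g x) \<le> 2 * \<epsilon>"
proof -
  have m': "1 \<le> m'" using m(1) by (simp add: m'_def)
  obtain J where J: "J \<subseteq> I" "card J \<le> 2 ^ (C * m')"
    "dexp \<nu> J (\<lambda>x y. of_bool ((1 / 2) ^ m' \<le> avg I J g x \<and> (1 / 2) ^ m' \<le> avg I J g y)) \<le> (1 / 2) ^ m'"
    using JuntaD [OF C m' I g g small] by blast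
  have fin: "finite J" using J(1) I finite_subset by blast
  define S where "S = {x \<in> cube J. (1 / 2) ^ m' \<le> avg I J g x}"
  have "dexp \<nu> J (\<lambda>x y. indicator S x * indicator S y) =
     dexp \<nu> J (\<lambda>x y. of_bool ((1 / 2) ^ m' \<le> avg I J g x \<and> (1 / 2) ^ m' \<le> avg I J g y))"
    by (rule dexp_cong) (auto simp: S_def indicator_def)
  also have "\<dots> \<le> (1 / 2) ^ m'" by (rule J(3))
  also have "\<dots> \<le> ((1 / 2) ^ b) ^ budget CARD('v) (C * m) l * (1 / 2) ^ (C * m)"
    unfolding power_mult [symmetric] power_add [symmetric] m'_def by (rule power_decreasing) auto
  finally have few: "dexp \<nu> J (\<lambda>x y. indicator S x * indicator S y) \<le> ((1 / 2) ^ b) ^ budget CARD('v) (C * m) l * (1 / 2) ^ (C * m)" .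
  obtain T where T: "T \<subseteq> S" "dexp \<nu> J (\<lambda>x y. indicator T x * indicator T y) = 0"
      "pexp (\<lambda>_. \<mu>) J (indicator (S - T)) \<le> \<epsilon>"
    using edge_removal [OF C b _ _ fin m l _ few] by (auto simp: S_def power_le_one)
  have le\<epsilon>: "(1 / 2) ^ m' \<le> \<epsilon>"
  proof -
    have "(1 / 2 :: real) ^ m' \<le> (1 / 2) ^ m" by (rule power_decreasing) (auto simp: m'_def)
    moreover have "0 \<le> (1 / 2 :: real) ^ m" by simp
    ultimately show ?thesis using m(2) by linarith
  qed
  have "pexp (\<lambda>_. \<mu>) J (\<lambda>x. indicator (cube J - T) x * avg I J g x) \<le> pexp (\<lambda>_. \<mu>) J (\<lambda>x. indicator (S - T) x + \<epsilon>)"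
  proof (rule pexp_mono [OF mu_nonneg])
    fix x :: "nat \<Rightarrow> 'v" assume x: "x \<in> cube J"
    have a: "0 \<le> avg I J g x" "avg I J g x \<le> 1"
      using avg_nonneg [where f = g and x = x, OF J(1)] avg_le_1 [where f = g and x = x, OF I J(1)] g by blast+
    have "0 \<le> \<epsilon>" by (rule order_trans [OF _ le\<epsilon>]) simp
    then show "indicator (cube J - T) x * avg I J g x \<le> indicator (S - T) x + \<epsilon>"
      using a x le\<epsilon> by (cases "x \<in> S") (auto simp: indicator_def S_def)
  qed
  also have "\<dots> \<le> 2 * \<epsilon>"
    unfolding pexp_add pexp_mu_const [OF fin] using T(3) by simp
  finally show ?thesis
    using J T(1,2) by (intro exI [of _ J] exI [of _ T]) (auto simp: S_def)
qed

section \<open>Choice of the parameters\<close>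

lemma inner_prod_chain_op:
  "inner_prod A J f (chain_op A J g) =
    dexp (\<lambda>x y. stationary_measure A $ x * A $ x $ y) J (\<lambda>x y. f x * g y)"
  by (simp add: inner_prod_def expect_def chain_op_def dexp_def sum_distrib_left prod.distrib mult_ac)

text \<open>The exponent \<open>2 * a + 4\<close> turns the factor 16 into
  \<open>(1 / 4) ^ a\<close>, and \<open>exp 1 \<le> 4\<close> does the rest. For
  \<open>\<eta> \<ge> 1\<close> the logarithm is at most 0 and \<open>nat\<close> gives
  \<open>a = 0\<close>.\<close>

lemma log_param:
  fixes \<eta> :: real
  assumes "0 < \<eta>"
  defines "a \<equiv> nat \<lceil>ln (1 / \<eta>)\<rceil>"
  shows "16 * (1 / 2) ^ (2 * a + 4) \<le> \<eta>" "40 * ln (1 / \<eta>) \<le> real (40 * a)"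
proof -
  have la: "ln (1 / \<eta>) \<le> real a"
    by (simp add: a_def) linarith
  then show "40 * ln (1 / \<eta>) \<le> real (40 * a)" by simp
  have "1 / \<eta> = exp (ln (1 / \<eta>))" using assms by simp
  also have "\<dots> \<le> exp (real a)" using la by simp
  also have "\<dots> = exp 1 ^ a" by (simp add: exp_of_nat_mult [symmetric])
  also have "\<dots> \<le> 4 ^ a" using exp_le by (intro power_mono) auto
  finally have "1 / \<eta> \<le> 4 ^ a" .
  then have "1 / 4 ^ a \<le> \<eta>" using assms by (simp add: field_simps)
  moreover have "16 * (1 / 2 :: real) ^ (2 * a + 4) = 1 / 4 ^ a"
    by (simp add: power_add power_mult power_one_over)
  ultimately show "16 * (1 / 2) ^ (2 * a + 4) \<le> \<eta>" by simp
qed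

lemma bigo_log_param:
  "(\<lambda>\<eta>::real. real (p * nat \<lceil>ln (1 / \<eta>)\<rceil> + q)) \<in> O[at_right 0](\<lambda>\<eta>. ln (1 / \<eta>))"
proof (rule bigoI)
  \<comment> \<open>Below \<open>exp (-1)\<close> the logarithm exceeds 1, so rounding up at most
    doubles it and the constant \<open>q\<close> is dominated.\<close>
  have "\<forall>\<^sub>F \<eta> in at_right (0::real). \<eta> \<in> {0<..<exp (-1)}"
    by (rule eventually_at_right_real) simp
  then show "\<forall>\<^sub>F \<eta> in at_right (0::real). norm (real (p * nat \<lceil>ln (1 / \<eta>)\<rceil> + q)) \<le> real (2 * p + q) * norm (ln (1 / \<eta>))"
  proof (rule eventually_mono)
    fix \<eta> :: real assume "\<eta> \<in> {0<..<exp (-1)}"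
    then have \<eta>: "0 < \<eta>" "\<eta> < exp (-1)" by auto
    then have "ln \<eta> < -1" by (metis ln_exp ln_less_cancel_iff exp_gt_zero)
    then have L: "1 \<le> ln (1 / \<eta>)" using \<eta> by (simp add: ln_div)
    define L where "L = ln (1 / \<eta>)"
    have "real (nat \<lceil>L\<rceil>) \<le> 2 * L" using L by (simp add: L_def [symmetric]) linarith
    then have "real p * real (nat \<lceil>L\<rceil>) \<le> real p * (2 * L)" by (intro mult_left_mono) auto
    moreover have "real q * 1 \<le> real q * L" using L by (intro mult_left_mono) (auto simp: L_def)
    ultimately have "real (p * nat \<lceil>L\<rceil> + q) \<le> real (2 * p + q) * L" by (simp add: algebra_simps)
    then show "norm (real (p * nat \<lceil>ln (1 / \<eta>)\<rceil> + q)) \<le> real (2 * p + q) * norm (ln (1 / \<eta>))"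
      using L by (simp add: L_def)
  qed
qed

theorem corollary3p2:
  fixes A :: "real^'v^'v"
  assumes "transition_matrix A" and "reversible_chain A"
    and "irreducible_chain A" and "aperiodic_chain A"
  shows "(\<forall>\<epsilon>>0. \<exists>\<delta>>0. \<exists>j\<ge>1. almost_in_juntas A \<epsilon> \<delta> j) \<and>
    (\<exists>c>0. \<exists>h. (\<lambda>\<eta>. real (h \<eta>)) \<in> O[at_right 0](\<lambda>\<eta>. ln (1 / \<eta>)) \<and>
       (\<forall>\<epsilon>>0. 0 < \<delta>\<^sub>1 c (\<delta>\<^sub>2 h (\<epsilon> / 2)) \<and> 1 \<le> nat \<lfloor>j\<^sub>1 c (\<delta>\<^sub>2 h (\<epsilon> / 2))\<rfloor> \<and>
          almost_in_juntas A \<epsilon> (\<delta>\<^sub>1 c (\<delta>\<^sub>2 h (\<epsilon> / 2))) (nat \<lfloor>j\<^sub>1 c (\<delta>\<^sub>2 h (\<epsilon> / 2))\<rfloor>)))"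
proof -
  define \<mu> where "\<mu> = ($) (stationary_measure A)"
  define \<nu> where "\<nu> = (\<lambda>x y. stationary_measure A $ x * A $ x $ y)"
  obtain \<phi> lam \<kappa> and v0 :: 'v where "spectral_chain \<mu> \<nu> \<phi> lam v0 \<kappa>"
    unfolding \<mu>_def \<nu>_def using ex_spectral_chain [OF assms(1,3,2,4)] by blast
  then interpret spectral_chain \<mu> \<nu> \<phi> lam v0 \<kappa> .
  have "\<exists>C. Junta C"
    unfolding Junta_def by (rule junta_approximation)
  then obtain C where C: "Junta C" by blast
  \<comment> \<open>A positive lower bound for all positive edge weights; the inserted 1 keeps the
    minimum over a non-empty set.\<close>
  define e where "e = Min (insert 1 {\<nu> x y |x y. 0 < \<nu> x y})"
  have fin: "finite {\<nu> x y |x y. 0 < \<nu> x y}"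
    by (rule finite_subset [of _ "(\<lambda>(x, y). \<nu> x y) ` UNIV"]) auto
  then have epos: "0 < e" by (auto simp: e_def)
  have ele: "e \<le> \<nu> x y" if "0 < \<nu> x y" for x y
    unfolding e_def using fin that by (intro Min_le) auto
  obtain b where "(1 / 2) ^ b < e"
    using real_arch_pow_inv [OF epos, of "1 / 2"] by auto
  then have b: "(1 / 2) ^ b \<le> \<nu> x y" if "0 < \<nu> x y" for x y
    using ele [OF that] by linarith
  define a where "a \<eta> = nat \<lceil>ln (1 / \<eta>)\<rceil>" for \<eta> :: real
  \<comment> \<open>The height in \<open>exponent_le_tower\<close> for
    \<open>m = 2 * a \<eta> + 4\<close> and \<open>l = 40 * a \<eta>\<close>, rearranged as a linear
    function of \<open>a \<eta>\<close>.\<close>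
  define h where "h \<eta> = (2 * C + 122) * a \<eta> + (4 * C + CARD('v) + 4 + C + b + 4 + 3)" for \<eta>
  have bigo: "(\<lambda>\<eta>. real (h \<eta>)) \<in> O[at_right 0](\<lambda>\<eta>. ln (1 / \<eta>))"
    unfolding h_def a_def by (rule bigo_log_param)
  have T0: "0 < tower n" for n by (cases n) auto
  \<comment> \<open>The constant \<open>c\<close> is taken to be 1: the height \<open>h\<close>
    already includes the polynomial dependence of \<open>\<delta>\<close> and \<open>j\<close> on
    the accuracy of the junta step.\<close>
  have d1: "\<delta>\<^sub>1 1 (\<delta>\<^sub>2 h \<eta>) = 1 / real (tower (h \<eta>))" for \<eta>
    using T0 by (simp add: \<delta>\<^sub>1_def \<delta>\<^sub>2_def)
  have j1: "nat \<lfloor>j\<^sub>1 1 (\<delta>\<^sub>2 h \<eta>)\<rfloor> = tower (h \<eta>)" for \<eta>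
    using T0 [of "h \<eta>"] by (simp add: j\<^sub>1_def \<delta>\<^sub>2_def powr_minus)
  have main: "almost_in_juntas A \<epsilon> (1 / real (tower (h (\<epsilon> / 2)))) (tower (h (\<epsilon> / 2)))" if \<epsilon>: "0 < \<epsilon>" for \<epsilon>
    unfolding almost_in_juntas_def
  proof (intro allI impI)
    fix n :: nat and g :: "(nat \<Rightarrow> 'v) \<Rightarrow> real"
    assume g: "\<forall>x\<in>cube {1..n}. 0 \<le> g x \<and> g x \<le> 1"
      and corr: "inner_prod A {1..n} g (chain_op A {1..n} g) < 1 / real (tower (h (\<epsilon> / 2)))"
    define I where "I = {1..n}"
    define \<eta> where "\<eta> = \<epsilon> / 2"
    define m where "m = 2 * a \<eta> + 4"
    define l where "l = 40 * a \<eta>"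
    define m' where "m' = b * budget CARD('v) (C * m) l + C * m + m"
    have \<eta>: "0 < \<eta>" using \<epsilon> by (simp add: \<eta>_def)
    have "h \<eta> = (C * m + CARD('v) + 4) + 3 * l + C + b + m + 3"
      by (simp add: h_def m_def l_def algebra_simps)
    then have tw: "2 ^ (C * m') \<le> tower (h \<eta>)"
      unfolding m'_def by (simp only: exponent_le_tower)
    then have "2 ^ (C * m') \<le> real (tower (h \<eta>))"
      by (metis of_nat_le_iff of_nat_numeral of_nat_power)
    then have "1 / real (tower (h \<eta>)) \<le> (1 / 2) ^ (C * m')"
      unfolding power_one_over by (intro divide_left_mono) (use T0 [of "h \<eta>"] in auto)
    then have "dexp \<nu> I (\<lambda>x y. g x * g y) \<le> (1 / 2) ^ (C * m')"
      using corr by (simp add: inner_prod_chain_op \<nu>_def I_def \<eta>_def)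
    then obtain J T where JT: "J \<subseteq> I" "card J \<le> 2 ^ (C * m')" "T \<subseteq> cube J" "dexp \<nu> J (\<lambda>x y. indicator T x * indicator T y) = 0"
        "pexp (\<lambda>_. \<mu>) J (\<lambda>x. indicator (cube J - T) x * avg I J g x) \<le> 2 * \<eta>"
      using almost_in_junta [OF C b, where I = I and m = m and \<epsilon> = \<eta> and l = l and g = g, folded m'_def]
        log_param [OF \<eta>, folded a_def] g by (auto simp: m_def l_def I_def)
    have ex: "expect A K f = pexp (\<lambda>_. \<mu>) K f" for K f
      by (simp add: expect_def pexp_def \<mu>_def)
    have "restr n J g = fibre I J g"
      by (simp add: restr_def fibre_def I_def fun_eq_iff)
    then have "expect A J (\<lambda>x. indicator (cube J - T) x * expect A ({1..n} - J) (restr n J g x)) \<le> \<epsilon>"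
      using JT(5) by (simp add: ex avg_def I_def \<eta>_def)
    moreover have "inner_prod A J (indicator T) (chain_op A J (indicator T)) = 0"
      using JT(4) by (simp add: inner_prod_chain_op \<nu>_def)
    moreover have "card J \<le> tower (h (\<epsilon> / 2))"
      using JT(2) tw by (simp add: \<eta>_def)
    ultimately show "\<exists>J T. J \<subseteq> {1..n} \<and> card J \<le> tower (h (\<epsilon> / 2)) \<and> T \<subseteq> cube J \<and>
           inner_prod A J (indicator T) (chain_op A J (indicator T)) = 0 \<and>
           expect A J (\<lambda>x. indicator (cube J - T) x * expect A ({1..n} - J) (restr n J g x)) \<le> \<epsilon>"
      using JT(1,3) by (auto simp: I_def)
  qed
  have quant: "0 < \<delta>\<^sub>1 1 (\<delta>\<^sub>2 h (\<epsilon> / 2)) \<and> 1 \<le> nat \<lfloor>j\<^sub>1 1 (\<delta>\<^sub>2 h (\<epsilon> / 2))\<rfloor> \<and>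
      almost_in_juntas A \<epsilon> (\<delta>\<^sub>1 1 (\<delta>\<^sub>2 h (\<epsilon> / 2))) (nat \<lfloor>j\<^sub>1 1 (\<delta>\<^sub>2 h (\<epsilon> / 2))\<rfloor>)" if "0 < \<epsilon>" for \<epsilon>
    unfolding d1 j1 using main [OF that] T0 [of "h (\<epsilon> / 2)"] by simp
  show ?thesis
  proof (intro conjI allI impI)
    show "\<exists>\<delta>>0. \<exists>j\<ge>1. almost_in_juntas A \<epsilon> \<delta> j" if "0 < \<epsilon>" for \<epsilon>
      using quant [OF that] by blast
    show "\<exists>c>0. \<exists>h. (\<lambda>\<eta>. real (h \<eta>)) \<in> O[at_right 0](\<lambda>\<eta>. ln (1 / \<eta>)) \<and>
       (\<forall>\<epsilon>>0. 0 < \<delta>\<^sub>1 c (\<delta>\<^sub>2 h (\<epsilon> / 2)) \<and> 1 \<le> nat \<lfloor>j\<^sub>1 c (\<delta>\<^sub>2 h (\<epsilon> / 2))\<rfloor> \<and>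
          almost_in_juntas A \<epsilon> (\<delta>\<^sub>1 c (\<delta>\<^sub>2 h (\<epsilon> / 2))) (nat \<lfloor>j\<^sub>1 c (\<delta>\<^sub>2 h (\<epsilon> / 2))\<rfloor>))"
      by (intro exI [of _ 1] exI [of _ h] conjI allI impI bigo quant) auto
  qed
qed

end
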